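(* Let $1\le p\le\infty$, $f\in L^p(K,\mu)$, and let $u(t,x)$ be either the Dirichlet Poisson integral of $f$ ($u(t,x)=\mathcal P^D_tf(x)$) or the Neumann Poisson integral of $f$ ($u(t,x)=\mathcal P^N_tf(x)$). Let $\alpha>0$. Then: (1) There exists $A_\alpha>0$ such that, for every $x\in K$, $$\sup_{(t,y)\in\Gamma_\alpha(x)}|u(t,y)|\le A_\alpha\,Mf(x),$$ where $Mf$ is the maximal function of $f$. (2) For $\mu$-almost every $x\in K$, $$\lim_{\substack{(t,y)\to(0,x)\\ (t,y)\in\Gamma_\alpha(x)}}u(t,y)=f(x).$$
   Context: Setting. $(K,S,\{F_i\}_{i\in S})$ is a self-similar structure ($S$ finite, $K$ compact metrizable, $F_i:K\to K$ continuous injections, with a continuous surjection $\pi:S^{\mathbb N}\to K$ satisfying $\pi(i\omega)=F_i(\pi(\omega))$). $W_m=S^m$, $W_*=\bigcup_{m\ge0}W_m$; for $w=w_1\cdots w_m$, $F_w=F_{w_1}\circ\cdots\circ F_{w_m}$, and $r_w=r_{w_1}\cdots r_{w_m}$ for numbers $r_i$. The critical set is $\mathcal C=\bigcup_{i\ne j}F_i(K)\cap F_j(K)$ and the boundary is $V_0=\{p\in K:\ F_w(p)\in\mathcal C\text{ for some nonempty word }w\}$. $K$ is assumed post-critically finite: $V_0$ is finite, and $V_0\neq\emptyset$. $V_m=\bigcup_{w\in W_m}F_w(V_0)$. A regular harmonic structure $(D,\mathbf r)$ is fixed: $\mathbf r=(r_i)_{i\in S}$ with $0<r_i<1$; $D$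 is a real symmetric matrix indexed by $V_0$ with nonnegative off-diagonal entries, nonpositive definite, with kernel exactly the constants; with $\mathcal E_0(u,v)=-\sum_{p,q}u(p)D_{pq}v(q)$ and $\mathcal E_m(u,v)=\sum_{w\in W_m}r_w^{-1}\mathcal E_0(u\circ F_w|_{V_0},v\circ F_w|_{V_0})$, one has $\mathcal E_0(u,u)=\min\{\mathcal E_1(v,v):v|_{V_0}=u\}$. The Dirichlet form is $\mathcal E(u,v)=\lim_m\mathcal E_m(u|_{V_m},v|_{V_m})$ on $\mathcal F=\{u\in C(K):\lim_m\mathcal E_m(u,u)<\infty\}$, and $\mathcal F_0=\{u\in\mathcal F:u|_{V_0}=0\}$. The effective resistance metric is $R(x,y)=\sup\{|u(x)-u(y)|^2/\mathcal E(u,u):u\in\mathcal F,\ \mathcal E(u,u)>0\}$; it induces the topology of $K$. $d$ is the unique real number with $\sum_{i\in S}r_i^d=1$, and $\mu$ is the self-similar (Bernoulli) probability measure on $K$ with weights $\mu_i=r_i^d$. $B_\varepsilon(x)$ is the $R$-ball of radius $\varepsilon$ about $x$. $\mathbb R_+=(0,\infty)$. Maximal function: $Mf(x)=\sup_{\varepsilon>0}\frac1{\mu(B_\varepsilon(x))}\int_{B_\varepsilon(x)}|f|\,d\mu$. Laplacian: $u\in\mathcal D$ and $\Delta u=g$ mean $u\in\mathcal F$, $g\in C(K)$ and $\mathcal E(u,v)=-\int_Kgv\,d\mu$ for all $v\in\mathcal F_0$. The Neumann derivative $du(p)$, $p\in V_0$, of $u\in\mathcal D$ is determined by $\mathcal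 E(u,v)=\sum_{p\in V_0}v(p)\,du(p)-\int_Kv\,\Delta u\,d\mu$ for all $v\in\mathcal F$. $\mathcal D_D=\{u\in\mathcal D:u|_{V_0}=0\}$, $\mathcal D_N=\{u\in\mathcal D:du=0\text{ on }V_0\}$. For $b\in\{D,N\}$ there are eigenvalues $0\le\lambda^b_1\le\lambda^b_2\le\cdots$ (with multiplicity) and real-valued $\phi^b_n\in\mathcal D_b$ with $\Delta\phi^b_n=-\lambda^b_n\phi^b_n$ such that $\{\phi^b_n\}_{n\ge1}$ is a complete orthonormal system of $L^2(K,\mu)$. Poisson kernel: for $b=D$ (Dirichlet) or $b=N$ (Neumann), $P^b(t,x,y)=\sum_{n\ge1}e^{-\sqrt{\lambda^b_n}\,t}\phi^b_n(x)\phi^b_n(y)$ on $\mathbb R_+\times K\times K$ (the series converges uniformly on $[T,\infty)\times K\times K$ for every $T>0$). The Poisson integral of $f\in L^1(K,\mu)$ is $\mathcal P^b_tf(x)=\int_KP^b(t,x,y)f(y)\,d\mu(y)$. Cones: $\Gamma_\alpha(x)=\{(t,y)\in\mathbb R_+\times K:R(x,y)^{d+1}<\alpha t^2\}$.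
   Formalization: "Post-critically finite" is taken in Kigami's sense: the set of shifted codes of critical points is finite, not only V_0. With V_0 finite alone, part (1) fails, e.g. on a six-cell diamond fractal whose boundary points have infinitely many codes. *)

theory Defs
  imports "HOL-Probability.Probability"
begin

text \<open>
  The compact metrizable space \<open>K\<close> is the whole type \<open>'a::metric_space\<close>, assumed compact; only the
  topology of the ambient metric is ever used.  The index set \<open>S\<close> is the finite type \<open>'i\<close>, words
  are lists over \<open>'i\<close>, and \<open>S\<^sup>\<nat>\<close> is \<open>nat \<Rightarrow> 'i\<close> with the product of the discrete topologies.
\<close>

section \<open>Self-similar structures\<close>

definition self_similar_structure ::
    "('i::finite \<Rightarrow> 'a::metric_space \<Rightarrow> 'a) \<Rightarrow> ((nat \<Rightarrow> 'i) \<Rightarrow> 'a) \<Rightarrow> bool" where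
  "self_similar_structure F \<pi> \<longleftrightarrow>
     compact (UNIV :: 'a set) \<and>
     (\<forall>i. continuous_on UNIV (F i) \<and> inj (F i)) \<and>
     continuous_map (product_topology (\<lambda>_::nat. discrete_topology (UNIV :: 'i set)) UNIV)
       euclidean \<pi> \<and>
     surj \<pi> \<and>
     (\<forall>i \<omega>. \<pi> (case_nat i \<omega>) = F i (\<pi> \<omega>))"

definition words :: "nat \<Rightarrow> 'i::finite list set" where
  "words m = {w. length w = m}"

fun Fw :: "('i \<Rightarrow> 'a \<Rightarrow> 'a) \<Rightarrow> 'i list \<Rightarrow> 'a \<Rightarrow> 'a" where
  "Fw F [] = id"
| "Fw F (i # w) = F i \<circ> Fw F w"

definition rw :: "('i \<Rightarrow> real) \<Rightarrow> 'i list \<Rightarrow> real" where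
  "rw r w = prod_list (map r w)"

definition critical_set :: "('i \<Rightarrow> 'a \<Rightarrow> 'a) \<Rightarrow> 'a set" where
  "critical_set F = (\<Union>i. \<Union>j\<in>-{i}. range (F i) \<inter> range (F j))"

definition V0 :: "('i \<Rightarrow> 'a \<Rightarrow> 'a) \<Rightarrow> 'a set" where
  "V0 F = {p. \<exists>w. w \<noteq> [] \<and> Fw F w p \<in> critical_set F}"

text \<open>
  Post-critical finiteness in the usual sense: the set of all proper shifts of codes of critical
  points is finite.  Its image under \<open>\<pi>\<close> is \<open>V0 F\<close>, so finiteness of \<open>V0 F\<close> is a consequence, stated
  for emphasis.  Finiteness of \<open>V0 F\<close> by itself is weaker: hierarchical diamond-type fractals have a
  two-point boundary, but boundary points with uncountably many codes, and are not post-critically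
  finite.
\<close>

definition post_critical_set ::
    "('i \<Rightarrow> 'a \<Rightarrow> 'a) \<Rightarrow> ((nat \<Rightarrow> 'i) \<Rightarrow> 'a) \<Rightarrow> (nat \<Rightarrow> 'i) set" where
  "post_critical_set F \<pi> = {(\<lambda>k. \<omega> (n + k)) | n \<omega>. 1 \<le> n \<and> \<pi> \<omega> \<in> critical_set F}"

definition post_critically_finite ::
    "('i \<Rightarrow> 'a \<Rightarrow> 'a) \<Rightarrow> ((nat \<Rightarrow> 'i) \<Rightarrow> 'a) \<Rightarrow> bool" where
  "post_critically_finite F \<pi> \<longleftrightarrow> finite (post_critical_set F \<pi>) \<and> finite (V0 F)"

definition self_similar_measure ::
    "('i::finite \<Rightarrow> 'a::metric_space \<Rightarrow> 'a) \<Rightarrow> ('i \<Rightarrow> real) \<Rightarrow> 'a measure \<Rightarrow> bool" where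
  "self_similar_measure F m \<mu> \<longleftrightarrow>
     prob_space \<mu> \<and> sets \<mu> = sets borel \<and>
     (\<forall>A\<in>sets borel. emeasure \<mu> A = (\<Sum>i\<in>UNIV. ennreal (m i) * emeasure \<mu> (F i -` A)))"

section \<open>Harmonic structures, Dirichlet form and effective resistance\<close>

text \<open>
  Functions on \<open>V\<^sub>m\<close> are represented by functions on the whole space: since \<open>F\<^sub>w\<close> maps \<open>V\<^sub>0\<close> into
  \<open>V\<^sub>m\<close> for words of length \<open>m\<close>, \<open>Em F r D m u v\<close> only depends on the restrictions to \<open>V\<^sub>m\<close>.
\<close>

definition E0 :: "('i \<Rightarrow> 'a \<Rightarrow> 'a) \<Rightarrow> ('a \<Rightarrow> 'a \<Rightarrow> real) \<Rightarrow> ('a \<Rightarrow> real) \<Rightarrow> ('a \<Rightarrow> real) \<Rightarrow> real" where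
  "E0 F D u v = - (\<Sum>p\<in>V0 F. \<Sum>q\<in>V0 F. u p * D p q * v q)"

definition Em ::
    "('i::finite \<Rightarrow> 'a \<Rightarrow> 'a) \<Rightarrow> ('i \<Rightarrow> real) \<Rightarrow> ('a \<Rightarrow> 'a \<Rightarrow> real) \<Rightarrow> nat \<Rightarrow>
     ('a \<Rightarrow> real) \<Rightarrow> ('a \<Rightarrow> real) \<Rightarrow> real" where
  "Em F r D m u v = (\<Sum>w\<in>words m. inverse (rw r w) * E0 F D (u \<circ> Fw F w) (v \<circ> Fw F w))"

definition regular_harmonic_structure ::
    "('i::finite \<Rightarrow> 'a \<Rightarrow> 'a) \<Rightarrow> ('i \<Rightarrow> real) \<Rightarrow> ('a \<Rightarrow> 'a \<Rightarrow> real) \<Rightarrow> bool" where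
  "regular_harmonic_structure F r D \<longleftrightarrow>
     (\<forall>i. 0 < r i \<and> r i < 1) \<and>
     (\<forall>p\<in>V0 F. \<forall>q\<in>V0 F. D p q = D q p) \<and>
     (\<forall>p\<in>V0 F. \<forall>q\<in>V0 F. p \<noteq> q \<longrightarrow> 0 \<le> D p q) \<and>
     (\<forall>u. (\<Sum>p\<in>V0 F. \<Sum>q\<in>V0 F. u p * D p q * u q) \<le> 0) \<and>
     (\<forall>u. (\<forall>p\<in>V0 F. (\<Sum>q\<in>V0 F. D p q * u q) = 0) \<longleftrightarrow> (\<exists>c. \<forall>p\<in>V0 F. u p = c)) \<and>
     (\<forall>u. let X = {Em F r D 1 v v | v. \<forall>p\<in>V0 F. v p = u p}
           in E0 F D u u \<in> X \<and> (\<forall>e\<in>X. E0 F D u u \<le> e))"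

definition energy ::
    "('i::finite \<Rightarrow> 'a \<Rightarrow> 'a) \<Rightarrow> ('i \<Rightarrow> real) \<Rightarrow> ('a \<Rightarrow> 'a \<Rightarrow> real) \<Rightarrow>
     ('a \<Rightarrow> real) \<Rightarrow> ('a \<Rightarrow> real) \<Rightarrow> real" where
  "energy F r D u v = lim (\<lambda>m. Em F r D m u v)"

text \<open>\<open>Em F r D m u u\<close> is nondecreasing in \<open>m\<close>, so its limit is finite iff it converges in \<open>\<real>\<close>.\<close>

definition dom_energy ::
    "('i::finite \<Rightarrow> 'a::metric_space \<Rightarrow> 'a) \<Rightarrow> ('i \<Rightarrow> real) \<Rightarrow> ('a \<Rightarrow> 'a \<Rightarrow> real) \<Rightarrow> ('a \<Rightarrow> real) set" where
  "dom_energy F r D = {u. continuous_on UNIV u \<and> convergent (\<lambda>m. Em F r D m u u)}"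

definition dom_energy0 ::
    "('i::finite \<Rightarrow> 'a::metric_space \<Rightarrow> 'a) \<Rightarrow> ('i \<Rightarrow> real) \<Rightarrow> ('a \<Rightarrow> 'a \<Rightarrow> real) \<Rightarrow> ('a \<Rightarrow> real) set" where
  "dom_energy0 F r D = {u \<in> dom_energy F r D. \<forall>p\<in>V0 F. u p = 0}"

definition eff_res ::
    "('i::finite \<Rightarrow> 'a::metric_space \<Rightarrow> 'a) \<Rightarrow> ('i \<Rightarrow> real) \<Rightarrow> ('a \<Rightarrow> 'a \<Rightarrow> real) \<Rightarrow> 'a \<Rightarrow> 'a \<Rightarrow> ennreal" where
  "eff_res F r D x y =
     (SUP u\<in>{u \<in> dom_energy F r D. 0 < energy F r D u u}.
        ennreal (\<bar>u x - u y\<bar>\<^sup>2 / energy F r D u u))"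

definition res ::
    "('i::finite \<Rightarrow> 'a::metric_space \<Rightarrow> 'a) \<Rightarrow> ('i \<Rightarrow> real) \<Rightarrow> ('a \<Rightarrow> 'a \<Rightarrow> real) \<Rightarrow> 'a \<Rightarrow> 'a \<Rightarrow> real" where
  "res F r D x y = enn2real (eff_res F r D x y)"

text \<open>
  The standing assumption that the effective resistance is a (finite) metric inducing the topology
  of \<open>K\<close>.  It holds whenever \<open>K\<close> is connected, but does not follow from the clauses of
  \<open>regular_harmonic_structure\<close> alone: if \<open>K\<close> is the disjoint union of an interval-like part and a
  copy of \<open>K\<close> that does not meet \<open>V\<^sub>0\<close>, the supremum defining \<open>eff_res\<close> is infinite.
\<close>

definition resistance_metrizes ::
    "('i::finite \<Rightarrow> 'a::metric_space \<Rightarrow> 'a) \<Rightarrow> ('i \<Rightarrow> real) \<Rightarrow> ('a \<Rightarrow> 'a \<Rightarrow> real) \<Rightarrow> bool" where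
  "resistance_metrizes F r D \<longleftrightarrow>
     (\<forall>x y. eff_res F r D x y < top) \<and>
     Metric_space UNIV (res F r D) \<and>
     Metric_space.mtopology UNIV (res F r D) = (euclidean :: 'a topology)"

definition res_ball ::
    "('i::finite \<Rightarrow> 'a::metric_space \<Rightarrow> 'a) \<Rightarrow> ('i \<Rightarrow> real) \<Rightarrow> ('a \<Rightarrow> 'a \<Rightarrow> real) \<Rightarrow> 'a \<Rightarrow> real \<Rightarrow> 'a set" where
  "res_ball F r D x e = {y. res F r D x y < e}"

section \<open>Laplacian, Neumann derivative and eigenfunctions\<close>

text \<open>\<open>has_laplacian F r D \<mu> u g\<close> means \<open>u \<in> \<D>\<close> and \<open>\<Delta> u = g\<close>.\<close>

definition has_laplacian ::
    "('i::finite \<Rightarrow> 'a::metric_space \<Rightarrow> 'a) \<Rightarrow> ('i \<Rightarrow> real) \<Rightarrow> ('a \<Rightarrow> 'a \<Rightarrow> real) \<Rightarrow> 'a measure \<Rightarrow>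
     ('a \<Rightarrow> real) \<Rightarrow> ('a \<Rightarrow> real) \<Rightarrow> bool" where
  "has_laplacian F r D \<mu> u g \<longleftrightarrow>
     u \<in> dom_energy F r D \<and> continuous_on UNIV g \<and>
     (\<forall>v\<in>dom_energy0 F r D. energy F r D u v = - (LINT x|\<mu>. g x * v x))"

text \<open>\<open>has_neumann_derivative F r D \<mu> u \<eta>\<close> means \<open>u \<in> \<D>\<close> and \<open>du = \<eta>\<close> on \<open>V\<^sub>0\<close>.\<close>

definition has_neumann_derivative ::
    "('i::finite \<Rightarrow> 'a::metric_space \<Rightarrow> 'a) \<Rightarrow> ('i \<Rightarrow> real) \<Rightarrow> ('a \<Rightarrow> 'a \<Rightarrow> real) \<Rightarrow> 'a measure \<Rightarrow>
     ('a \<Rightarrow> real) \<Rightarrow> ('a \<Rightarrow> real) \<Rightarrow> bool" where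
  "has_neumann_derivative F r D \<mu> u \<eta> \<longleftrightarrow>
     (\<exists>g. has_laplacian F r D \<mu> u g \<and>
        (\<forall>v\<in>dom_energy F r D.
           energy F r D u v = (\<Sum>p\<in>V0 F. v p * \<eta> p) - (LINT x|\<mu>. v x * g x)))"

datatype boundary_condition = Dirichlet | Neumann

fun dom_laplacian ::
    "('i::finite \<Rightarrow> 'a::metric_space \<Rightarrow> 'a) \<Rightarrow> ('i \<Rightarrow> real) \<Rightarrow> ('a \<Rightarrow> 'a \<Rightarrow> real) \<Rightarrow> 'a measure \<Rightarrow>
     boundary_condition \<Rightarrow> ('a \<Rightarrow> real) set" where
  "dom_laplacian F r D \<mu> Dirichlet =
     {u. (\<exists>g. has_laplacian F r D \<mu> u g) \<and> (\<forall>p\<in>V0 F. u p = 0)}"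
| "dom_laplacian F r D \<mu> Neumann =
     {u. \<exists>\<eta>. has_neumann_derivative F r D \<mu> u \<eta> \<and> (\<forall>p\<in>V0 F. \<eta> p = 0)}"

text \<open>Membership of a (representative) function in \<open>L\<^sup>p(K, \<mu>)\<close>, for \<open>p\<close> up to and including infinity.\<close>

definition in_Lp :: "'a measure \<Rightarrow> ennreal \<Rightarrow> ('a \<Rightarrow> real) \<Rightarrow> bool" where
  "in_Lp \<mu> p f \<longleftrightarrow>
     f \<in> borel_measurable \<mu> \<and>
     (if p = top then \<exists>C. AE x in \<mu>. \<bar>f x\<bar> \<le> C
      else integrable \<mu> (\<lambda>x. \<bar>f x\<bar> powr enn2real p))"

definition complete_orthonormal_system :: "'a measure \<Rightarrow> (nat \<Rightarrow> 'a \<Rightarrow> real) \<Rightarrow> bool" where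
  "complete_orthonormal_system \<mu> \<phi> \<longleftrightarrow>
     (\<forall>n. in_Lp \<mu> 2 (\<phi> n)) \<and>
     (\<forall>m n. (LINT x|\<mu>. \<phi> m x * \<phi> n x) = (if m = n then 1 else 0)) \<and>
     (\<forall>f. in_Lp \<mu> 2 f \<and> (\<forall>n. (LINT x|\<mu>. f x * \<phi> n x) = 0) \<longrightarrow> (AE x in \<mu>. f x = 0))"

text \<open>Eigenvalues and eigenfunctions are enumerated from \<open>0\<close> instead of \<open>1\<close>.\<close>

definition eigensystem ::
    "('i::finite \<Rightarrow> 'a::metric_space \<Rightarrow> 'a) \<Rightarrow> ('i \<Rightarrow> real) \<Rightarrow> ('a \<Rightarrow> 'a \<Rightarrow> real) \<Rightarrow> 'a measure \<Rightarrow>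
     boundary_condition \<Rightarrow> (nat \<Rightarrow> real) \<Rightarrow> (nat \<Rightarrow> 'a \<Rightarrow> real) \<Rightarrow> bool" where
  "eigensystem F r D \<mu> b lam \<phi> \<longleftrightarrow>
     (\<forall>n. 0 \<le> lam n) \<and> mono lam \<and>
     (\<forall>n. \<phi> n \<in> dom_laplacian F r D \<mu> b \<and>
          has_laplacian F r D \<mu> (\<phi> n) (\<lambda>x. - lam n * \<phi> n x)) \<and>
     complete_orthonormal_system \<mu> \<phi>"

section \<open>Poisson integrals, maximal function and cones\<close>

definition poisson_kernel ::
    "(nat \<Rightarrow> real) \<Rightarrow> (nat \<Rightarrow> 'a \<Rightarrow> real) \<Rightarrow> real \<Rightarrow> 'a \<Rightarrow> 'a \<Rightarrow> real" where
  "poisson_kernel lam \<phi> t x y = (\<Sum>n. exp (- sqrt (lam n) * t) * \<phi> n x * \<phi> n y)"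

definition poisson_integral ::
    "'a measure \<Rightarrow> (nat \<Rightarrow> real) \<Rightarrow> (nat \<Rightarrow> 'a \<Rightarrow> real) \<Rightarrow> ('a \<Rightarrow> real) \<Rightarrow> real \<Rightarrow> 'a \<Rightarrow> real" where
  "poisson_integral \<mu> lam \<phi> f t x = (LINT y|\<mu>. poisson_kernel lam \<phi> t x y * f y)"

text \<open>The maximal function may take the value infinity, hence \<open>ennreal\<close>.\<close>

definition maximal_function ::
    "('i::finite \<Rightarrow> 'a::metric_space \<Rightarrow> 'a) \<Rightarrow> ('i \<Rightarrow> real) \<Rightarrow> ('a \<Rightarrow> 'a \<Rightarrow> real) \<Rightarrow> 'a measure \<Rightarrow>
     ('a \<Rightarrow> real) \<Rightarrow> 'a \<Rightarrow> ennreal" where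
  "maximal_function F r D \<mu> f x =
     (SUP e\<in>{0<..}.
        (\<integral>\<^sup>+y\<in>res_ball F r D x e. ennreal \<bar>f y\<bar> \<partial>\<mu>) / emeasure \<mu> (res_ball F r D x e))"

definition nt_cone ::
    "('i::finite \<Rightarrow> 'a::metric_space \<Rightarrow> 'a) \<Rightarrow> ('i \<Rightarrow> real) \<Rightarrow> ('a \<Rightarrow> 'a \<Rightarrow> real) \<Rightarrow> real \<Rightarrow>
     real \<Rightarrow> 'a \<Rightarrow> (real \<times> 'a) set" where
  "nt_cone F r D d \<alpha> x = {(t, y). 0 < t \<and> res F r D x y powr (d + 1) < \<alpha> * t\<^sup>2}"

end

theory Submission
  imports Defs "HOL-Library.Sublist"
begin

text \<open>
  The proof uses no heat kernel.  The resolvent \<open>w\<close> at \<open>\<sigma>\<close> of a function \<open>f\<close> supported in a small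
  resistance ball is \<open>\<sigma>\<close>-harmonic off that ball, so a Caccioppoli inequality with a cutoff function at
  distance \<open>\<rho>\<close>, whose energy is of order \<open>1 / \<rho>\<close>, together with the embedding of the form domain into
  \<open>C(K)\<close> gains a factor \<open>\<sigma> powr (- 1 / (d + 1)) / \<rho>\<close> whenever the distance is multiplied by a constant.
  Iterating, resolvents decay faster than any power of the distance.  Writing
  \<open>exp (- t * sqrt \<lambda>)\<close> as a sine transform of \<open>s / (s\<^sup>2 + \<lambda>)\<close> turns this into
  \<open>\<bar>P(t, x, y)\<bar> \<le> C * min (t powr (- 2 * d / (d + 1))) (t * R(x, y) powr (- (3 * d + 1) / 2))\<close> for \<open>t \<le> 1\<close>.
  By Ahlfors regularity of \<open>\<mu>\<close> the kernel is then dominated on cones by averages over balls, which is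
  the maximal inequality; with the weak type (1,1) estimate for the maximal function and the density
  of the linear span of the eigenfunctions in \<open>L\<^sup>1\<close>, where convergence is obvious, it yields almost
  everywhere convergence.
\<close>

section \<open>Discrete energies and the resistance metric\<close>

text \<open>Post-critical finiteness makes the geometry uniform: it bounds the number of cells of
  one size that meet at a point, independently of the size. From this bound come both the cutoff
  functions of energy of order \<open>1 / \<rho>\<close> and the upper estimate for the measure of
  balls. Only resolvents at real \<open>\<sigma> = s\<^sup>2\<close> are used. The obstacle is that
  \<open>s / (s\<^sup>2 + \<lambda>)\<close> is not absolutely integrable in \<open>s\<close>; the
  transform is therefore applied to pairs of functions with disjoint supports, where the leading
  term cancels and the fast decay of resolvents gives convergence. Pointwise bounds are recovered by
  testing with small bumps. The exponent \<open>(3 * d + 1) / 2\<close> is what this integration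
  produces when the frequencies are cut where the decay factor
  \<open>C * kappa \<sigma> / \<rho>\<close> passes 1. It exceeds \<open>d\<close>, as summation
  over dyadic balls requires. Both boundary conditions are treated at once, through a finite set
  \<open>Z\<close> of forced zeros.\<close>

lemma Fw_append: "Fw F (v @ w) = Fw F v \<circ> Fw F w"
  by (induction v) (auto simp: comp_assoc)

lemma rw_Nil [simp]: "rw r [] = 1"
  and rw_Cons [simp]: "rw r (i # w) = r i * rw r w"
  and rw_append: "rw r (v @ w) = rw r v * rw r w"
  by (simp_all add: rw_def)

lemma words_0: "words 0 = {[]}"
  by (auto simp: words_def)

lemma words_add: "(words (k + m) :: 'b::finite list set) = (\<lambda>(v, w). v @ w) ` (words k \<times> words m)"
proof (intro set_eqI iffI)
  fix w :: "'b::finite list" assume "w \<in> words (k + m)"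
  then have "w = take k w @ drop k w" "take k w \<in> words k" "drop k w \<in> words m"
    by (auto simp: words_def)
  then show "w \<in> (\<lambda>(v, w). v @ w) ` (words k \<times> words m)"
    by (metis (mono_tags, lifting) SigmaI case_prod_conv image_eqI)
qed (auto simp: words_def)

lemma finite_words [simp]: "finite (words m)"
  using finite_lists_length_eq[of "UNIV :: 'a::finite set" m] by (simp add: words_def)

lemma sum_words_add: "(\<Sum>w\<in>words (k + m). f w) = (\<Sum>v\<in>words k. \<Sum>w\<in>words m. f (v @ w))"
proof -
  have "inj_on (\<lambda>(v, w). v @ w) (words k \<times> words m)"
    by (auto simp: inj_on_def words_def)
  then show ?thesis
    unfolding words_add sum.reindex[OF \<open>inj_on _ _\<close>] by (simp add: sum.cartesian_product case_prod_unfold)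
qed

lemma words_1: "words 1 = (\<lambda>i. [i]) ` UNIV"
  by (auto simp: words_def length_Suc_conv)

lemma sum_words_1: "(\<Sum>w\<in>words 1. f w) = (\<Sum>i\<in>UNIV. f [i])"
  unfolding words_1 by (subst sum.reindex) (auto simp: inj_on_def)

lemma sum_words_Suc: "(\<Sum>w\<in>words (Suc m). f w) = (\<Sum>i\<in>UNIV. \<Sum>w\<in>words m. f (i # w))"
  using sum_words_add[of f 1 m] unfolding sum_words_1 by simp

lemma Em_add_words:
  "Em F r D (k + m) u v = (\<Sum>w\<in>words k. inverse (rw r w) * Em F r D m (u \<circ> Fw F w) (v \<circ> Fw F w))"
  unfolding Em_def by (simp add: sum_words_add Fw_append rw_append comp_assoc sum_distrib_left mult.assoc)

locale pcf_harmonic =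
  fixes F :: "'i::finite \<Rightarrow> 'a::metric_space \<Rightarrow> 'a"
    and \<pi> :: "(nat \<Rightarrow> 'i) \<Rightarrow> 'a"
    and r :: "'i \<Rightarrow> real"
    and D :: "'a \<Rightarrow> 'a \<Rightarrow> real"
  assumes sss: "self_similar_structure F \<pi>"
    and pcf: "post_critically_finite F \<pi>"
    and V0_nonempty: "V0 F \<noteq> {}"
    and rhs: "regular_harmonic_structure F r D"
    and metrizes: "resistance_metrizes F r D"
begin

abbreviation "V \<equiv> V0 F"
abbreviation "E \<equiv> Em F r D"
abbreviation "En \<equiv> energy F r D"
abbreviation "Dom \<equiv> dom_energy F r D"
abbreviation "R \<equiv> res F r D"

lemma compact_K: "compact (UNIV :: 'a set)"
  and cont_F: "continuous_on UNIV (F i)"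
  and inj_F: "inj (F i)"
  and surj_code: "surj \<pi>"
  and code_cons: "\<pi> (case_nat i \<omega>) = F i (\<pi> \<omega>)"
  using sss by (auto simp: self_similar_structure_def)

lemma finite_V [simp]: "finite V"
  using pcf by (auto simp: post_critically_finite_def)

lemma r_pos: "0 < r i" and r_less_1: "r i < 1"
  using rhs by (auto simp: regular_harmonic_structure_def)

lemma D_sym: "p \<in> V \<Longrightarrow> q \<in> V \<Longrightarrow> D p q = D q p"
  and D_nonneg: "p \<in> V \<Longrightarrow> q \<in> V \<Longrightarrow> p \<noteq> q \<Longrightarrow> 0 \<le> D p q"
  using rhs unfolding regular_harmonic_structure_def by (elim conjE, simp)+

lemma D_row_sum: "p \<in> V \<Longrightarrow> (\<Sum>q\<in>V. D p q) = 0"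
proof -
  assume "p \<in> V"
  have "\<forall>u. (\<forall>p\<in>V. (\<Sum>q\<in>V. D p q * u q) = 0) \<longleftrightarrow> (\<exists>c. \<forall>p\<in>V. u p = c)"
    using rhs unfolding regular_harmonic_structure_def by (elim conjE)
  from this[rule_format, of "\<lambda>_. 1"] show ?thesis
    using \<open>p \<in> V\<close> by auto
qed

lemma E0_le_E1: "E0 F D u u \<le> E 1 u u"
proof -
  have "\<forall>u. let X = {Em F r D 1 v v | v. \<forall>p\<in>V0 F. v p = u p}
           in E0 F D u u \<in> X \<and> (\<forall>e\<in>X. E0 F D u u \<le> e)"
    using rhs unfolding regular_harmonic_structure_def by (elim conjE)
  then show ?thesis unfolding Let_def by blast
qed

lemma rw_pos: "0 < rw r w"
  by (induction w) (auto simp: r_pos)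

lemma rw_le_1: "rw r w \<le> 1"
  by (induction w) (auto simp: r_pos rw_pos less_imp_le r_less_1 intro!: mult_le_one)

lemma cont_Fw: "continuous_on UNIV (Fw F w)"
proof (induction w)
  case (Cons i w)
  then show ?case
    using continuous_on_compose[OF Cons continuous_on_subset[OF cont_F]] by auto
qed (auto simp: id_def)

lemma inj_Fw: "inj (Fw F w)"
proof (induction w)
  case (Cons i w)
  then show ?case using inj_compose[OF inj_F Cons] by (simp add: comp_def)
qed simp

text \<open>By symmetry and vanishing row sums the diagonal of \<open>D\<close> can be eliminated,
  which leaves the energy of a weighted graph on \<open>V\<close>: the conductances are the
  off-diagonal entries, and the factor 1/2 compensates for counting each pair twice.\<close>

lemma E0_eq:
  "E0 F D u v = (\<Sum>p\<in>V. \<Sum>q\<in>V. (if p = q then 0 else D p q) / 2 * (u p - u q) * (v p - v q))"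
proof -
  let ?S = "\<Sum>p\<in>V. \<Sum>q\<in>V. u p * D p q * v q"
  have a: "(\<Sum>p\<in>V. \<Sum>q\<in>V. D p q * u p * v p) = 0"
  proof (rule sum.neutral, rule ballI)
    fix p assume "p \<in> V"
    have "(\<Sum>q\<in>V. D p q * u p * v p) = (\<Sum>q\<in>V. D p q) * (u p * v p)"
      by (simp add: sum_distrib_right mult.assoc)
    then show "(\<Sum>q\<in>V. D p q * u p * v p) = 0" using D_row_sum[OF \<open>p \<in> V\<close>] by simp
  qed
  have b: "(\<Sum>p\<in>V. \<Sum>q\<in>V. D p q * u q * v q) = (\<Sum>p\<in>V. \<Sum>q\<in>V. D p q * u p * v p)"
    by (subst sum.swap) (intro sum.cong, auto simp: D_sym)
  have c: "(\<Sum>p\<in>V. \<Sum>q\<in>V. D p q * u q * v p) = ?S"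
    by (subst sum.swap) (intro sum.cong, auto simp: D_sym)
  have "(\<Sum>p\<in>V. \<Sum>q\<in>V. (if p = q then 0 else D p q) / 2 * (u p - u q) * (v p - v q))
      = (\<Sum>p\<in>V. \<Sum>q\<in>V. (D p q * u p * v p + D p q * u q * v q - u p * D p q * v q - D p q * u q * v p) / 2)"
    by (intro sum.cong refl) (auto simp: field_simps)
  also have "\<dots> = ((\<Sum>p\<in>V. \<Sum>q\<in>V. D p q * u p * v p) + (\<Sum>p\<in>V. \<Sum>q\<in>V. D p q * u q * v q)
      - ?S - (\<Sum>p\<in>V. \<Sum>q\<in>V. D p q * u q * v p)) / 2"
    by (simp add: sum.distrib sum_subtractf flip: sum_divide_distrib)
  also have "\<dots> = - ?S" using a b c by simp
  finally show ?thesis by (simp add: E0_def)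
qed

text \<open>An edge carries its word, so that edges of different cells stay distinct even if they
  join the same points. Many inequalities for \<open>E m\<close> then reduce to inequalities between
  single terms with nonnegative weights.\<close>

definition edges :: "nat \<Rightarrow> ('i list \<times> 'a \<times> 'a) set" where
  "edges m = words m \<times> V \<times> V"

definition weight :: "'i list \<times> 'a \<times> 'a \<Rightarrow> real" where
  "weight = (\<lambda>(w, p, q). inverse (rw r w) * ((if p = q then 0 else D p q) / 2))"

definition src :: "'i list \<times> 'a \<times> 'a \<Rightarrow> 'a" where "src = (\<lambda>(w, p, q). Fw F w p)"
definition tgt :: "'i list \<times> 'a \<times> 'a \<Rightarrow> 'a" where "tgt = (\<lambda>(w, p, q). Fw F w q)"

lemma finite_edges [simp]: "finite (edges m)"
  by (simp add: edges_def)

lemma weight_nonneg: "e \<in> edges m \<Longrightarrow> 0 \<le> weight e"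
  by (auto simp: edges_def weight_def rw_pos less_imp_le D_nonneg intro!: mult_nonneg_nonneg)

lemma E_edges:
  "E m u v = (\<Sum>e\<in>edges m. weight e * ((u (src e) - u (tgt e)) * (v (src e) - v (tgt e))))"
  unfolding Em_def E0_eq edges_def
  by (simp add: sum_distrib_left sum.cartesian_product weight_def src_def tgt_def case_prod_unfold mult.assoc)

lemma E_sym: "E m u v = E m v u"
  by (simp add: E_edges mult.commute mult.left_commute)

lemma E_nonneg: "0 \<le> E m u u"
  unfolding E_edges by (intro sum_nonneg mult_nonneg_nonneg[OF weight_nonneg]) auto

lemma E_add_left: "E m (\<lambda>x. u x + u' x) v = E m u v + E m u' v"
  unfolding E_edges by (simp add: algebra_simps flip: sum.distrib)

lemma E_scale_left: "E m (\<lambda>x. c * u x) v = c * E m u v"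
  unfolding E_edges sum_distrib_left by (intro sum.cong refl) (simp add: algebra_simps)

lemma E_add_right: "E m v (\<lambda>x. u x + u' x) = E m v u + E m v u'"
  using E_add_left E_sym by metis

lemma E_scale_right: "E m v (\<lambda>x. c * u x) = c * E m v u"
  using E_scale_left E_sym by metis

lemma E_const [simp]: "E m (\<lambda>_. c) v = 0"
  by (simp add: E_edges)

text \<open>The minimum property \<open>E0_le_E1\<close>, applied in every cell of level
  \<open>m\<close>.\<close>

lemma E_mono_Suc: "E m u u \<le> E (Suc m) u u"
proof -
  have "E m u u = (\<Sum>w\<in>words m. inverse (rw r w) * E0 F D (u \<circ> Fw F w) (u \<circ> Fw F w))"
    by (simp add: Em_def)
  also have "\<dots> \<le> (\<Sum>w\<in>words m. inverse (rw r w) * E 1 (u \<circ> Fw F w) (u \<circ> Fw F w))"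
    by (intro sum_mono mult_left_mono E0_le_E1) (simp add: rw_pos less_imp_le)
  also have "\<dots> = E (Suc m) u u"
    using Em_add_words[of F r D m 1 u u] by simp
  finally show ?thesis .
qed

lemma E_mono: "m \<le> n \<Longrightarrow> E m u u \<le> E n u u"
  by (rule lift_Suc_mono_le[of "\<lambda>m. E m u u"]) (auto simp: E_mono_Suc)

lemma E_add_le: "E m (\<lambda>x. u x + v x) (\<lambda>x. u x + v x) \<le> 2 * E m u u + 2 * E m v v"
proof -
  have "0 \<le> E m (\<lambda>x. u x + (-1) * v x) (\<lambda>x. u x + (-1) * v x)" by (rule E_nonneg)
  then show ?thesis
    unfolding E_add_left E_add_right E_scale_left E_scale_right by (simp add: E_sym[of m v u])
qed

text \<open>A Leibniz rule, from \<open>u x * v x - u y * v y = u x * (v x - v y) + v y * (u x - u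
  y)\<close>. It makes the form domain closed under products, which cutting off and interpolation
  need.\<close>

lemma E_mult_le:
  assumes "\<And>x. \<bar>u x\<bar> \<le> A" "\<And>x. \<bar>v x\<bar> \<le> B"
  shows "E m (\<lambda>x. u x * v x) (\<lambda>x. u x * v x) \<le> 2 * A\<^sup>2 * E m v v + 2 * B\<^sup>2 * E m u u"
proof -
  have *: "(u x * v x - u y * v y)\<^sup>2 \<le> 2 * A\<^sup>2 * (v x - v y)\<^sup>2 + 2 * B\<^sup>2 * (u x - u y)\<^sup>2" for x y
  proof -
    have "(u x * v x - u y * v y)\<^sup>2 = (u x * (v x - v y) + v y * (u x - u y))\<^sup>2"
      by (simp add: algebra_simps)
    also have "\<dots> \<le> 2 * (u x * (v x - v y))\<^sup>2 + 2 * (v y * (u x - u y))\<^sup>2"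
      using zero_le_power2[of "u x * (v x - v y) - v y * (u x - u y)"]
      by (simp add: power2_eq_square algebra_simps)
    also have "\<dots> \<le> 2 * A\<^sup>2 * (v x - v y)\<^sup>2 + 2 * B\<^sup>2 * (u x - u y)\<^sup>2"
      using assms[of x] assms[of y] unfolding power_mult_distrib mult.assoc
      by (intro add_mono mult_left_mono mult_right_mono) (auto simp: abs_le_square_iff[symmetric])
    finally show ?thesis .
  qed
  have "E m (\<lambda>x. u x * v x) (\<lambda>x. u x * v x)
     \<le> (\<Sum>e\<in>edges m. weight e * (2 * A\<^sup>2 * (v (src e) - v (tgt e))\<^sup>2 + 2 * B\<^sup>2 * (u (src e) - u (tgt e))\<^sup>2))"
    unfolding E_edges power2_eq_square[symmetric]
    by (intro sum_mono mult_left_mono *) (auto simp: weight_nonneg)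
  also have "\<dots> = 2 * A\<^sup>2 * E m v v + 2 * B\<^sup>2 * E m u u"
    unfolding E_edges sum_distrib_left sum.distrib[symmetric]
    by (intro sum.cong refl) (simp add: algebra_simps power2_eq_square)
  finally show ?thesis .
qed

section \<open>The form domain and the limit energy\<close>

lemma in_Dom_iff: "u \<in> Dom \<longleftrightarrow> continuous_on UNIV u \<and> (\<exists>B. \<forall>m. E m u u \<le> B)"
proof -
  have "convergent (\<lambda>m. E m u u) \<longleftrightarrow> (\<exists>B. \<forall>m. E m u u \<le> B)"
  proof
    assume "convergent (\<lambda>m. E m u u)"
    then have "Bseq (\<lambda>m. E m u u)" by (rule convergent_imp_Bseq)
    then obtain B where "\<forall>m. \<bar>E m u u\<bar> \<le> B" by (auto simp: Bseq_def)
    then show "\<exists>B. \<forall>m. E m u u \<le> B" by (meson abs_le_D1)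
  next
    assume "\<exists>B. \<forall>m. E m u u \<le> B"
    then obtain B where B: "\<And>m. E m u u \<le> B" by auto
    have "Bseq (\<lambda>m. E m u u)"
      using B E_nonneg[of _ u] by (intro BseqI'[of _ B]) auto
    then show "convergent (\<lambda>m. E m u u)"
      by (rule Bseq_mono_convergent) (auto simp: E_mono)
  qed
  then show ?thesis by (auto simp: dom_energy_def)
qed

lemma Dom_cont: "u \<in> Dom \<Longrightarrow> continuous_on UNIV u"
  by (simp add: in_Dom_iff)

lemma cont_bounded:
  fixes u :: "'a \<Rightarrow> real"
  assumes "continuous_on UNIV u" obtains B where "0 < B" "\<And>x. \<bar>u x\<bar> \<le> B"
proof -
  have "bounded (range u)"
    using compact_continuous_image[OF assms compact_K] compact_imp_bounded by blast
  then obtain B where "0 < B" "\<forall>y\<in>range u. norm y \<le> B" by (auto simp: bounded_pos)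
  then show ?thesis by (intro that[of B]) auto
qed

lemma Dom_const [intro!, simp]: "(\<lambda>_. c) \<in> Dom"
  by (auto simp: in_Dom_iff)

lemma Dom_add [intro]: assumes "u \<in> Dom" "v \<in> Dom" shows "(\<lambda>x. u x + v x) \<in> Dom"
proof -
  obtain B C where "\<And>m. E m u u \<le> B" "\<And>m. E m v v \<le> C" using assms by (auto simp: in_Dom_iff)
  then have "E m (\<lambda>x. u x + v x) (\<lambda>x. u x + v x) \<le> 2 * B + 2 * C" for m
    by (intro order.trans[OF E_add_le]) (simp add: add_mono)
  then show ?thesis using assms by (auto simp: in_Dom_iff intro!: continuous_intros)
qed

lemma Dom_mult [intro]: assumes "u \<in> Dom" "v \<in> Dom" shows "(\<lambda>x. u x * v x) \<in> Dom"
proof -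
  obtain B C where BC: "\<And>m. E m u u \<le> B" "\<And>m. E m v v \<le> C" using assms by (auto simp: in_Dom_iff)
  obtain X Y where "\<And>x. \<bar>u x\<bar> \<le> X" "\<And>x. \<bar>v x\<bar> \<le> Y"
    using assms cont_bounded by (metis Dom_cont)
  then have "E m (\<lambda>x. u x * v x) (\<lambda>x. u x * v x) \<le> 2 * X\<^sup>2 * C + 2 * Y\<^sup>2 * B" for m
    by (intro order.trans[OF E_mult_le[of u X v Y]] add_mono mult_left_mono BC) auto
  then show ?thesis using assms by (auto simp: in_Dom_iff intro!: continuous_intros)
qed

lemma Dom_scale [intro]: "u \<in> Dom \<Longrightarrow> (\<lambda>x. c * u x) \<in> Dom"
  using Dom_mult[of "\<lambda>_. c" u] by simp

lemma Dom_diff [intro]: "u \<in> Dom \<Longrightarrow> v \<in> Dom \<Longrightarrow> (\<lambda>x. u x - v x) \<in> Dom"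
  using Dom_add[of u "\<lambda>x. (-1) * v x"] Dom_scale[of v "-1"] by simp

lemma Dom_power2 [intro]: "u \<in> Dom \<Longrightarrow> (\<lambda>x. (u x)\<^sup>2) \<in> Dom"
  by (auto simp: power2_eq_square)

lemma Dom_sum [intro]: "(\<And>i. i \<in> A \<Longrightarrow> u i \<in> Dom) \<Longrightarrow> (\<lambda>x. \<Sum>i\<in>A. u i x) \<in> Dom"
  by (induction A rule: infinite_finite_induct) auto

lemma Dom_prod [intro]: "(\<And>i. i \<in> A \<Longrightarrow> u i \<in> Dom) \<Longrightarrow> (\<lambda>x. \<Prod>i\<in>A. u i x) \<in> Dom"
  by (induction A rule: infinite_finite_induct) auto

lemma En_lim_diag: "u \<in> Dom \<Longrightarrow> (\<lambda>m. E m u u) \<longlonglongrightarrow> En u u"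
  unfolding energy_def dom_energy_def using convergent_LIMSEQ_iff by auto

lemma En_lim:
  assumes "u \<in> Dom" "v \<in> Dom" shows "(\<lambda>m. E m u v) \<longlonglongrightarrow> En u v"
proof -
  have eq: "E m u v = (E m (\<lambda>x. u x + v x) (\<lambda>x. u x + v x) - E m u u - E m v v) / 2" for m
    unfolding E_add_left E_add_right by (simp add: E_sym[of m v u])
  have "convergent (\<lambda>m. E m u v)"
    unfolding eq using assms
    by (intro convergentI[OF tendsto_divide[OF tendsto_diff[OF tendsto_diff[OF
          En_lim_diag[OF Dom_add] En_lim_diag] En_lim_diag] tendsto_const]]) auto
  then show ?thesis by (simp add: energy_def convergent_LIMSEQ_iff)
qed

lemma En_sym: "En u v = En v u"
  unfolding energy_def by (subst E_sym) simp

lemma En_nonneg: "u \<in> Dom \<Longrightarrow> 0 \<le> En u u"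
  by (rule LIMSEQ_le_const[OF En_lim_diag]) (auto simp: E_nonneg)

lemma E_le_En: "u \<in> Dom \<Longrightarrow> E m u u \<le> En u u"
  by (rule incseq_le[OF _ En_lim_diag]) (auto simp: incseq_def E_mono)

lemma En_add_left:
  "u \<in> Dom \<Longrightarrow> u' \<in> Dom \<Longrightarrow> v \<in> Dom \<Longrightarrow> En (\<lambda>x. u x + u' x) v = En u v + En u' v"
  by (rule LIMSEQ_unique[OF En_lim]) (auto simp: E_add_left intro!: tendsto_add En_lim)

lemma En_scale_left: "u \<in> Dom \<Longrightarrow> v \<in> Dom \<Longrightarrow> En (\<lambda>x. c * u x) v = c * En u v"
  by (rule LIMSEQ_unique[OF En_lim]) (auto simp: E_scale_left intro!: tendsto_mult En_lim)

lemma En_add_right: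
  "u \<in> Dom \<Longrightarrow> u' \<in> Dom \<Longrightarrow> v \<in> Dom \<Longrightarrow> En v (\<lambda>x. u x + u' x) = En v u + En v u'"
  using En_add_left En_sym by metis

lemma En_scale_right: "u \<in> Dom \<Longrightarrow> v \<in> Dom \<Longrightarrow> En v (\<lambda>x. c * u x) = c * En v u"
  using En_scale_left En_sym by metis

lemma En_const [simp]: "En (\<lambda>_. c) v = 0"
  by (simp add: energy_def)

lemma En_diff_left:
  "u \<in> Dom \<Longrightarrow> u' \<in> Dom \<Longrightarrow> v \<in> Dom \<Longrightarrow> En (\<lambda>x. u x - u' x) v = En u v - En u' v"
  using En_add_left[of u "\<lambda>x. (-1) * u' x" v] En_scale_left[of u' v "-1"] Dom_scale[of u' "-1"] by simp

lemma En_diff_right: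
  "u \<in> Dom \<Longrightarrow> u' \<in> Dom \<Longrightarrow> v \<in> Dom \<Longrightarrow> En v (\<lambda>x. u x - u' x) = En v u - En v u'"
  using En_diff_left En_sym by metis

lemma En_sum_left:
  assumes "finite A" "\<And>i. i \<in> A \<Longrightarrow> u i \<in> Dom" "v \<in> Dom"
  shows "En (\<lambda>x. \<Sum>i\<in>A. u i x) v = (\<Sum>i\<in>A. En (u i) v)"
  using assms by (induction A rule: finite_induct) (auto simp: En_add_left Dom_sum)

lemma En_quadratic:
  assumes "u \<in> Dom" "v \<in> Dom"
  shows "En (\<lambda>x. u x + c * v x) (\<lambda>x. u x + c * v x) = En u u + 2 * c * En u v + c\<^sup>2 * En v v"
  using assms by (simp add: En_add_left En_add_right En_scale_left En_scale_right Dom_scale Dom_add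
      En_sym[of v u] algebra_simps power2_eq_square)

text \<open>The discrete Caccioppoli inequality rests on
  \<open>(a - b) (a s\<^sup>2 - b t\<^sup>2) = (a s - b t)\<^sup>2 - a b (s - t)\<^sup>2\<close>.\<close>

lemma E_caccioppoli:
  assumes "\<And>e. e \<in> edges m \<Longrightarrow> \<psi> (src e) \<noteq> \<psi> (tgt e) \<Longrightarrow> \<bar>u (src e)\<bar> \<le> M \<and> \<bar>u (tgt e)\<bar> \<le> M"
  shows "E m (\<lambda>x. u x * \<psi> x) (\<lambda>x. u x * \<psi> x) \<le> E m u (\<lambda>x. u x * (\<psi> x)\<^sup>2) + M\<^sup>2 * E m \<psi> \<psi>"
proof -
  have "weight e * ((u (src e) * \<psi> (src e) - u (tgt e) * \<psi> (tgt e)) * (u (src e) * \<psi> (src e) - u (tgt e) * \<psi> (tgt e)))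
     \<le> weight e * ((u (src e) - u (tgt e)) * (u (src e) * (\<psi> (src e))\<^sup>2 - u (tgt e) * (\<psi> (tgt e))\<^sup>2))
      + M\<^sup>2 * (weight e * ((\<psi> (src e) - \<psi> (tgt e)) * (\<psi> (src e) - \<psi> (tgt e))))" if "e \<in> edges m" for e
  proof -
    define a b s t where "a = u (src e)" "b = u (tgt e)" "s = \<psi> (src e)" "t = \<psi> (tgt e)"
    note d = this
    have "a * b * (s - t)\<^sup>2 \<le> M\<^sup>2 * (s - t)\<^sup>2"
    proof (cases "s = t")
      case False
      then have "\<bar>a\<bar> \<le> M" "\<bar>b\<bar> \<le> M" using assms[OF that] by (auto simp: d)
      then have "\<bar>a * b\<bar> \<le> M * M" by (simp add: abs_mult mult_mono)
      then show ?thesis by (intro mult_right_mono) (auto simp: power2_eq_square)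
    qed simp
    then have "(a * s - b * t) * (a * s - b * t) \<le> (a - b) * (a * s\<^sup>2 - b * t\<^sup>2) + M\<^sup>2 * ((s - t) * (s - t))"
      by (simp add: power2_eq_square algebra_simps)
    from mult_left_mono[OF this weight_nonneg[OF that]] show ?thesis
      unfolding d by (simp add: algebra_simps)
  qed
  then show ?thesis
    unfolding E_edges sum_distrib_left sum.distrib[symmetric] by (intro sum_mono)
qed

section \<open>The resistance metric\<close>

lemma R_metric: "Metric_space UNIV R" and R_topology: "Metric_space.mtopology UNIV R = euclidean"
  and eff_res_finite: "eff_res F r D x y < top"
  using metrizes by (auto simp: resistance_metrizes_def)

sublocale RM: Metric_space UNIV R by (rule R_metric)

lemma R_nonneg [simp]: "0 \<le> R x y" by simp
lemma R_sym: "R x y = R y x" by (rule RM.commute)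
lemma R_tri: "R x z \<le> R x y + R y z" by (rule RM.triangle) auto
lemma R_zero [simp]: "R x y = 0 \<longleftrightarrow> x = y" by (rule RM.zero) auto

lemma R_bound_pos:
  assumes "u \<in> Dom" "0 < En u u" shows "(u x - u y)\<^sup>2 \<le> R x y * En u u"
proof -
  have "ennreal (\<bar>u x - u y\<bar>\<^sup>2 / En u u) \<le> eff_res F r D x y"
    unfolding eff_res_def by (rule SUP_upper) (use assms in auto)
  then have "\<bar>u x - u y\<bar>\<^sup>2 / En u u \<le> R x y"
    unfolding res_def using eff_res_finite[of x y] assms
    by (metis enn2real_mono enn2real_ennreal divide_nonneg_pos zero_le_power2)
  then show ?thesis using assms by (simp add: field_simps)
qed

text \<open>The supremum that defines the resistance ranges over functions of positive energy only.
  A function \<open>v\<close> of zero energy is constant: added with any factor to a function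
  \<open>u\<close> of positive energy it leaves the energy unchanged, so a nonzero difference of its
  values would contradict the bound for \<open>u + c * v\<close> for large \<open>c\<close>.\<close>

lemma R_bound:
  assumes v: "v \<in> Dom" shows "(v x - v y)\<^sup>2 \<le> R x y * En v v"
proof (cases "En v v = 0")
  case True
  have "v x = v y"
  proof (cases "\<exists>u\<in>Dom. 0 < En u u")
    case True
    then obtain u where u: "u \<in> Dom" "0 < En u u" by auto
    have q: "En (\<lambda>x. u x + c * v x) (\<lambda>x. u x + c * v x) = En u u + 2 * c * En u v" for c
      using En_quadratic[OF u(1) v] \<open>En v v = 0\<close> by simp
    have "En u v = 0"
    proof (rule ccontr)
      assume ne: "En u v \<noteq> 0"
      \<comment> \<open>This coefficient makes the energy of \<open>u + c * v\<close> equal to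
        \<open>- En u u\<close>, which is negative.\<close>
      have "0 \<le> En u u + 2 * (- En u u / En u v) * En u v"
        unfolding q[symmetric] by (intro En_nonneg Dom_add Dom_scale u v)
      then show False using u ne by simp
    qed
    then have b: "(u x + c * v x - (u y + c * v y))\<^sup>2 \<le> R x y * En u u" for c
      using R_bound_pos[of "\<lambda>x. u x + c * v x" x y] u v q[of c] by (auto simp: Dom_add Dom_scale)
    show "v x = v y"
    proof (rule ccontr)
      assume ne: "v x \<noteq> v y"
      define c where "c = (R x y * En u u + 1 - (u x - u y)) / (v x - v y)"
      have p: "0 \<le> R x y * En u u" using u by (intro mult_nonneg_nonneg) auto
      have "u x + c * v x - (u y + c * v y) = (u x - u y) + c * (v x - v y)" by (simp add: algebra_simps)
      also have "\<dots> = R x y * En u u + 1" using ne by (simp add: c_def)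
      finally have "(R x y * En u u + 1)\<^sup>2 \<le> R x y * En u u" using b[of c] by simp
      then show False using p by (simp add: power2_sum) (smt (verit) zero_le_power2 mult.commute)
    qed
  next
    case False
    \<comment> \<open>The supremum over the empty set is 0, and \<open>R\<close> separates points,
      so here \<open>x = y\<close>.\<close>
    then have e: "{u \<in> Dom. 0 < En u u} = {}" by blast
    have "eff_res F r D x y = 0" unfolding eff_res_def e by (simp add: bot_ennreal)
    then have "R x y = 0" by (simp add: res_def)
    then show ?thesis by simp
  qed
  then show ?thesis using True by simp
next
  case False
  then show ?thesis using R_bound_pos[OF v] En_nonneg[OF v] by auto
qed

lemma Dom_separates: assumes "x \<noteq> y" obtains u where "u \<in> Dom" "u x \<noteq> u y"
proof -
  have "R x y \<noteq> 0" using assms by simp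
  then have "eff_res F r D x y \<noteq> 0" by (auto simp: res_def)
  then have "\<not> (\<forall>u\<in>{u \<in> Dom. 0 < En u u}. ennreal (\<bar>u x - u y\<bar>\<^sup>2 / En u u) = 0)"
  proof (rule contrapos_nn)
    assume "\<forall>u\<in>{u \<in> Dom. 0 < En u u}. ennreal (\<bar>u x - u y\<bar>\<^sup>2 / En u u) = 0"
    then have "eff_res F r D x y \<le> 0" unfolding eff_res_def by (intro SUP_least) simp
    then show "eff_res F r D x y = 0" by simp
  qed
  then show ?thesis using that by force
qed

lemma R_le_of_bound:
  assumes "0 \<le> C" "\<And>u. u \<in> Dom \<Longrightarrow> (u x - u y)\<^sup>2 \<le> C * En u u"
  shows "R x y \<le> C"
proof -
  have "eff_res F r D x y \<le> ennreal C"
    unfolding eff_res_def using assms by (intro SUP_least ennreal_leI) (auto simp: field_simps)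
  then have "enn2real (eff_res F r D x y) \<le> C"
    using assms(1) by (metis enn2real_ennreal enn2real_mono ennreal_less_top)
  then show ?thesis by (simp add: res_def)
qed

text \<open>The energy at level \<open>length w + m\<close> splits over the cells of level
  \<open>length w\<close>; keeping only the cell of \<open>w\<close> leaves
  \<open>inverse (rw r w)\<close> times the energy of \<open>u \<circ> Fw F w\<close> at level
  \<open>m\<close>.\<close>

lemma Dom_comp_Fw:
  assumes "u \<in> Dom"
  shows "u \<circ> Fw F w \<in> Dom" and "En (u \<circ> Fw F w) (u \<circ> Fw F w) \<le> rw r w * En u u"
proof -
  have b: "E m (u \<circ> Fw F w) (u \<circ> Fw F w) \<le> rw r w * En u u" for m
  proof -
    have "inverse (rw r w) * E m (u \<circ> Fw F w) (u \<circ> Fw F w) \<le> E (length w + m) u u"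
      unfolding Em_add_words
      by (rule member_le_sum) (auto simp: words_def rw_pos less_imp_le E_nonneg finite_words[unfolded words_def])
    also have "\<dots> \<le> En u u" by (rule E_le_En[OF assms])
    finally show ?thesis using rw_pos[of w] by (simp add: field_simps)
  qed
  show d: "u \<circ> Fw F w \<in> Dom"
    using b continuous_on_compose[OF cont_Fw[of w] continuous_on_subset[OF Dom_cont[OF assms]]]
    by (auto simp: in_Dom_iff)
  show "En (u \<circ> Fw F w) (u \<circ> Fw F w) \<le> rw r w * En u u"
    by (rule LIMSEQ_le_const2[OF En_lim_diag[OF d]]) (use b in auto)
qed

lemma R_Fw_le: "R (Fw F w x) (Fw F w y) \<le> rw r w * R x y"
proof (rule R_le_of_bound)
  fix u assume u: "u \<in> Dom"
  have "(u (Fw F w x) - u (Fw F w y))\<^sup>2 \<le> R x y * En (u \<circ> Fw F w) (u \<circ> Fw F w)"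
    using R_bound[OF Dom_comp_Fw(1)[OF u], of w x y] by simp
  also have "\<dots> \<le> R x y * (rw r w * En u u)"
    by (intro mult_left_mono Dom_comp_Fw(2)[OF u]) auto
  finally show "(u (Fw F w x) - u (Fw F w y))\<^sup>2 \<le> rw r w * R x y * En u u" by (simp add: mult_ac)
qed (simp add: rw_pos less_imp_le)

lemma open_res_ball: "open (res_ball F r D x e)"
proof -
  have "res_ball F r D x e = RM.mball x e" by (auto simp: res_ball_def RM.mball_def)
  then show ?thesis using RM.openin_mball[of x e] R_topology by simp
qed

lemma open_iff_R: "open A \<longleftrightarrow> (\<forall>x\<in>A. \<exists>e>0. res_ball F r D x e \<subseteq> A)"
proof -
  have "open A \<longleftrightarrow> openin RM.mtopology A" using R_topology by simp
  also have "\<dots> \<longleftrightarrow> (\<forall>x\<in>A. \<exists>e>0. res_ball F r D x e \<subseteq> A)"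
    by (auto simp: RM.openin_mtopology RM.mball_def res_ball_def)
  finally show ?thesis .
qed

lemma cont_R_left: "continuous_on UNIV (\<lambda>y. R x y)"
proof -
  have *: "\<exists>d>0. \<forall>y. R z y < d \<longrightarrow> \<bar>R x y - R x z\<bar> < e" if "e > 0" for z e
    proof (intro exI[of _ e] conjI allI impI)
    fix y assume "R z y < e"
    then show "\<bar>R x y - R x z\<bar> < e"
      using R_tri[of x y z] R_tri[of x z y] R_sym[of y z] by linarith
  qed (rule that)
  then have "open {y. R x y \<in> B}" if "open B" for B :: "real set"
    unfolding open_iff_R
  proof safe
    fix z assume z: "R x z \<in> B" 
    then obtain e where e: "e > 0" "\<And>y. \<bar>y - R x z\<bar> < e \<Longrightarrow> y \<in> B"
      using \<open>open B\<close> by (auto simp: open_dist dist_real_def)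
    then obtain d where "d > 0" "\<And>y. R z y < d \<Longrightarrow> \<bar>R x y - R x z\<bar> < e"
      using *[OF e(1)] by blast
    then show "\<exists>e>0. res_ball F r D z e \<subseteq> {y. R x y \<in> B}"
      using e by (intro exI[of _ d]) (auto simp: res_ball_def)
  qed
  then show ?thesis by (auto simp: continuous_on_open_vimage vimage_def)
qed

lemma R_bounded: obtains B where "1 \<le> B" "\<And>x y. R x y \<le> B"
proof -
  obtain B where B: "0 < B" "\<And>y. \<bar>R undefined y\<bar> \<le> B" using cont_bounded[OF cont_R_left[of undefined]] by metis
  have "R x y \<le> 2 * B + 1" for x y
    using R_tri[of x y undefined] B(2)[of x] B(2)[of y] R_sym[of x undefined] B(1) by linarith
  then show ?thesis using that[of "2 * B + 1"] B(1) by auto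
qed

end

section \<open>Cells and cutoff functions\<close>

context pcf_harmonic
begin

section \<open>Words stopped at a given resistance scale\<close>

definition rmin :: real where "rmin = Min (range r)"
definition rmax :: real where "rmax = Max (range r)"

lemma rmin_pos: "0 < rmin" and rmin_le: "rmin \<le> r i"
  by (auto simp: rmin_def r_pos)

lemma rmax_less_1: "rmax < 1" and rmax_ge: "r i \<le> rmax" and rmax_pos: "0 < rmax"
proof -
  show "rmax < 1" "r i \<le> rmax" by (auto simp: rmax_def r_less_1)
  then show "0 < rmax" using r_pos[of i] by linarith
qed

lemma rw_le_power: "rw r w \<le> rmax ^ length w"
  by (induction w) (auto intro!: mult_mono simp: rmax_ge rw_pos less_imp_le r_pos rmax_pos)

lemma rw_append_le: "rw r (u @ v) \<le> rw r u"
  using mult_left_mono[OF rw_le_1[of v], of "rw r u"] rw_pos[of u] by (simp add: rw_append)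

lemma rw_small: assumes "0 < \<delta>" obtains n where "\<And>w. n \<le> length w \<Longrightarrow> rw r w \<le> \<delta>"
proof -
  obtain n where n: "rmax ^ n < \<delta>" using real_arch_pow_inv[OF assms rmax_less_1] by auto
  have "rw r w \<le> \<delta>" if "n \<le> length w" for w
  proof -
    have "rw r w \<le> rmax ^ length w" by (rule rw_le_power)
    also have "\<dots> \<le> rmax ^ n" using that rmax_pos rmax_less_1 by (intro power_decreasing) auto
    finally show ?thesis using n by simp
  qed
  then show ?thesis by (rule that)
qed

text \<open>Words of equal length can have very different \<open>rw\<close>, so cells of size
  \<delta> are selected by a stopping rule: a word is cut as soon as \<open>rw\<close> falls to at
  most \<delta>. The words obtained form an antichain for the prefix order, and on them
  \<open>rw\<close> lies between \<open>rmin * \<delta>\<close> and \<delta>.\<close>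

definition Lam :: "real \<Rightarrow> 'i list set" where
  "Lam \<delta> = {w. w \<noteq> [] \<and> rw r w \<le> \<delta> \<and> \<delta> < rw r (butlast w)}"

lemma Lam_prefix_exists:
  assumes "\<delta> < 1" "rw r w \<le> \<delta>" shows "\<exists>u v. w = u @ v \<and> u \<in> Lam \<delta>"
  using assms(2)
proof (induction w rule: rev_induct)
  case (snoc i w)
  show ?case
  proof (cases "rw r w \<le> \<delta>")
    case True
    then obtain u v where "w = u @ v" "u \<in> Lam \<delta>" using snoc by auto
    then show ?thesis by (intro exI[of _ u] exI[of _ "v @ [i]"]) auto
  next
    case False
    then have "w @ [i] \<in> Lam \<delta>" using snoc by (auto simp: Lam_def)
    then show ?thesis by blast
  qed
qed (use assms in auto)

lemma Lam_prefix_free: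
  assumes "u \<in> Lam \<delta>" "u @ z \<in> Lam \<delta>" shows "z = []"
proof (rule ccontr)
  assume "z \<noteq> []"
  then have "\<delta> < rw r (u @ butlast z)" using assms by (auto simp: Lam_def butlast_append)
  also have "\<dots> \<le> rw r u" by (rule rw_append_le)
  finally show False using assms by (auto simp: Lam_def)
qed

lemma Lam_prefix_unique:
  assumes "u @ v = u' @ v'" "u \<in> Lam \<delta>" "u' \<in> Lam \<delta>" shows "u = u'"
  using assms Lam_prefix_free[of u \<delta>] Lam_prefix_free[of u' \<delta>]
  by (auto simp: append_eq_append_conv2)

lemma Lam_length: assumes "0 < \<delta>"
  obtains n where "\<And>w. n \<le> length w \<Longrightarrow> rw r w \<le> \<delta>" "\<And>w. w \<in> Lam \<delta> \<Longrightarrow> length w \<le> n"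
proof -
  obtain n where n: "\<And>w. n \<le> length w \<Longrightarrow> rw r w \<le> \<delta>" using rw_small[OF assms] by auto
  have "length w \<le> n" if "w \<in> Lam \<delta>" for w
  proof (rule ccontr)
    assume "\<not> length w \<le> n"
    then have "rw r (butlast w) \<le> \<delta>" by (intro n) simp
    then show False using that by (auto simp: Lam_def)
  qed
  with n show ?thesis by (rule that)
qed

lemma finite_Lam [simp]: assumes "0 < \<delta>" shows "finite (Lam \<delta>)"
proof -
  obtain n where "\<And>w. w \<in> Lam \<delta> \<Longrightarrow> length w \<le> n" using Lam_length[OF assms] by metis
  then have "Lam \<delta> \<subseteq> {w. set w \<subseteq> UNIV \<and> length w \<le> n}" by auto
  then show ?thesis by (rule finite_subset) (rule finite_lists_length_le, simp)
qed

lemma Lam_rw_ge: assumes "w \<in> Lam \<delta>" shows "rmin * \<delta> \<le> rw r w"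
proof -
  have w: "w = butlast w @ [last w]" using assms by (auto simp: Lam_def)
  have "rmin * \<delta> \<le> r (last w) * rw r (butlast w)"
    using assms rmin_pos order.trans[OF less_imp_le[OF rw_pos[of w]]]
    by (intro mult_mono rmin_le) (auto simp: Lam_def rw_pos r_pos less_imp_le)
  also have "\<dots> = rw r w" by (subst (2) w) (simp add: rw_append)
  finally show ?thesis .
qed

lemma additive_words:
  fixes f :: "'i list \<Rightarrow> 'b::comm_monoid_add"
  assumes "\<And>w. length w < m \<Longrightarrow> f w = (\<Sum>i\<in>UNIV. f (w @ [i]))"
  shows "length v + k \<le> m \<Longrightarrow> f v = (\<Sum>w\<in>words k. f (v @ w))"
proof (induction k arbitrary: v)
  case (Suc k)
  have "f v = (\<Sum>i\<in>UNIV. f (v @ [i]))" using Suc.prems by (intro assms) auto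
  also have "\<dots> = (\<Sum>i\<in>UNIV. \<Sum>w\<in>words k. f ((v @ [i]) @ w))"
    using Suc.prems by (intro sum.cong refl Suc.IH) auto
  finally show ?case by (simp add: sum_words_Suc)
qed (simp add: words_0)

text \<open>Both sides are compared with the sum over all words of length \<open>m\<close>, in which
  each stopped word is replaced by its extensions. Additivity is demanded only below length
  \<open>m\<close>: the application to the energy uses the levels \<open>m - length w\<close>, where
  no further subdivision is possible once the difference is 0. The other application is to the
  measure.\<close>

lemma sum_Lam_words:
  fixes f :: "'i list \<Rightarrow> 'b::comm_monoid_add"
  assumes \<delta>: "0 < \<delta>" "\<delta> < 1"
    and small: "\<And>w. m \<le> length w \<Longrightarrow> rw r w \<le> \<delta>"
    and len: "\<And>w. w \<in> Lam \<delta> \<Longrightarrow> length w \<le> m"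
    and add: "\<And>w. length w < m \<Longrightarrow> f w = (\<Sum>i\<in>UNIV. f (w @ [i]))"
  shows "(\<Sum>v\<in>Lam \<delta>. f v) = f []"
proof -
  let ?A = "\<lambda>v. (\<lambda>w. v @ w) ` words (m - length v)"
  have eq: "words m = (\<Union>v\<in>Lam \<delta>. ?A v)"
  proof (intro set_eqI iffI)
    fix w :: "'i list" assume w: "w \<in> words m"
    then obtain u v where uv: "w = u @ v" "u \<in> Lam \<delta>"
      using Lam_prefix_exists[OF \<delta>(2) small[of w]] by (auto simp: words_def)
    then have "v \<in> words (m - length u)" using w by (auto simp: words_def)
    then show "w \<in> (\<Union>v\<in>Lam \<delta>. ?A v)" using uv by blast
  next
    fix w :: "'i list" assume "w \<in> (\<Union>v\<in>Lam \<delta>. ?A v)"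
    then show "w \<in> words m" using len by (auto simp: words_def)
  qed
  have "f [] = (\<Sum>w\<in>words m. f w)" using additive_words[of m f "[]" m] add by simp
  also have "\<dots> = (\<Sum>v\<in>Lam \<delta>. \<Sum>w\<in>?A v. f w)"
    unfolding eq using \<delta> by (intro sum.UNION_disjoint) (auto dest: Lam_prefix_unique)
  also have "\<dots> = (\<Sum>v\<in>Lam \<delta>. \<Sum>w\<in>words (m - length v). f (v @ w))"
    by (intro sum.cong refl sum.reindex[unfolded comp_def]) (auto simp: inj_on_def)
  also have "\<dots> = (\<Sum>v\<in>Lam \<delta>. f v)"
    using len add by (intro sum.cong refl additive_words[symmetric, of m]) auto
  finally show ?thesis by simp
qed

section \<open>Codes of points and the number of cells at a point\<close>

lemma code_shift: "\<pi> \<omega> = Fw F (map \<omega> [0..<n]) (\<pi> (\<lambda>k. \<omega> (n + k)))"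
proof (induction n)
  case (Suc n)
  have "(\<lambda>k. \<omega> (n + k)) = case_nat (\<omega> n) (\<lambda>k. \<omega> (Suc n + k))"
    by (auto split: nat.split)
  then have "\<pi> (\<lambda>k. \<omega> (n + k)) = F (\<omega> n) (\<pi> (\<lambda>k. \<omega> (Suc n + k)))"
    by (metis code_cons)
  with Suc show ?case by (simp add: Fw_append)
qed simp

lemma Fw_code: "Fw F w (\<pi> \<omega>) = \<pi> (\<lambda>k. if k < length w then w ! k else \<omega> (k - length w))"
proof (induction w)
  case (Cons i w)
  have "(\<lambda>k. if k < length (i # w) then (i # w) ! k else \<omega> (k - length (i # w)))
     = case_nat i (\<lambda>k. if k < length w then w ! k else \<omega> (k - length w))"
    by (auto split: nat.split)
  then show ?case using Cons by (simp add: code_cons)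
qed simp

lemma critical_setI:
  assumes "i \<noteq> j" "F i a = F j b" shows "F i a \<in> critical_set F"
proof -
  have "j \<in> - {i}" "F i a \<in> range (F i)" using assms(1) by auto
  moreover have "F i a \<in> range (F j)" unfolding assms(2) by (rule rangeI)
  ultimately show ?thesis unfolding critical_set_def by blast
qed

text \<open>The summand 1 covers points with a single code and keeps \<open>N0\<close>
  positive.\<close>

definition N0 :: nat where
  "N0 = CARD('i) * card (post_critical_set F \<pi>) + 1"

text \<open>A point with several codes is, after removal of their common prefix, a critical point, whose
  codes are determined by their first letter and their shift, a post-critical sequence.\<close>

lemma card_codes: "finite {\<omega>. \<pi> \<omega> = x} \<and> card {\<omega>. \<pi> \<omega> = x} \<le> N0"
proof (cases "\<exists>\<omega> \<omega>'. \<pi> \<omega> = x \<and> \<pi> \<omega>' = x \<and> \<omega> \<noteq> \<omega>'")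
  case True
  let ?C = "{\<omega>. \<pi> \<omega> = x}"
  let ?P = "post_critical_set F \<pi>"
  have finP: "finite ?P" using pcf by (simp add: post_critically_finite_def)
  \<comment> \<open>The least \<open>n\<close> with this property is the length of the common prefix
    of all codes of \<open>x\<close>.\<close>
  define Q where "Q n \<longleftrightarrow> (\<exists>\<omega>\<in>?C. \<exists>\<omega>'\<in>?C. \<omega> n \<noteq> \<omega>' n)" for n
  define n where "n = (LEAST n. Q n)"
  have "\<exists>n. Q n" using True by (auto simp: Q_def fun_eq_iff)
  then have "Q n" unfolding n_def by (rule LeastI_ex)
  then obtain \<omega>1 \<omega>2 where o: "\<omega>1 \<in> ?C" "\<omega>2 \<in> ?C" "\<omega>1 n \<noteq> \<omega>2 n" by (auto simp: Q_def)
  have agree: "\<omega> k = \<omega>' k" if "\<omega> \<in> ?C" "\<omega>' \<in> ?C" "k < n" for \<omega> \<omega>' k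
  proof -
    have "\<not> Q k" using not_less_Least[of k Q] that(3) by (simp add: n_def)
    then show ?thesis using that(1,2) unfolding Q_def by blast
  qed
  define c where "c = \<pi> (\<lambda>k. \<omega>1 (n + k))"
  have c: "\<pi> (\<lambda>k. \<omega> (n + k)) = c" if "\<omega> \<in> ?C" for \<omega>
  proof -
    have "map \<omega> [0..<n] = map \<omega>1 [0..<n]" using agree[OF that o(1)] by (intro map_cong) auto
    then have "Fw F (map \<omega>1 [0..<n]) (\<pi> (\<lambda>k. \<omega> (n + k))) = Fw F (map \<omega>1 [0..<n]) c"
      using code_shift[of \<omega> n] code_shift[of \<omega>1 n] that o(1) unfolding c_def by (metis mem_Collect_eq)
    then show ?thesis using inj_Fw by (auto dest: injD)
  qed
  have step: "c = F (\<omega> n) (\<pi> (\<lambda>k. \<omega> (Suc n + k)))" if "\<omega> \<in> ?C" for \<omega>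
  proof -
    have "(\<lambda>k. \<omega> (n + k)) = case_nat (\<omega> n) (\<lambda>k. \<omega> (Suc n + k))" by (auto split: nat.split)
    then show ?thesis using c[OF that] by (metis code_cons)
  qed
  have crit: "c \<in> critical_set F"
    using critical_setI[OF o(3)] step[OF o(1)] step[OF o(2)] by metis
  let ?f = "\<lambda>\<omega>::nat \<Rightarrow> 'i. (\<omega> n, \<lambda>k. \<omega> (Suc n + k))"
  have "?f ` ?C \<subseteq> UNIV \<times> ?P"
  proof safe
    fix \<omega> assume "x = \<pi> \<omega>"
    then have "\<pi> (\<lambda>k. \<omega> (n + k)) \<in> critical_set F" using c crit by auto
    then have "(\<lambda>k. (\<lambda>k. \<omega> (n + k)) (1 + k)) \<in> ?P"
      unfolding post_critical_set_def by (intro CollectI exI[of _ 1] exI[of _ "\<lambda>k. \<omega> (n + k)"]) simp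
    then show "(\<lambda>k. \<omega> (Suc n + k)) \<in> ?P" by simp
  qed auto
  then have sub: "?f ` ?C \<subseteq> UNIV \<times> ?P" .
  have inj: "inj_on ?f ?C"
  proof (rule inj_onI)
    fix \<omega> \<omega>' assume a: "\<omega> \<in> ?C" "\<omega>' \<in> ?C" "?f \<omega> = ?f \<omega>'"
    show "\<omega> = \<omega>'"
    proof
      fix k
      consider "k < n" | "k = n" | j where "k = Suc n + j"
        by (metis add_Suc_right less_imp_Suc_add linorder_neqE_nat add_Suc)
      then show "\<omega> k = \<omega>' k" using a agree[OF a(1,2)] by cases (auto dest: fun_cong)
    qed
  qed
  have fin: "finite ((UNIV :: 'i set) \<times> ?P)" using finP by simp
  have "finite ?C" "card ?C \<le> card ((UNIV :: 'i set) \<times> ?P)"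
    using inj_on_finite[OF inj sub fin] card_inj_on_le[OF inj sub fin] by simp_all
  then show ?thesis by (simp add: N0_def card_cartesian_product)
next
  case False
  have "?thesis \<or> (\<exists>\<omega>. \<pi> \<omega> = x)" using surj_code by (metis surj_def)
  then obtain \<omega> where "\<pi> \<omega> = x" using surj_code by (metis surj_def)
  with False have "{\<omega>. \<pi> \<omega> = x} = {\<omega>}" by auto
  then show ?thesis by (simp add: N0_def)
qed

definition cells :: "real \<Rightarrow> 'a \<Rightarrow> 'i list set" where
  "cells \<delta> x = {v \<in> Lam \<delta>. x \<in> range (Fw F v)}"

definition nbs :: "real \<Rightarrow> 'i list set \<Rightarrow> 'i list set" where
  "nbs \<delta> G = {v \<in> Lam \<delta>. \<exists>w\<in>G. range (Fw F v) \<inter> range (Fw F w) \<noteq> {}}"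

lemma cells_subset: "cells \<delta> x \<subseteq> Lam \<delta>" and nbs_subset: "nbs \<delta> G \<subseteq> Lam \<delta>"
  by (auto simp: cells_def nbs_def)

text \<open>A cell that contains \<open>x\<close> supplies a code of \<open>x\<close> that starts
  with the word of the cell. Words in \<open>Lam \<delta>\<close> are prefix-free, so different
  cells give different codes, and \<open>card_codes\<close> bounds their number.\<close>

lemma card_cells: "card (cells \<delta> x) \<le> N0"
proof -
  have "\<exists>\<omega>. \<pi> \<omega> = x \<and> (\<exists>s. \<omega> = (\<lambda>k. if k < length v then v ! k else s k))" if v: "v \<in> cells \<delta> x" for v
  proof -
    obtain a where a: "x = Fw F v a" using v unfolding cells_def by blast
    obtain \<omega> where "a = \<pi> \<omega>" using surj_code by (metis surj_def)
    with a show ?thesis using Fw_code[of v \<omega>] by auto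
  qed
  then obtain g where g: "\<And>v. v \<in> cells \<delta> x \<Longrightarrow> \<pi> (g v) = x"
      "\<And>v. v \<in> cells \<delta> x \<Longrightarrow> \<exists>s. g v = (\<lambda>k. if k < length v then v ! k else s k)"
    by metis
  have pre: "v = map (g v) [0..<length v]" if v: "v \<in> cells \<delta> x" for v
  proof -
    obtain s where s: "g v = (\<lambda>k. if k < length v then v ! k else s k)" using g(2)[OF v] by auto
    show ?thesis unfolding s by (intro nth_equalityI) auto
  qed
  have "inj_on g (cells \<delta> x)"
  proof (rule inj_onI)
    fix u v assume a: "u \<in> cells \<delta> x" "v \<in> cells \<delta> x" "g u = g v"
    have *: "\<exists>z. map h [0..<n] = map h [0..<m] @ z" if "m \<le> n" for m n :: nat and h :: "nat \<Rightarrow> 'i"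
      using that upt_add_eq_append[of 0 m "n - m"] by (intro exI[of _ "map h [m..<n]"]) simp
    show "u = v"
    proof (cases "length u \<le> length v")
      case True
      then obtain z where "v = u @ z" using *[OF True, of "g u"] pre[OF a(1)] pre[OF a(2)] a(3) by auto
      then show ?thesis using a Lam_prefix_free[of u \<delta> z] by (auto simp: cells_def)
    next
      case False
      then have "length v \<le> length u" by simp
      from *[OF this, of "g u"] obtain z where "u = v @ z" using pre[OF a(1)] pre[OF a(2)] a(3) by auto
      then show ?thesis using a Lam_prefix_free[of v \<delta> z] by (auto simp: cells_def)
    qed
  qed
  then have "card (cells \<delta> x) \<le> card {\<omega>. \<pi> \<omega> = x}"
    using g(1) card_codes[of x] by (intro card_inj_on_le[of g]) auto
  then show ?thesis using card_codes[of x] by simp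
qed

lemma cells_nonempty: assumes "0 < \<delta>" "\<delta> < 1" shows "cells \<delta> x \<noteq> {}"
proof -
  obtain n where n: "\<And>w. n \<le> length w \<Longrightarrow> rw r w \<le> \<delta>" using rw_small[OF assms(1)] by auto
  obtain \<omega> where \<omega>: "x = \<pi> \<omega>" using surj_code by (metis surj_def)
  obtain u v where uv: "map \<omega> [0..<n] = u @ v" "u \<in> Lam \<delta>"
    using Lam_prefix_exists[OF assms(2) n[of "map \<omega> [0..<n]"]] by auto
  have "x = Fw F u (Fw F v (\<pi> (\<lambda>k. \<omega> (n + k))))"
    using code_shift[of \<omega> n] \<omega> uv by (simp add: Fw_append)
  then show ?thesis using uv(2) by (auto simp: cells_def)
qed

text \<open>Incomparable words split at letters \<open>i \<noteq> j\<close> after a common prefix.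
  Injectivity of the map of the prefix turns the meeting point into a point of two different
  first-level cells, that is a critical point, and \<open>a\<close> is a preimage of it under a
  nonempty word.\<close>

lemma touching_vertex:
  assumes "u \<in> Lam \<delta>" "v \<in> Lam \<delta>" "u \<noteq> v" "Fw F u a = Fw F v b"
  shows "a \<in> V"
proof -
  have "\<not> prefix u v" "\<not> prefix v u"
    using assms Lam_prefix_free[of u \<delta>] Lam_prefix_free[of v \<delta>] by (auto simp: prefix_def)
  then have "u \<parallel> v" by (simp add: parallel_def)
  then obtain p i u' j v' where d: "i \<noteq> j" "u = p @ i # u'" "v = p @ j # v'"
    using parallel_decomp by blast
  have "Fw F p (Fw F (i # u') a) = Fw F p (Fw F (j # v') b)"
    using assms(4) unfolding d by (simp add: Fw_append)
  then have eq: "Fw F (i # u') a = Fw F (j # v') b" using inj_Fw by (auto dest: injD)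
  have "Fw F (i # u') a \<in> critical_set F"
    using critical_setI[OF d(1), of "Fw F u' a" "Fw F v' b"] eq by simp
  then show ?thesis unfolding V0_def by blast
qed

definition N1 :: nat where "N1 = card V * N0 + 1"

text \<open>A cell that touches the cell of \<open>w\<close> without being equal to it contains one
  of the finitely many boundary points of the cell of \<open>w\<close>, and each of these lies in at
  most \<open>N0\<close> cells.\<close>

lemma card_nbs: assumes "0 < \<delta>" "G \<subseteq> Lam \<delta>" shows "card (nbs \<delta> G) \<le> card G * N1"
proof -
  have fG: "finite G" using assms finite_Lam finite_subset by blast
  have fc: "finite (cells \<delta> x)" for x using assms finite_Lam finite_subset[OF cells_subset] by blast
  have one: "card (nbs \<delta> {w}) \<le> N1" if w: "w \<in> Lam \<delta>" for w
  proof -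
    have "nbs \<delta> {w} \<subseteq> insert w (\<Union>p\<in>V. cells \<delta> (Fw F w p))"
    proof
      fix v assume v: "v \<in> nbs \<delta> {w}"
      obtain a b where ab: "v \<in> Lam \<delta>" "Fw F w a = Fw F v b" using v unfolding nbs_def by (blast dest: sym)
      show "v \<in> insert w (\<Union>p\<in>V. cells \<delta> (Fw F w p))"
        using touching_vertex[OF w ab(1) _ ab(2)] ab by (cases "w = v") (auto simp: cells_def)
    qed
    then have "card (nbs \<delta> {w}) \<le> card (insert w (\<Union>p\<in>V. cells \<delta> (Fw F w p)))"
      by (intro card_mono) (auto simp: fc)
    also have "\<dots> \<le> card (\<Union>p\<in>V. cells \<delta> (Fw F w p)) + 1"
      by (simp add: card_insert_if fc)
    also have "card (\<Union>p\<in>V. cells \<delta> (Fw F w p)) \<le> (\<Sum>p\<in>V. card (cells \<delta> (Fw F w p)))"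
      by (rule card_UN_le) simp
    also have "\<dots> \<le> card V * N0"
      using sum_bounded_above[of V "\<lambda>p. card (cells \<delta> (Fw F w p))" N0] by (simp add: card_cells)
    finally show ?thesis by (simp add: N1_def)
  qed
  have "nbs \<delta> G = (\<Union>w\<in>G. nbs \<delta> {w})" by (auto simp: nbs_def)
  then have "card (nbs \<delta> G) \<le> (\<Sum>w\<in>G. card (nbs \<delta> {w}))" using card_UN_le[OF fG] by simp
  also have "\<dots> \<le> card G * N1"
    using sum_bounded_above[of G "\<lambda>w. card (nbs \<delta> {w})" N1] one assms by auto
  finally show ?thesis .
qed

section \<open>Cutoff functions built from cells\<close>

lemma indicator_fun_exists:
  assumes "A \<subseteq> V" shows "\<exists>h\<in>Dom. \<forall>q\<in>V. h q = of_bool (q \<in> A)"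
proof -
  have "\<exists>u. p \<noteq> q \<longrightarrow> u \<in> Dom \<and> u p \<noteq> u q" for p q
    using Dom_separates by metis
  then obtain u where u: "\<And>p q. p \<noteq> q \<Longrightarrow> u p q \<in> Dom" "\<And>p q. p \<noteq> q \<Longrightarrow> u p q p \<noteq> u p q q"
    by metis
  \<comment> \<open>Lagrange interpolation: each factor vanishes at its \<open>q\<close> and equals
    1 at \<open>p\<close>.\<close>
  define s where "s p x = (\<Prod>q\<in>V - {p}. (u p q x - u p q q) * (1 / (u p q p - u p q q)))" for p x
  have sD: "s p \<in> Dom" for p unfolding s_def
  proof (rule Dom_prod)
    fix q assume "q \<in> V - {p}"
    then have "u p q \<in> Dom" using u by auto
    then show "(\<lambda>x. (u p q x - u p q q) * (1 / (u p q p - u p q q))) \<in> Dom"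
      by (intro Dom_mult Dom_diff Dom_const)
  qed
  have sV: "s p q = of_bool (p = q)" if "q \<in> V" for p q
  proof (cases "p = q")
    case True
    have "s p p = (\<Prod>q\<in>V - {p}. 1)" unfolding s_def using u(2) by (intro prod.cong refl) auto
    then show ?thesis using True by simp
  next
    case False
    then show ?thesis unfolding s_def using that by (auto intro!: prod_zero)
  qed
  have "finite A" using assms finite_subset finite_V by blast
  show ?thesis
  proof (intro bexI[of _ "\<lambda>x. \<Sum>p\<in>A. s p x"] ballI Dom_sum sD)
    fix q assume "q \<in> V"
    then have "(\<Sum>p\<in>A. s p q) = (\<Sum>p\<in>A. if p = q then 1 else 0)" by (intro sum.cong refl) (simp add: sV)
    then show "(\<Sum>p\<in>A. s p q) = of_bool (q \<in> A)" using \<open>finite A\<close> by simp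
  qed
qed

text \<open>The sets \<open>V\<close> and \<open>{}\<close> get exact constants instead of
  interpolating functions: a cutoff is then exactly 1 or 0 on whole cells, and such cells contribute
  no energy.\<close>

definition vertex_fun :: "'a set \<Rightarrow> 'a \<Rightarrow> real" where
  "vertex_fun A = (if A = V then (\<lambda>_. 1) else if A = {} then (\<lambda>_. 0)
     else (SOME h. h \<in> Dom \<and> (\<forall>q\<in>V. h q = of_bool (q \<in> A))))"

lemma vertex_fun: assumes "A \<subseteq> V"
  shows "vertex_fun A \<in> Dom" "\<And>q. q \<in> V \<Longrightarrow> vertex_fun A q = of_bool (q \<in> A)"
proof -
  have "\<exists>h. h \<in> Dom \<and> (\<forall>q\<in>V. h q = of_bool (q \<in> A))" using indicator_fun_exists[OF assms] by auto
  from someI_ex[OF this] show "vertex_fun A \<in> Dom" "\<And>q. q \<in> V \<Longrightarrow> vertex_fun A q = of_bool (q \<in> A)"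
    by (auto simp: vertex_fun_def)
qed

lemma E_Suc: "E (Suc k) u v = (\<Sum>i\<in>UNIV. inverse (r i) * E k (u \<circ> F i) (v \<circ> F i))"
  using Em_add_words[of F r D 1 k u v] unfolding sum_words_1 by simp

text \<open>Functions given on the cells of \<open>Lam \<delta>\<close> can be glued if they agree
  wherever cells meet. For large \<open>m\<close> the discrete energy splits exactly over these
  cells, which bounds the energy of the glued function by the rescaled energies of the
  pieces.\<close>

lemma piecewise_Dom:
  assumes \<delta>: "0 < \<delta>" "\<delta> < 1"
    and h: "\<And>v. v \<in> Lam \<delta> \<Longrightarrow> h v \<in> Dom"
    and cons: "\<And>u v a b. u \<in> Lam \<delta> \<Longrightarrow> v \<in> Lam \<delta> \<Longrightarrow> Fw F u a = Fw F v b \<Longrightarrow> h u a = h v b"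
  obtains \<psi> where "\<psi> \<in> Dom" "\<And>v a. v \<in> Lam \<delta> \<Longrightarrow> \<psi> (Fw F v a) = h v a"
    "En \<psi> \<psi> \<le> (\<Sum>v\<in>Lam \<delta>. inverse (rw r v) * En (h v) (h v))"
proof -
  define \<psi> where "\<psi> x = (THE t. \<exists>v\<in>Lam \<delta>. \<exists>a. x = Fw F v a \<and> t = h v a)" for x
  have eq: "\<psi> (Fw F v a) = h v a" if "v \<in> Lam \<delta>" for v a
    unfolding \<psi>_def using that cons by (intro the_equality) metis+
  then have comp: "\<psi> \<circ> Fw F v = h v" if "v \<in> Lam \<delta>" for v using that by auto
  have "continuous_on (\<Union>v\<in>Lam \<delta>. range (Fw F v)) \<psi>"
  proof (rule continuous_on_closed_Union)
    fix v assume v: "v \<in> Lam \<delta>"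
    show "closed (range (Fw F v))"
      using compact_continuous_image[OF cont_Fw compact_K] compact_imp_closed by blast
    have "continuous_on (range (Fw F v)) (inv (Fw F v))"
      by (rule continuous_on_inv[OF cont_Fw compact_K]) (simp add: inj_Fw)
    then have "continuous_on (range (Fw F v)) (h v \<circ> inv (Fw F v))"
      by (rule continuous_on_compose) (rule continuous_on_subset[OF Dom_cont[OF h[OF v]]], simp)
    then show "continuous_on (range (Fw F v)) \<psi>"
      by (rule continuous_on_cong[THEN iffD1, rotated 2]) (auto simp: eq[OF v] inj_Fw)
  qed (use \<delta> in simp)
  moreover have "(\<Union>v\<in>Lam \<delta>. range (Fw F v)) = UNIV"
    using cells_nonempty[OF \<delta>] by (fastforce simp: cells_def)
  ultimately have cont: "continuous_on UNIV \<psi>" by simp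
  obtain M where M: "\<And>w. M \<le> length w \<Longrightarrow> rw r w \<le> \<delta>" "\<And>w. w \<in> Lam \<delta> \<Longrightarrow> length w \<le> M"
    using Lam_length[OF \<delta>(1)] by metis
  let ?S = "\<Sum>v\<in>Lam \<delta>. inverse (rw r v) * En (h v) (h v)"
  have big: "E m \<psi> \<psi> \<le> ?S" if "M \<le> m" for m
  proof -
    \<comment> \<open>Additive under subdivision by \<open>E_Suc\<close>; its value at the empty
      word is \<open>E m \<psi> \<psi>\<close>.\<close>
    let ?f = "\<lambda>w. inverse (rw r w) * E (m - length w) (\<psi> \<circ> Fw F w) (\<psi> \<circ> Fw F w)"
    have "(\<Sum>v\<in>Lam \<delta>. ?f v) = ?f []"
    proof (rule sum_Lam_words[OF \<delta>, of m])
      fix w :: "'i list" assume w: "length w < m"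
      then have s: "m - length w = Suc (m - Suc (length w))" by simp
      show "?f w = (\<Sum>i\<in>UNIV. ?f (w @ [i]))"
        unfolding s E_Suc by (simp add: sum_distrib_left rw_append Fw_append comp_assoc mult.assoc)
    qed (use M that order.trans in blast)+
    then have "E m \<psi> \<psi> = (\<Sum>v\<in>Lam \<delta>. ?f v)" by simp
    also have "\<dots> \<le> ?S"
      by (intro sum_mono mult_left_mono) (auto simp: comp h E_le_En rw_pos less_imp_le)
    finally show ?thesis .
  qed
  have all: "E m \<psi> \<psi> \<le> ?S" for m
    using order.trans[OF E_mono[of m "max m M"] big[of "max m M"]] by simp
  have D: "\<psi> \<in> Dom" using cont all by (auto simp: in_Dom_iff)
  have "En \<psi> \<psi> \<le> ?S" by (rule LIMSEQ_le_const2[OF En_lim_diag[OF D]]) (use all in auto)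
  with D eq show ?thesis by (rule that)
qed

text \<open>On each cell the cutoff is the vertex function of those boundary points whose images are
  vertices of cells of \<open>G\<close>. Only finitely many vertex functions occur, whence constants
  independent of \<delta>. Only cells in \<open>nbs \<delta> G\<close> carry energy, each at most a
  multiple of \<open>1 / \<delta>\<close> because \<open>rw\<close> is at least
  \<open>rmin * \<delta>\<close> there.\<close>

lemma cutoff_cells:
  obtains C where "0 < C"
    "\<And>\<delta> G. 0 < \<delta> \<Longrightarrow> \<delta> < 1 \<Longrightarrow> G \<subseteq> Lam \<delta> \<Longrightarrow> \<exists>\<psi>\<in>Dom.
       (\<forall>v\<in>G. \<forall>a. \<psi> (Fw F v a) = 1) \<and> (\<forall>v\<in>Lam \<delta> - nbs \<delta> G. \<forall>a. \<psi> (Fw F v a) = 0) \<and>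
       En \<psi> \<psi> \<le> real (card (nbs \<delta> G)) * C / \<delta> \<and> (\<forall>x. \<bar>\<psi> x\<bar> \<le> C)"
proof -
  have fP: "finite (Pow V)" by simp
  define S where "S = (\<Sum>A\<in>Pow V. En (vertex_fun A) (vertex_fun A))"
  have S: "En (vertex_fun A) (vertex_fun A) \<le> S" if "A \<subseteq> V" for A
    unfolding S_def using that fP by (intro member_le_sum) (auto intro!: En_nonneg vertex_fun)
  have S0: "0 \<le> S" unfolding S_def by (intro sum_nonneg En_nonneg vertex_fun) auto
  have "\<exists>B>0. \<forall>x. \<bar>vertex_fun A x\<bar> \<le> B" if "A \<subseteq> V" for A
    using cont_bounded[OF Dom_cont[OF vertex_fun(1)[OF that]]] by metis
  then obtain b where b: "\<And>A. A \<subseteq> V \<Longrightarrow> b A > 0" "\<And>A x. A \<subseteq> V \<Longrightarrow> \<bar>vertex_fun A x\<bar> \<le> b A" by metis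
  define B where "B = (\<Sum>A\<in>Pow V. b A)"
  have B: "\<bar>vertex_fun A x\<bar> \<le> B" if "A \<subseteq> V" for A x
  proof -
    have "b A \<le> B" unfolding B_def using that fP b by (intro member_le_sum) (auto simp: less_imp_le)
    then show ?thesis using b(2)[OF that, of x] by simp
  qed
  have B0: "0 \<le> B" using B[of "{}" undefined] by simp
  define C where "C = S / rmin + B + 1"
  have C: "0 < C" "S / rmin \<le> C" "B \<le> C"
    using S0 B0 rmin_pos by (auto simp: C_def add_nonneg_pos)
  show ?thesis
  proof (rule that[OF C(1)])
    fix \<delta> :: real and G assume \<delta>: "0 < \<delta>" "\<delta> < 1" and G: "G \<subseteq> Lam \<delta>"
    define X where "X = (\<Union>v\<in>G. Fw F v ` V)"
    define A where "A v = {p \<in> V. Fw F v p \<in> X}" for v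
    have AV: "A v \<subseteq> V" for v by (auto simp: A_def)
    let ?h = "\<lambda>v. vertex_fun (A v)"
    have cons: "?h u a = ?h v b" if "u \<in> Lam \<delta>" "v \<in> Lam \<delta>" "Fw F u a = Fw F v b" for u v a b
    proof (cases "u = v")
      case True
      then show ?thesis using that inj_Fw by (auto dest: injD)
    next
      case False
      have "a \<in> V" "b \<in> V"
        using touching_vertex[OF that(1,2) False that(3)]
          touching_vertex[OF that(2,1) False[symmetric] that(3)[symmetric]] by auto
      then show ?thesis using that(3) by (simp add: vertex_fun(2)[OF AV]) (simp add: A_def)
    qed
    obtain \<psi> where \<psi>: "\<psi> \<in> Dom" "\<And>v a. v \<in> Lam \<delta> \<Longrightarrow> \<psi> (Fw F v a) = ?h v a"
      "En \<psi> \<psi> \<le> (\<Sum>v\<in>Lam \<delta>. inverse (rw r v) * En (?h v) (?h v))"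
      by (rule piecewise_Dom[OF \<delta>, of ?h]) (rule vertex_fun(1)[OF AV], erule (2) cons, blast)
    have one: "A v = V" if "v \<in> G" for v using that by (auto simp: A_def X_def)
    have zero: "A v = {}" if "v \<in> Lam \<delta> - nbs \<delta> G" for v
      using that by (force simp: A_def X_def nbs_def)
    \<comment> \<open>If \<open>V\<close> were empty, the first case of \<open>vertex_fun\<close>
      would give the constant 1 for \<open>{}\<close>.\<close>
    have VE: "V \<noteq> {}" by (rule V0_nonempty)
    show "\<exists>\<psi>\<in>Dom. (\<forall>v\<in>G. \<forall>a. \<psi> (Fw F v a) = 1) \<and> (\<forall>v\<in>Lam \<delta> - nbs \<delta> G. \<forall>a. \<psi> (Fw F v a) = 0) \<and>
       En \<psi> \<psi> \<le> real (card (nbs \<delta> G)) * C / \<delta> \<and> (\<forall>x. \<bar>\<psi> x\<bar> \<le> C)"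
    proof (intro bexI[OF _ \<psi>(1)] conjI ballI allI)
      fix v a assume "v \<in> G"
      then show "\<psi> (Fw F v a) = 1" using \<psi>(2)[of v a] G one by (auto simp: vertex_fun_def)
    next
      fix v a assume v: "v \<in> Lam \<delta> - nbs \<delta> G"
      then show "\<psi> (Fw F v a) = 0" using \<psi>(2)[of v a] zero[OF v] VE by (auto simp: vertex_fun_def)
    next
      fix x
      obtain v where v: "v \<in> Lam \<delta>" "x \<in> range (Fw F v)"
        using cells_nonempty[OF \<delta>, of x] by (auto simp: cells_def)
      then have "\<bar>\<psi> x\<bar> \<le> B" using \<psi>(2)[OF v(1)] B[OF AV] by auto
      then show "\<bar>\<psi> x\<bar> \<le> C" using C by simp
    next
      have "(\<Sum>v\<in>Lam \<delta>. inverse (rw r v) * En (?h v) (?h v))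
         = (\<Sum>v\<in>nbs \<delta> G. inverse (rw r v) * En (?h v) (?h v))"
      proof (rule sum.mono_neutral_right)
        show "\<forall>v\<in>Lam \<delta> - nbs \<delta> G. inverse (rw r v) * En (?h v) (?h v) = 0"
          using zero VE by (auto simp: vertex_fun_def)
      qed (use \<delta> nbs_subset in auto)
      also have "\<dots> \<le> (\<Sum>v\<in>nbs \<delta> G. C / \<delta>)"
      proof (rule sum_mono)
        fix v assume "v \<in> nbs \<delta> G"
        then have "rmin * \<delta> \<le> rw r v" using nbs_subset Lam_rw_ge by blast
        then have "inverse (rw r v) \<le> inverse (rmin * \<delta>)"
          using rmin_pos \<delta> by (intro le_imp_inverse_le) auto
        then have "inverse (rw r v) * En (?h v) (?h v) \<le> inverse (rmin * \<delta>) * S"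
          using S[OF AV] En_nonneg[OF vertex_fun(1)[OF AV]] rmin_pos \<delta> by (intro mult_mono) auto
        also have "\<dots> = S / rmin / \<delta>" by (simp add: field_simps)
        also have "\<dots> \<le> C / \<delta>" using C \<delta> by (intro divide_right_mono) auto
        finally show "inverse (rw r v) * En (?h v) (?h v) \<le> C / \<delta>" .
      qed
      finally show "En \<psi> \<psi> \<le> real (card (nbs \<delta> G)) * C / \<delta>" using \<psi>(3) by simp
    qed
  qed
qed

section \<open>Comparison of resistance balls with cells\<close>

definition D0 :: real where "D0 = (SOME B. 1 \<le> B \<and> (\<forall>x y. R x y \<le> B))"

lemma D0: "1 \<le> D0" "R x y \<le> D0"
proof -
  have "\<exists>B. 1 \<le> B \<and> (\<forall>x y. R x y \<le> B)" using R_bounded by metis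
  from someI_ex[OF this] show "1 \<le> D0" "R x y \<le> D0" by (auto simp: D0_def)
qed

lemma R_cell: assumes "v \<in> Lam \<delta>" shows "R (Fw F v a) (Fw F v b) \<le> D0 * \<delta>"
proof -
  have "R (Fw F v a) (Fw F v b) \<le> rw r v * R a b" by (rule R_Fw_le)
  also have "\<dots> \<le> \<delta> * D0" using assms D0 rw_pos[of v] by (intro mult_mono) (auto simp: Lam_def)
  finally show ?thesis by (simp add: mult.commute)
qed

text \<open>A cutoff that is 1 at \<open>x\<close> and 0 at \<open>y\<close> bounds
  \<open>R x y\<close> from below by the inverse of its energy. If some cell at \<open>y\<close>
  were not a neighbour of a cell at \<open>x\<close>, the cutoff around the cells at
  \<open>x\<close> would be of this kind, with energy of order \<open>1 / \<delta>\<close>.\<close>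

lemma ball_cells:
  obtains c where "0 < c"
    "\<And>\<delta> x y. 0 < \<delta> \<Longrightarrow> \<delta> < 1 \<Longrightarrow> R x y < c * \<delta> \<Longrightarrow> cells \<delta> y \<subseteq> nbs \<delta> (cells \<delta> x)"
proof -
  obtain C where C: "0 < C"
    "\<And>\<delta> G. 0 < \<delta> \<Longrightarrow> \<delta> < 1 \<Longrightarrow> G \<subseteq> Lam \<delta> \<Longrightarrow> \<exists>\<psi>\<in>Dom.
       (\<forall>v\<in>G. \<forall>a. \<psi> (Fw F v a) = 1) \<and> (\<forall>v\<in>Lam \<delta> - nbs \<delta> G. \<forall>a. \<psi> (Fw F v a) = 0) \<and>
       En \<psi> \<psi> \<le> real (card (nbs \<delta> G)) * C / \<delta> \<and> (\<forall>x. \<bar>\<psi> x\<bar> \<le> C)"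
    using cutoff_cells by metis
  have "0 < N0" "0 < N1" by (simp_all add: N0_def N1_def)
  then have N: "0 < real N0 * real N1 * C" using C by simp
  show ?thesis
  proof (rule that[of "1 / (real N0 * real N1 * C)"])
    show "0 < 1 / (real N0 * real N1 * C)" using N by simp
    fix \<delta> x y assume \<delta>: "0 < \<delta>" "\<delta> < 1" and R: "R x y < 1 / (real N0 * real N1 * C) * \<delta>"
    let ?G = "cells \<delta> x"
    obtain \<psi> where \<psi>: "\<psi> \<in> Dom" "\<forall>v\<in>?G. \<forall>a. \<psi> (Fw F v a) = 1"
       "\<forall>v\<in>Lam \<delta> - nbs \<delta> ?G. \<forall>a. \<psi> (Fw F v a) = 0" "En \<psi> \<psi> \<le> real (card (nbs \<delta> ?G)) * C / \<delta>"
      using C(2)[OF \<delta> cells_subset, of x] by (elim bexE conjE) (rule that)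
    show "cells \<delta> y \<subseteq> nbs \<delta> ?G"
    proof (rule ccontr)
      assume "\<not> cells \<delta> y \<subseteq> nbs \<delta> ?G"
      then obtain v where "v \<in> Lam \<delta> - nbs \<delta> ?G" "y \<in> range (Fw F v)" by (auto simp: cells_def)
      then have "\<psi> y = 0" using \<psi>(3) by blast
      moreover have "\<psi> x = 1"
      proof -
        obtain v where "v \<in> ?G" using cells_nonempty[OF \<delta>] by blast
        then show ?thesis using \<psi>(2) by (auto simp: cells_def)
      qed
      ultimately have "1 \<le> R x y * En \<psi> \<psi>" using R_bound[OF \<psi>(1), of x y] by simp
      also have "\<dots> \<le> R x y * (real N0 * real N1 * C / \<delta>)"
      proof (intro mult_left_mono order.trans[OF \<psi>(4)] divide_right_mono mult_right_mono)
        have "card (nbs \<delta> ?G) \<le> N0 * N1"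
          using card_nbs[OF \<delta>(1) cells_subset, of x] card_cells[of \<delta> x] by (meson le_trans mult_le_mono1)
        then show "real (card (nbs \<delta> ?G)) \<le> real N0 * real N1" by (metis of_nat_le_iff of_nat_mult)
      qed (use C \<delta> in auto)
      also have "\<dots> < 1" using R N \<delta> by (simp add: field_simps)
      finally show False by simp
    qed
  qed
qed

lemma nbs_R:
  assumes "v \<in> nbs \<delta> G" shows "\<exists>w\<in>G. \<forall>a b. G \<subseteq> Lam \<delta> \<longrightarrow> R (Fw F w a) (Fw F v b) \<le> 2 * D0 * \<delta>"
proof -
  obtain w z z' where w: "w \<in> G" "Fw F w z = Fw F v z'" "v \<in> Lam \<delta>"
    using assms unfolding nbs_def by (blast dest: sym)
  have "R (Fw F w a) (Fw F v b) \<le> 2 * D0 * \<delta>" if "G \<subseteq> Lam \<delta>" for a b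
  proof -
    have "R (Fw F w a) (Fw F v b) \<le> R (Fw F w a) (Fw F w z) + R (Fw F v z') (Fw F v b)"
      using R_tri[of "Fw F w a" "Fw F v b" "Fw F w z"] w(2) by simp
    then show ?thesis using R_cell[of w \<delta> a z] R_cell[of v \<delta> z' b] w that by auto
  qed
  then show ?thesis using w by blast
qed

text \<open>The function is one minus a cell cutoff. The first layer of neighbours contains the ball
  of radius \<rho> by \<open>ball_cells\<close>; the second layer, outside which the function is 1,
  stays within distance \<open>4 * D0 * \<delta>\<close> of \<open>x\<close> by two uses of
  \<open>nbs_R\<close>.\<close>

lemma ball_cutoff:
  obtains C where "1 \<le> C"
    "\<And>x \<rho>. 0 < \<rho> \<Longrightarrow> \<exists>\<psi>\<in>Dom. (\<forall>y. R x y < \<rho> \<longrightarrow> \<psi> y = 0) \<and> (\<forall>y. C * \<rho> \<le> R x y \<longrightarrow> \<psi> y = 1) \<and>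
       En \<psi> \<psi> \<le> C / \<rho>"
proof -
  obtain C where C: "0 < C"
    "\<And>\<delta> G. 0 < \<delta> \<Longrightarrow> \<delta> < 1 \<Longrightarrow> G \<subseteq> Lam \<delta> \<Longrightarrow> \<exists>\<psi>\<in>Dom.
       (\<forall>v\<in>G. \<forall>a. \<psi> (Fw F v a) = 1) \<and> (\<forall>v\<in>Lam \<delta> - nbs \<delta> G. \<forall>a. \<psi> (Fw F v a) = 0) \<and>
       En \<psi> \<psi> \<le> real (card (nbs \<delta> G)) * C / \<delta> \<and> (\<forall>x. \<bar>\<psi> x\<bar> \<le> C)"
    using cutoff_cells by metis
  obtain c where c: "0 < c"
    "\<And>\<delta> x y. 0 < \<delta> \<Longrightarrow> \<delta> < 1 \<Longrightarrow> R x y < c * \<delta> \<Longrightarrow> cells \<delta> y \<subseteq> nbs \<delta> (cells \<delta> x)"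
    using ball_cells by metis
  define N where "N = real (N0 * N1 * N1)"
  \<comment> \<open>The three terms serve \<open>1 \<le> C'\<close>, the radius beyond which the
    function is 1, and its energy.\<close>
  define C' where "C' = 1 + 4 * D0 / c + N * C * c"
  have p: "0 \<le> N * C * c" "0 < 4 * D0 / c" using C c D0(1) by (auto simp: N_def)
  have C': "1 \<le> C'" "4 * D0 / c < C'" "N * C * c \<le> C'"
    using p by (auto simp: C'_def)
  show ?thesis
  proof (rule that[OF C'(1)])
    fix x and \<rho> :: real assume \<rho>: "0 < \<rho>"
    define \<delta> where "\<delta> = \<rho> / c"
    have \<rho>_eq: "\<rho> = c * \<delta>" using c by (simp add: \<delta>_def)
    have \<delta>: "0 < \<delta>" using \<rho> c by (simp add: \<delta>_def)
    have far: "4 * D0 * \<delta> < C' * \<rho>"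
      using C'(2) \<rho> c by (simp add: \<delta>_def field_simps)
    show "\<exists>\<psi>\<in>Dom. (\<forall>y. R x y < \<rho> \<longrightarrow> \<psi> y = 0) \<and> (\<forall>y. C' * \<rho> \<le> R x y \<longrightarrow> \<psi> y = 1) \<and>
       En \<psi> \<psi> \<le> C' / \<rho>"
    proof (cases "\<delta> < 1")
      case False
      \<comment> \<open>A scale of at least 1 means that \<open>C' * \<rho>\<close> exceeds the
        diameter bound \<open>D0\<close>, so the zero function meets all requirements.\<close>
      have "D0 * 1 \<le> D0 * \<delta>" using False D0(1) by (intro mult_left_mono) auto
      then have "R x y < C' * \<rho>" for y using D0(2)[of x y] far D0(1) by linarith
      then show ?thesis using \<rho> C' by (intro bexI[of _ "\<lambda>_. 0"]) (auto simp: not_le[symmetric])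
    next
      case True
      let ?G = "nbs \<delta> (cells \<delta> x)"
      obtain \<psi> where \<psi>: "\<psi> \<in> Dom" "\<forall>v\<in>?G. \<forall>a. \<psi> (Fw F v a) = 1"
         "\<forall>v\<in>Lam \<delta> - nbs \<delta> ?G. \<forall>a. \<psi> (Fw F v a) = 0" "En \<psi> \<psi> \<le> real (card (nbs \<delta> ?G)) * C / \<delta>"
        using C(2)[OF \<delta> True nbs_subset, of "cells \<delta> x"] by (elim bexE conjE) (rule that)
      show ?thesis
      proof (intro bexI[of _ "\<lambda>y. 1 - \<psi> y"] conjI allI impI)
        show D: "(\<lambda>y. 1 - \<psi> y) \<in> Dom" by (intro Dom_diff Dom_const \<psi>)
        fix y
        obtain v where v: "v \<in> cells \<delta> y" using cells_nonempty[OF \<delta> True] by blast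
        show "1 - \<psi> y = 0" if "R x y < \<rho>"
        proof -
          have "v \<in> ?G" using c(2)[OF \<delta> True, of x y] that v \<rho>_eq by auto
          then show ?thesis using v \<psi>(2) by (auto simp: cells_def)
        qed
        show "1 - \<psi> y = 1" if "C' * \<rho> \<le> R x y"
        proof -
          have "v \<notin> nbs \<delta> ?G"
          proof
            assume vn: "v \<in> nbs \<delta> ?G"
            obtain b where b: "y = Fw F v b" using v by (auto simp: cells_def)
            obtain w where w: "w \<in> ?G" "\<And>a. R (Fw F w a) y \<le> 2 * D0 * \<delta>"
              using nbs_R[OF vn] nbs_subset b by blast
            obtain u where u: "u \<in> cells \<delta> x" "\<And>a b. R (Fw F u a) (Fw F w b) \<le> 2 * D0 * \<delta>"
              using nbs_R[OF w(1)] cells_subset by blast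
            obtain a where a: "x = Fw F u a" using u(1) by (auto simp: cells_def)
            have "R x y \<le> R x (Fw F w a) + R (Fw F w a) y" by (rule R_tri)
            then have "R x y \<le> 4 * D0 * \<delta>" using u(2)[of a a] a w(2)[of a] by simp
            then show False using far that by simp
          qed
          then show ?thesis using v \<psi>(3) by (auto simp: cells_def)
        qed
      next
        have "En (\<lambda>y. 1 - \<psi> y) (\<lambda>y. 1 - \<psi> y) = En \<psi> \<psi>"
          using \<psi>(1) by (simp add: En_diff_left En_diff_right Dom_diff En_sym[of \<psi> "\<lambda>_. 1"])
        also have "\<dots> \<le> N * C / \<delta>"
        proof (intro order.trans[OF \<psi>(4)] divide_right_mono mult_right_mono)
          have "card (nbs \<delta> ?G) \<le> card ?G * N1" by (rule card_nbs[OF \<delta> nbs_subset])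
          also have "\<dots> \<le> card (cells \<delta> x) * N1 * N1"
            by (intro mult_le_mono1 card_nbs[OF \<delta> cells_subset])
          also have "\<dots> \<le> N0 * N1 * N1" by (intro mult_le_mono1 card_cells)
          finally show "real (card (nbs \<delta> ?G)) \<le> N" unfolding N_def by (rule of_nat_mono)
        qed (use C \<delta> in auto)
        also have "\<dots> = N * C * c / \<rho>" using c by (simp add: \<delta>_def)
        also have "\<dots> \<le> C' / \<rho>" using C' \<rho> by (intro divide_right_mono) auto
        finally show "En (\<lambda>y. 1 - \<psi> y) (\<lambda>y. 1 - \<psi> y) \<le> C' / \<rho>" .
      qed
    qed
  qed
qed

text \<open>Cutoffs near an arbitrary set at an arbitrarily small distance, bounded uniformly but
  without control of the energy; they serve the density argument and the bump functions.\<close>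

lemma set_cutoff:
  obtains C where "0 < C"
    "\<And>X \<delta>. 0 < \<delta> \<Longrightarrow> \<exists>\<psi>\<in>Dom. (\<forall>x\<in>X. \<psi> x = 1) \<and> (\<forall>y. (\<forall>x\<in>X. \<delta> < R x y) \<longrightarrow> \<psi> y = 0) \<and>
       (\<forall>x. \<bar>\<psi> x\<bar> \<le> C)"
proof -
  obtain C where C: "0 < C"
    "\<And>\<delta> G. 0 < \<delta> \<Longrightarrow> \<delta> < 1 \<Longrightarrow> G \<subseteq> Lam \<delta> \<Longrightarrow> \<exists>\<psi>\<in>Dom.
       (\<forall>v\<in>G. \<forall>a. \<psi> (Fw F v a) = 1) \<and> (\<forall>v\<in>Lam \<delta> - nbs \<delta> G. \<forall>a. \<psi> (Fw F v a) = 0) \<and>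
       En \<psi> \<psi> \<le> real (card (nbs \<delta> G)) * C / \<delta> \<and> (\<forall>x. \<bar>\<psi> x\<bar> \<le> C)"
    using cutoff_cells by metis
  show ?thesis
  proof (rule that[OF C(1)])
    fix X and \<epsilon> :: real assume \<epsilon>: "0 < \<epsilon>"
    define \<delta> where "\<delta> = min (1/2) (\<epsilon> / (2 * D0))"
    have \<delta>: "0 < \<delta>" "\<delta> < 1" using \<epsilon> D0(1) by (auto simp: \<delta>_def)
    have "\<delta> \<le> \<epsilon> / (2 * D0)" by (simp add: \<delta>_def)
    then have le: "2 * D0 * \<delta> \<le> \<epsilon>" using D0(1) by (simp add: field_simps)
    let ?G = "{v \<in> Lam \<delta>. range (Fw F v) \<inter> X \<noteq> {}}"
    have GL: "?G \<subseteq> Lam \<delta>" by (rule Collect_restrict)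
    obtain \<psi> where \<psi>: "\<psi> \<in> Dom" "\<forall>v\<in>?G. \<forall>a. \<psi> (Fw F v a) = 1"
       "\<forall>v\<in>Lam \<delta> - nbs \<delta> ?G. \<forall>a. \<psi> (Fw F v a) = 0" "\<forall>x. \<bar>\<psi> x\<bar> \<le> C"
      using C(2)[OF \<delta> GL] by (elim bexE conjE) (rule that)
    show "\<exists>\<psi>\<in>Dom. (\<forall>x\<in>X. \<psi> x = 1) \<and> (\<forall>y. (\<forall>x\<in>X. \<epsilon> < R x y) \<longrightarrow> \<psi> y = 0) \<and> (\<forall>x. \<bar>\<psi> x\<bar> \<le> C)"
    proof (intro bexI[OF _ \<psi>(1)] conjI \<psi>(4) ballI allI impI)
      fix x assume x: "x \<in> X"
      obtain v where v: "v \<in> Lam \<delta>" "x \<in> range (Fw F v)" using cells_nonempty[OF \<delta>, of x] by (auto simp: cells_def)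
      then show "\<psi> x = 1" using \<psi>(2) x by blast
    next
      fix y assume y: "\<forall>x\<in>X. \<epsilon> < R x y"
      obtain v where v: "v \<in> Lam \<delta>" "y \<in> range (Fw F v)" using cells_nonempty[OF \<delta>, of y] by (auto simp: cells_def)
      have "v \<notin> nbs \<delta> ?G"
      proof
        assume "v \<in> nbs \<delta> ?G"
        from nbs_R[OF this] obtain w where w: "w \<in> ?G" "\<And>a b. R (Fw F w a) (Fw F v b) \<le> 2 * D0 * \<delta>"
          by blast
        then obtain a b where "Fw F w a \<in> X" "y = Fw F v b" using v by blast
        then show False using y w(2)[of a b] le by force
      qed
      then show "\<psi> y = 0" using \<psi>(3) v by blast
    qed
  qed
qed

end

section \<open>Ahlfors regularity and the maximal function\<close>

locale pcf_measure = pcf_harmonic F \<pi> r D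
  for F :: "'i::finite \<Rightarrow> 'a::metric_space \<Rightarrow> 'a" and \<pi> r D +
  fixes d :: real and \<mu> :: "'a measure"
  assumes sum_r: "(\<Sum>i\<in>UNIV. r i powr d) = 1"
    and ssm: "self_similar_measure F (\<lambda>i. r i powr d) \<mu>"
    and d_pos: "0 < d"
begin

lemma prob_mu: "prob_space \<mu>" and sets_mu [simp, measurable_cong]: "sets \<mu> = sets borel"
  and mu_step: "A \<in> sets borel \<Longrightarrow> emeasure \<mu> A = (\<Sum>i\<in>UNIV. ennreal (r i powr d) * emeasure \<mu> (F i -` A))"
  using ssm by (auto simp: self_similar_measure_def)

sublocale prob_space \<mu> by (rule prob_mu)

lemma space_mu [simp]: "space \<mu> = UNIV"
  using sets_eq_imp_space_eq[OF sets_mu] by simp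

abbreviation "B \<equiv> res_ball F r D"

lemma open_sets [simp]: "open A \<Longrightarrow> A \<in> sets borel" by simp

lemma B_sets [simp, measurable]: "B x e \<in> sets borel"
  using open_res_ball by simp

lemma B_mono: "e \<le> e' \<Longrightarrow> B x e \<subseteq> B x e'"
  by (auto simp: res_ball_def)

lemma cont_meas: "continuous_on UNIV (f :: 'a \<Rightarrow> real) \<Longrightarrow> f \<in> borel_measurable \<mu>"
  using borel_measurable_continuous_onI[of f] measurable_cong_sets[OF sets_mu refl] by blast

lemma cont_int: "continuous_on UNIV (f :: 'a \<Rightarrow> real) \<Longrightarrow> integrable \<mu> f"
proof -
  assume f: "continuous_on UNIV f"
  then obtain b where "\<And>x. \<bar>f x\<bar> \<le> b" using cont_bounded by metis
  then show ?thesis by (intro integrable_const_bound[of _ b] cont_meas f) auto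
qed

lemma Fw_vimage: "A \<in> sets borel \<Longrightarrow> Fw F w -` A \<in> sets borel"
  using measurable_sets[OF borel_measurable_continuous_onI[OF cont_Fw[of w]], of A] by simp

text \<open>Self-similarity iterated along the stopped words. Working with preimages under the cell
  maps avoids any discussion of the measure of overlaps.\<close>

lemma mu_Lam:
  assumes "0 < \<delta>" "\<delta> < 1" "A \<in> sets borel"
  shows "emeasure \<mu> A = (\<Sum>v\<in>Lam \<delta>. ennreal (rw r v powr d) * emeasure \<mu> (Fw F v -` A))"
proof -
  obtain M where M: "\<And>w. M \<le> length w \<Longrightarrow> rw r w \<le> \<delta>" "\<And>w. w \<in> Lam \<delta> \<Longrightarrow> length w \<le> M"
    using Lam_length[OF assms(1)] by metis
  let ?f = "\<lambda>w. ennreal (rw r w powr d) * emeasure \<mu> (Fw F w -` A)"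
  have "(\<Sum>v\<in>Lam \<delta>. ?f v) = ?f []"
  proof (rule sum_Lam_words[OF assms(1,2) M])
    fix w :: "'i list"
    have "?f w = (\<Sum>i\<in>UNIV. ennreal (rw r w powr d) * (ennreal (r i powr d) * emeasure \<mu> (F i -` (Fw F w -` A))))"
      by (simp add: mu_step[OF Fw_vimage[OF assms(3)], of w] sum_distrib_left)
    also have "\<dots> = (\<Sum>i\<in>UNIV. ?f (w @ [i]))"
      by (intro sum.cong refl)
        (simp add: rw_append Fw_append powr_mult rw_pos r_pos less_imp_le ennreal_mult vimage_comp mult.assoc)
    finally show "?f w = (\<Sum>i\<in>UNIV. ?f (w @ [i]))" .
  qed
  then show ?thesis by simp
qed

text \<open>At the scale \<open>\<rho> / (2 * D0)\<close> every cell at \<open>x\<close> has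
  diameter at most \<open>\<rho> / 2\<close> and lies in the ball; the term of one such cell in
  \<open>mu_Lam\<close> already gives the bound.\<close>

lemma ball_lower: obtains c where "0 < c" "\<And>x \<rho>. 0 < \<rho> \<Longrightarrow> \<rho> \<le> 1 \<Longrightarrow> c * \<rho> powr d \<le> measure \<mu> (B x \<rho>)"
proof -
  define c where "c = (rmin / (2 * D0)) powr d"
  have q: "0 < rmin / (2 * D0)" using rmin_pos D0(1) by simp
  have c: "0 < c" using rmin_pos D0(1) by (auto simp: c_def)
  have "c * \<rho> powr d \<le> measure \<mu> (B x \<rho>)" if \<rho>: "0 < \<rho>" "\<rho> \<le> 1" for x \<rho>
  proof -
    define \<delta> where "\<delta> = \<rho> / (2 * D0)"
    have \<delta>: "0 < \<delta>" "\<delta> < 1" using \<rho> D0(1) by (auto simp: \<delta>_def)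
    obtain v where v: "v \<in> Lam \<delta>" "x \<in> range (Fw F v)" using cells_nonempty[OF \<delta>, of x] by (auto simp: cells_def)
    have "Fw F v -` B x \<rho> = UNIV"
    proof -
      have "R x (Fw F v b) < \<rho>" for b
      proof -
        have "R x (Fw F v b) \<le> D0 * \<delta>" using v R_cell by auto
        also have "\<dots> = \<rho> / 2" using D0(1) by (simp add: \<delta>_def)
        finally show ?thesis using \<rho> by simp
      qed
      then show ?thesis by (auto simp: res_ball_def)
    qed
    then have "emeasure \<mu> (Fw F v -` B x \<rho>) = 1" using emeasure_space_1 by simp
    then have "ennreal (rw r v powr d) = ennreal (rw r v powr d) * emeasure \<mu> (Fw F v -` B x \<rho>)" by simp
    also have "\<dots> \<le> (\<Sum>v\<in>Lam \<delta>. ennreal (rw r v powr d) * emeasure \<mu> (Fw F v -` B x \<rho>))"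
      using v \<delta> by (intro member_le_sum) auto
    also have "\<dots> = emeasure \<mu> (B x \<rho>)" by (rule mu_Lam[symmetric]) (use \<delta> in auto)
    finally have "rw r v powr d \<le> measure \<mu> (B x \<rho>)" by (simp add: emeasure_eq_measure)
    moreover have "c * \<rho> powr d \<le> rw r v powr d"
    proof -
      have "c * \<rho> powr d = (rmin / (2 * D0) * \<rho>) powr d"
        unfolding c_def by (subst powr_mult) (use q \<rho> in auto)
      also have "rmin / (2 * D0) * \<rho> = rmin * \<delta>" by (simp add: \<delta>_def)
      also have "(rmin * \<delta>) powr d \<le> rw r v powr d"
        using Lam_rw_ge[OF v(1)] d_pos rmin_pos \<delta> by (intro powr_mono2) auto
      finally show ?thesis .
    qed
    ultimately show ?thesis by simp
  qed
  with c show ?thesis by (rule that)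
qed

text \<open>At the scale \<open>\<rho> / c\<close> the ball meets only neighbours of the cells at
  \<open>x\<close>. There are at most \<open>N0 * N1\<close> of them, each of weight at most
  \<open>\<delta> powr d\<close>.\<close>

lemma ball_upper: obtains C where "0 < C" "\<And>x \<rho>. 0 < \<rho> \<Longrightarrow> measure \<mu> (B x \<rho>) \<le> C * \<rho> powr d"
proof -
  obtain c where c: "0 < c"
    "\<And>\<delta> x y. 0 < \<delta> \<Longrightarrow> \<delta> < 1 \<Longrightarrow> R x y < c * \<delta> \<Longrightarrow> cells \<delta> y \<subseteq> nbs \<delta> (cells \<delta> x)"
    using ball_cells by metis
  define N where "N = real (N0 * N1)"
  have "1 \<le> N0 * N1" by (simp add: N0_def N1_def)
  from of_nat_mono[OF this, where 'a = real] have N: "1 \<le> N" unfolding N_def by (simp only: of_nat_1)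
  define C where "C = N * (1 / c) powr d"
  have C: "0 < C" using N c by (simp add: C_def)
  have "measure \<mu> (B x \<rho>) \<le> C * \<rho> powr d" if \<rho>: "0 < \<rho>" for x \<rho>
  proof -
    define \<delta> where "\<delta> = \<rho> / c"
    have \<delta>: "0 < \<delta>" using \<rho> c by (simp add: \<delta>_def)
    have eq: "C * \<rho> powr d = N * \<delta> powr d"
    proof -
      have "(1 / c) powr d * \<rho> powr d = (1 / c * \<rho>) powr d" using c \<rho> by (subst powr_mult) auto
      then show ?thesis by (simp add: C_def \<delta>_def mult.assoc)
    qed
    show ?thesis
    proof (cases "\<delta> < 1")
      case False
      then have "1 \<le> \<delta> powr d" using d_pos by (simp add: ge_one_powr_ge_zero)
      then have "1 * 1 \<le> N * \<delta> powr d" using N by (intro mult_mono) auto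
      then show ?thesis using prob_le_1[of "B x \<rho>"] eq by linarith
    next
      case True
      let ?G = "nbs \<delta> (cells \<delta> x)"
      let ?f = "\<lambda>v. ennreal (rw r v powr d) * emeasure \<mu> (Fw F v -` B x \<rho>)"
      have "emeasure \<mu> (B x \<rho>) = (\<Sum>v\<in>Lam \<delta>. ?f v)" by (rule mu_Lam) (use \<delta> True in auto)
      also have "\<dots> = (\<Sum>v\<in>?G. ?f v)"
      proof (rule sum.mono_neutral_right)
        show "\<forall>v\<in>Lam \<delta> - ?G. ?f v = 0"
        proof
          fix v assume v: "v \<in> Lam \<delta> - ?G"
          have "Fw F v -` B x \<rho> = {}"
          proof (rule ccontr)
            assume "Fw F v -` B x \<rho> \<noteq> {}"
            then obtain b where "R x (Fw F v b) < \<rho>" by (auto simp: res_ball_def)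
            then have "cells \<delta> (Fw F v b) \<subseteq> ?G" using c by (intro c(2) \<delta> True) (simp add: \<delta>_def)
            moreover have "v \<in> cells \<delta> (Fw F v b)" using v by (simp add: cells_def)
            ultimately show False using v by auto
          qed
          then show "?f v = 0" by simp
        qed
      qed (use \<delta> nbs_subset in auto)
      also have "\<dots> \<le> (\<Sum>v\<in>?G. ennreal (\<delta> powr d))"
      proof (rule sum_mono)
        fix v assume "v \<in> ?G"
        then have "rw r v \<le> \<delta>" using nbs_subset[of \<delta> "cells \<delta> x"] by (auto simp: Lam_def)
        then have "rw r v powr d \<le> \<delta> powr d" using d_pos rw_pos[of v] by (intro powr_mono2) auto
        moreover have "emeasure \<mu> (Fw F v -` B x \<rho>) \<le> 1" by (rule emeasure_le_1)
        ultimately have "?f v \<le> ennreal (\<delta> powr d) * 1" by (intro mult_mono ennreal_leI) auto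
        then show "?f v \<le> ennreal (\<delta> powr d)" by simp
      qed
      also have "\<dots> = ennreal (real (card ?G) * \<delta> powr d)" by (simp add: ennreal_mult ennreal_of_nat_eq_real_of_nat)
      also have "\<dots> \<le> ennreal (N * \<delta> powr d)"
      proof (intro ennreal_leI mult_right_mono)
        have "card ?G \<le> N0 * N1"
          using card_nbs[OF \<delta> cells_subset, of x] card_cells[of \<delta> x] by (meson le_trans mult_le_mono1)
        then show "real (card ?G) \<le> N" unfolding N_def by (rule of_nat_mono)
      qed simp
      finally have "measure \<mu> (B x \<rho>) \<le> N * \<delta> powr d"
        using N by (simp add: emeasure_eq_measure ennreal_le_iff)
      then show ?thesis using eq by simp
    qed
  qed
  with C show ?thesis by (rule that)
qed

lemma ball_pos: "0 < \<rho> \<Longrightarrow> 0 < measure \<mu> (B x \<rho>)"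
proof -
  assume \<rho>: "0 < \<rho>"
  obtain c where c: "0 < c" "\<And>x \<rho>. 0 < \<rho> \<Longrightarrow> \<rho> \<le> 1 \<Longrightarrow> c * \<rho> powr d \<le> measure \<mu> (B x \<rho>)"
    using ball_lower by metis
  have "0 < c * (min \<rho> 1) powr d" using c \<rho> by simp
  also have "\<dots> \<le> measure \<mu> (B x (min \<rho> 1))" using \<rho> by (intro c) auto
  also have "\<dots> \<le> measure \<mu> (B x \<rho>)" by (intro finite_measure_mono B_mono) auto
  finally show ?thesis .
qed

lemma ball_doubling: obtains C where "0 < C" "\<And>x \<rho>. 0 < \<rho> \<Longrightarrow> measure \<mu> (B x (3 * \<rho>)) \<le> C * measure \<mu> (B x \<rho>)"
proof -
  obtain c where c: "0 < c" "\<And>x \<rho>. 0 < \<rho> \<Longrightarrow> \<rho> \<le> 1 \<Longrightarrow> c * \<rho> powr d \<le> measure \<mu> (B x \<rho>)"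
    using ball_lower by metis
  obtain C where C: "0 < C" "\<And>x \<rho>. 0 < \<rho> \<Longrightarrow> measure \<mu> (B x \<rho>) \<le> C * \<rho> powr d"
    using ball_upper by metis
  have "measure \<mu> (B x (3 * \<rho>)) \<le> (C * 3 powr d / c + 1 / c) * measure \<mu> (B x \<rho>)" if \<rho>: "0 < \<rho>" for x \<rho>
  proof (cases "\<rho> \<le> 1")
    case True
    have "measure \<mu> (B x (3 * \<rho>)) \<le> C * (3 * \<rho>) powr d" using \<rho> by (intro C) auto
    also have "\<dots> = C * 3 powr d / c * (c * \<rho> powr d)" using \<rho> c by (simp add: powr_mult)
    also have "\<dots> \<le> C * 3 powr d / c * measure \<mu> (B x \<rho>)"
      using c(2)[OF \<rho> True] C c by (intro mult_left_mono) auto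
    also have "\<dots> \<le> (C * 3 powr d / c + 1 / c) * measure \<mu> (B x \<rho>)"
      using c by (intro mult_right_mono) auto
    finally show ?thesis .
  next
    case False
    have "c \<le> measure \<mu> (B x 1)" using c(2)[of 1 x] by simp
    also have "\<dots> \<le> measure \<mu> (B x \<rho>)" using False by (intro finite_measure_mono B_mono) auto
    finally have "1 \<le> 1 / c * measure \<mu> (B x \<rho>)" using c by (simp add: field_simps)
    also have "\<dots> \<le> (C * 3 powr d / c + 1 / c) * measure \<mu> (B x \<rho>)"
      using c C by (intro mult_right_mono) auto
    finally show ?thesis using prob_le_1[of "B x (3 * \<rho>)"] by linarith
  qed
  moreover have "0 < C * 3 powr d / c + 1 / c" using c C by (intro add_pos_pos) auto
  ultimately show ?thesis by (intro that) auto
qed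

lemma cont_integral_pos:
  fixes f :: "'a \<Rightarrow> real"
  assumes f: "continuous_on UNIV f" and nn: "\<And>x. 0 \<le> f x" and x: "0 < f x"
  shows "0 < (LINT x|\<mu>. f x)"
proof -
  have "open {y. f x / 2 < f y}" by (intro open_Collect_less continuous_intros f)
  then obtain e where e: "0 < e" "B x e \<subseteq> {y. f x / 2 < f y}"
    using x unfolding open_iff_R by (metis (mono_tags, lifting) field_sum_of_halves less_add_same_cancel1 half_gt_zero mem_Collect_eq)
  have "0 < f x / 2 * measure \<mu> (B x e)" using ball_pos[OF e(1)] x by simp
  also have "\<dots> = (LINT y|\<mu>. f x / 2 * indicator (B x e) y)" by simp
  also have "\<dots> \<le> (LINT y|\<mu>. f y)"
  proof (intro integral_mono cont_int[OF f])
    show "integrable \<mu> (\<lambda>y. f x / 2 * indicator (B x e) y)"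
      by (intro integrable_mult_right integrable_real_indicator) (simp_all add: emeasure_eq_measure)
    show "f x / 2 * indicator (B x e) y \<le> f y" for y
      using e(2) nn[of y] by (cases "y \<in> B x e") (auto simp: less_imp_le)
  qed
  finally show ?thesis .
qed

lemma cont_integral_sq_zero:
  fixes f :: "'a \<Rightarrow> real"
  assumes f: "continuous_on UNIV f" and z: "(LINT x|\<mu>. (f x)\<^sup>2) \<le> 0" shows "f x = 0"
proof (rule ccontr)
  assume "f x \<noteq> 0"
  then have "0 < (LINT x|\<mu>. (f x)\<^sup>2)"
    using f by (intro cont_integral_pos[of _ x]) (auto intro!: continuous_intros)
  with z show False by simp
qed

lemma cont_AE_zero:
  fixes f :: "'a \<Rightarrow> real"
  assumes f: "continuous_on UNIV f" and z: "AE x in \<mu>. f x = 0" shows "f x = 0"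
proof (rule cont_integral_sq_zero[OF f])
  have "(LINT x|\<mu>. (f x)\<^sup>2) = (LINT x|\<mu>. 0)"
    using z by (intro integral_cong_AE cont_meas continuous_intros f) auto
  then show "(LINT x|\<mu>. (f x)\<^sup>2) \<le> 0" by simp
qed

text \<open>The order of magnitude of the resolvent kernel at \<open>\<sigma>\<close> on the diagonal; for \<open>\<sigma> < 1\<close> the eigenvalue
  \<open>0\<close> of the Neumann Laplacian dominates.\<close>

definition kappa :: "real \<Rightarrow> real" where
  "kappa \<sigma> = (if 1 \<le> \<sigma> then \<sigma> powr (- 1 / (d + 1)) else 1 / \<sigma>)"

lemma kappa_pos: "0 < \<sigma> \<Longrightarrow> 0 < kappa \<sigma>"
  by (simp add: kappa_def)

text \<open>The value at \<open>y\<close> is compared with the values on a ball, where the energy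
  controls the difference, and the square is averaged over the ball.\<close>

lemma pointwise_ball_bound:
  assumes u: "u \<in> Dom" and \<rho>: "0 < \<rho>"
  shows "(u y)\<^sup>2 \<le> 2 * \<rho> * En u u + 2 / measure \<mu> (B y \<rho>) * (LINT x|\<mu>. (u x)\<^sup>2)"
proof -
  let ?m = "measure \<mu> (B y \<rho>)"
  note cu = Dom_cont[OF u]
  have i2: "integrable \<mu> (\<lambda>x. (u x)\<^sup>2)" using cu by (intro cont_int continuous_intros)
  have le: "(u y)\<^sup>2 * indicator (B y \<rho>) z \<le> 2 * \<rho> * En u u * indicator (B y \<rho>) z + 2 * (u z)\<^sup>2" for z
  proof (cases "z \<in> B y \<rho>")
    case True
    have "(u y)\<^sup>2 = ((u y - u z) + u z)\<^sup>2" by simp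
    also have "\<dots> \<le> 2 * (u y - u z)\<^sup>2 + 2 * (u z)\<^sup>2"
      using zero_le_power2[of "(u y - u z) - u z"] by (simp add: power2_eq_square algebra_simps)
    also have "(u y - u z)\<^sup>2 \<le> R y z * En u u" by (rule R_bound[OF u])
    also have "\<dots> \<le> \<rho> * En u u" using True En_nonneg[OF u] by (intro mult_right_mono) (auto simp: res_ball_def)
    finally show ?thesis using True by simp
  qed simp
  have "(u y)\<^sup>2 * ?m = (LINT z|\<mu>. (u y)\<^sup>2 * indicator (B y \<rho>) z)" by simp
  also have "\<dots> \<le> (LINT z|\<mu>. 2 * \<rho> * En u u * indicator (B y \<rho>) z + 2 * (u z)\<^sup>2)"
    by (intro integral_mono Bochner_Integration.integrable_add integrable_mult_right i2 le)
      (auto simp: emeasure_eq_measure)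
  also have "\<dots> = 2 * \<rho> * En u u * ?m + 2 * (LINT x|\<mu>. (u x)\<^sup>2)"
    by (subst Bochner_Integration.integral_add) (use i2 in \<open>auto simp: emeasure_eq_measure\<close>)
  finally show ?thesis using ball_pos[OF \<rho>, of y] by (simp add: field_simps)
qed

text \<open>The Sobolev embedding with its dependence on \<sigma>. In
  \<open>pointwise_ball_bound\<close> the radius is chosen to balance \<rho> against
  \<open>1 / (\<sigma> * \<rho> powr d)\<close>, which gives
  \<open>\<sigma> powr (- 1 / (d + 1))\<close>. For \<sigma> < 1 the radius is 1, up to which the
  lower estimate for balls is available.\<close>

lemma sup_bound:
  obtains C where "0 < C"
    "\<And>\<sigma> u y. 0 < \<sigma> \<Longrightarrow> u \<in> Dom \<Longrightarrow> (u y)\<^sup>2 \<le> C * kappa \<sigma> * (En u u + \<sigma> * (LINT x|\<mu>. (u x)\<^sup>2))"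
proof -
  obtain c where c: "0 < c" "\<And>x \<rho>. 0 < \<rho> \<Longrightarrow> \<rho> \<le> 1 \<Longrightarrow> c * \<rho> powr d \<le> measure \<mu> (B x \<rho>)"
    using ball_lower by metis
  define C where "C = 2 + 2 / c"
  have C: "0 < C" "2 \<le> C" "2 / c \<le> C" using c by (auto simp: C_def add_pos_pos)
  have "(u y)\<^sup>2 \<le> C * kappa \<sigma> * (En u u + \<sigma> * (LINT x|\<mu>. (u x)\<^sup>2))" if \<sigma>: "0 < \<sigma>" and u: "u \<in> Dom" for \<sigma> u y
  proof -
    let ?I = "LINT x|\<mu>. (u x)\<^sup>2"
    have I: "0 \<le> ?I" by simp
    define \<rho> where "\<rho> = (if 1 \<le> \<sigma> then kappa \<sigma> else 1)"
    have \<rho>: "0 < \<rho>" "\<rho> \<le> 1" "\<rho> \<le> kappa \<sigma>"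
    proof -
      have "\<sigma> powr (- 1 / (d + 1)) \<le> 1" if "1 \<le> \<sigma>"
        using powr_mono[of "- 1 / (d + 1)" 0 \<sigma>] that d_pos by simp
      then show "0 < \<rho>" "\<rho> \<le> 1" "\<rho> \<le> kappa \<sigma>" using \<sigma> by (simp_all add: \<rho>_def kappa_def)
    qed
    have q: "1 / \<rho> powr d \<le> kappa \<sigma> * \<sigma>"
    proof (cases "1 \<le> \<sigma>")
      case True
      have "1 / \<rho> powr d = \<rho> powr (- d)" by (simp only: powr_minus_divide)
      also have "\<dots> = \<sigma> powr (- 1 / (d + 1) * - d)"
        using True by (simp only: \<rho>_def kappa_def if_True powr_powr)
      also have "- 1 / (d + 1) * - d = - 1 / (d + 1) + 1" using d_pos by (simp add: field_simps)
      also have "\<sigma> powr (- 1 / (d + 1) + 1) = kappa \<sigma> * \<sigma>"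
        using True by (subst powr_add) (simp add: kappa_def)
      finally show ?thesis by simp
    next
      case False
      then show ?thesis using \<sigma> by (simp add: \<rho>_def kappa_def)
    qed
    have "2 / measure \<mu> (B y \<rho>) \<le> 2 / (c * \<rho> powr d)"
      using c(2)[OF \<rho>(1,2), of y] c(1) \<rho> ball_pos[OF \<rho>(1), of y] by (intro divide_left_mono mult_pos_pos) auto
    also have "\<dots> = 2 / c * (1 / \<rho> powr d)" by simp
    also have "\<dots> \<le> C * (kappa \<sigma> * \<sigma>)" using C c q kappa_pos[OF \<sigma>] \<sigma> by (intro mult_mono) auto
    finally have a: "2 / measure \<mu> (B y \<rho>) * ?I \<le> C * (kappa \<sigma> * \<sigma>) * ?I" using I by (rule mult_right_mono)
    have b: "2 * \<rho> * En u u \<le> C * kappa \<sigma> * En u u"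
      using C \<rho> kappa_pos[OF \<sigma>] En_nonneg[OF u] by (intro mult_right_mono mult_mono) auto
    show ?thesis using pointwise_ball_bound[OF u \<rho>(1), of y] a b by (simp add: algebra_simps)
  qed
  with C(1) show ?thesis by (rule that)
qed

section \<open>Covering lemma and weak type estimate\<close>

lemma finite_vitali:
  assumes "finite I" "\<And>i. i \<in> I \<Longrightarrow> 0 < \<rho> i"
  shows "\<exists>J\<subseteq>I. disjoint_family_on (\<lambda>i. B (c i) (\<rho> i)) J \<and> (\<forall>i\<in>I. \<exists>j\<in>J. B (c i) (\<rho> i) \<subseteq> B (c j) (3 * \<rho> j))"
  using assms
proof (induction "card I" arbitrary: I rule: less_induct)
  case less
  show ?case
  proof (cases "I = {}")
    case False
    \<comment> \<open>Greedy choice of a ball of maximal radius: every ball of the family that meets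
      it lies in its threefold enlargement.\<close>
    obtain m where m: "m \<in> I" "\<And>i. i \<in> I \<Longrightarrow> \<rho> i \<le> \<rho> m"
    proof -
      have "Max (\<rho> ` I) \<in> \<rho> ` I" using less.prems False by (intro Max_in) auto
      then obtain m where "m \<in> I" "\<rho> m = Max (\<rho> ` I)" by auto
      then show ?thesis using less.prems by (intro that[of m]) auto
    qed
    define I' where "I' = {i \<in> I. B (c i) (\<rho> i) \<inter> B (c m) (\<rho> m) = {}}"
    have "c m \<in> B (c m) (\<rho> m)" using less.prems(2)[OF m(1)] by (simp add: res_ball_def)
    then have "m \<notin> I'" by (auto simp: I'_def)
    then have sub: "I' \<subset> I" using m by (auto simp: I'_def)
    then obtain J where J: "J \<subseteq> I'" "disjoint_family_on (\<lambda>i. B (c i) (\<rho> i)) J"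
      "\<forall>i\<in>I'. \<exists>j\<in>J. B (c i) (\<rho> i) \<subseteq> B (c j) (3 * \<rho> j)"
      using less.hyps[of I'] psubset_card_mono[OF less.prems(1) sub] less.prems finite_subset[of I' I] by blast
    show ?thesis
    proof (intro exI[of _ "insert m J"] conjI ballI)
      show "insert m J \<subseteq> I" using J sub m by auto
      show "disjoint_family_on (\<lambda>i. B (c i) (\<rho> i)) (insert m J)"
        using J(1,2) unfolding disjoint_family_on_def I'_def by blast
      fix i assume i: "i \<in> I"
      show "\<exists>j\<in>insert m J. B (c i) (\<rho> i) \<subseteq> B (c j) (3 * \<rho> j)"
      proof (cases "i \<in> I'")
        case True
        then show ?thesis using J(3) by blast
      next
        case False
        then obtain z where z: "R (c i) z < \<rho> i" "R (c m) z < \<rho> m"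
          using i by (auto simp: I'_def res_ball_def)
        have "R (c m) y < 3 * \<rho> m" if "R (c i) y < \<rho> i" for y
          using R_tri[of "c m" y z] R_tri[of z y "c i"] R_sym[of z "c i"] that z m(2)[OF i] by linarith
        then show ?thesis by (auto simp: res_ball_def)
      qed
    qed
  qed (simp add: disjoint_family_on_def)
qed

text \<open>An exhaustion of an open set by compact sets, through which estimates on compact subsets
  pass to the open set.\<close>

definition inner_part :: "'a set \<Rightarrow> nat \<Rightarrow> 'a set" where
  "inner_part A k = {x. \<forall>y. y \<notin> A \<longrightarrow> 1 / Suc k \<le> R x y}"

lemma compact_inner_part: "compact (inner_part A k)"
proof -
  have eq: "inner_part A k = (\<Inter>y\<in>- A. {x. 1 / Suc k \<le> R x y})" by (auto simp: inner_part_def)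
  have "continuous_on UNIV (\<lambda>x. R x y)" for y using cont_R_left[of y] by (simp add: R_sym)
  then have "closed (inner_part A k)"
    unfolding eq by (intro closed_INT ballI closed_Collect_le) auto
  then show ?thesis using compact_Int_closed[OF compact_K] by simp
qed

lemma inner_part_mono: "incseq (inner_part A)"
proof (rule incseq_SucI)
  fix k
  have "1 / real (Suc (Suc k)) \<le> 1 / real (Suc k)" by (intro divide_left_mono) auto
  then show "inner_part A k \<subseteq> inner_part A (Suc k)" by (force simp: inner_part_def)
qed

lemma inner_part_Union: assumes "open A" shows "(\<Union>k. inner_part A k) = A"
proof (intro set_eqI iffI)
  fix x assume "x \<in> (\<Union>k. inner_part A k)"
  then obtain k where k: "x \<in> inner_part A k" by auto
  show "x \<in> A"
  proof (rule ccontr)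
    assume "x \<notin> A"
    moreover have "\<forall>y. y \<notin> A \<longrightarrow> 1 / real (Suc k) \<le> R x y" using k by (simp add: inner_part_def)
    ultimately have "1 / real (Suc k) \<le> R x x" by blast
    moreover have "R x x = 0" by simp
    moreover have "0 < 1 / real (Suc k)" by simp
    ultimately show False by linarith
  qed
next
  fix x assume "x \<in> A"
  then obtain e where e: "e > 0" "B x e \<subseteq> A" using assms by (auto simp: open_iff_R)
  obtain k where "1 / Suc k < e" using e(1) nat_approx_posE by blast
  then have "x \<in> inner_part A k" using e(2) by (auto simp: inner_part_def res_ball_def) force
  then show "x \<in> (\<Union>k. inner_part A k)" by auto
qed

lemma inner_part_lim:
  assumes "open A" shows "(\<lambda>k. measure \<mu> (inner_part A k)) \<longlonglongrightarrow> measure \<mu> A"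
proof -
  have "(\<lambda>k. measure \<mu> (inner_part A k)) \<longlonglongrightarrow> measure \<mu> (\<Union>k. inner_part A k)"
    by (intro finite_Lim_measure_incseq inner_part_mono)
      (auto intro!: borel_closed compact_imp_closed compact_inner_part)
  then show ?thesis by (simp add: inner_part_Union[OF assms])
qed

text \<open>The superlevel set is enclosed in the union of all balls with average above
  \<open>l\<close>. This union is open, so measurability of the maximal function is not an issue;
  its compact subsets are handled by \<open>finite_vitali\<close> and doubling, and
  \<open>inner_part\<close> exhausts it.\<close>

lemma weak_type:
  obtains C where "0 < C"
    "\<And>f l. integrable \<mu> f \<Longrightarrow> 0 < l \<Longrightarrow> \<exists>A. open A \<and> measure \<mu> A \<le> C / l * (LINT x|\<mu>. \<bar>f x\<bar>) \<and>
        (\<forall>x. x \<notin> A \<longrightarrow> maximal_function F r D \<mu> f x \<le> ennreal l)"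
proof -
  obtain C where C: "0 < C" "\<And>x \<rho>. 0 < \<rho> \<Longrightarrow> measure \<mu> (B x (3 * \<rho>)) \<le> C * measure \<mu> (B x \<rho>)"
    using ball_doubling by metis
  have "\<exists>A. open A \<and> measure \<mu> A \<le> C / l * (LINT x|\<mu>. \<bar>f x\<bar>) \<and>
        (\<forall>x. x \<notin> A \<longrightarrow> maximal_function F r D \<mu> f x \<le> ennreal l)"
    if f: "integrable \<mu> f" and l: "0 < l" for f l
  proof -
    let ?I = "\<lambda>A. LINT y|\<mu>. indicator A y * \<bar>f y\<bar>"
    have intI: "integrable \<mu> (\<lambda>y. indicator A y * \<bar>f y\<bar>)" if "A \<in> sets borel" for A
      using integrable_real_mult_indicator[of A \<mu> "\<lambda>y. \<bar>f y\<bar>"] that f by (simp add: mult.commute)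
    define P where "P x e \<longleftrightarrow> 0 < e \<and> l * measure \<mu> (B x e) < ?I (B x e)" for x e
    define A where "A = (\<Union>(x, e)\<in>{(x, e). P x e}. B x e)"
    have oA: "open A" unfolding A_def using open_res_ball by (intro open_UN) auto
    have big: "maximal_function F r D \<mu> f x \<le> ennreal l" if x: "x \<notin> A" for x
      unfolding maximal_function_def
    proof (rule SUP_least)
      fix e :: real assume "e \<in> {0<..}"
      then have e: "0 < e" by simp
      have "x \<in> B x e" using e by (simp add: res_ball_def)
      then have "\<not> P x e" using x by (auto simp: A_def)
      then have le: "?I (B x e) \<le> l * measure \<mu> (B x e)" using e by (auto simp: P_def)
      have "(\<integral>\<^sup>+y\<in>B x e. ennreal \<bar>f y\<bar> \<partial>\<mu>) = (\<integral>\<^sup>+y. ennreal (indicator (B x e) y * \<bar>f y\<bar>) \<partial>\<mu>)"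
        by (intro nn_integral_cong) (auto simp: indicator_def)
      also have "\<dots> = ennreal (?I (B x e))" by (rule nn_integral_eq_integral[OF intI]) auto
      also have "\<dots> \<le> ennreal (l * measure \<mu> (B x e))" by (rule ennreal_leI[OF le])
      also have "\<dots> = ennreal l * emeasure \<mu> (B x e)" using l by (simp add: emeasure_eq_measure ennreal_mult)
      finally have "(\<integral>\<^sup>+y\<in>B x e. ennreal \<bar>f y\<bar> \<partial>\<mu>) / emeasure \<mu> (B x e)
           \<le> ennreal l * emeasure \<mu> (B x e) / emeasure \<mu> (B x e)" by (rule divide_right_mono_ennreal)
      also have "\<dots> = ennreal l"
        using ball_pos[OF e, of x] l
        by (simp add: emeasure_eq_measure divide_ennreal flip: ennreal_mult)
      finally show "(\<integral>\<^sup>+y\<in>B x e. ennreal \<bar>f y\<bar> \<partial>\<mu>) / emeasure \<mu> (B x e) \<le> ennreal l" .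
    qed
    have cpt: "measure \<mu> K \<le> C / l * (LINT x|\<mu>. \<bar>f x\<bar>)" if K: "compact K" "K \<subseteq> A" for K
    proof -
      have "K \<subseteq> (\<Union>p\<in>{p. P (fst p) (snd p)}. B (fst p) (snd p))" using K(2) by (force simp: A_def)
      then obtain I where I: "I \<subseteq> {p. P (fst p) (snd p)}" "finite I" "K \<subseteq> (\<Union>p\<in>I. B (fst p) (snd p))"
        using compactE_image[OF K(1), of "{p. P (fst p) (snd p)}" "\<lambda>p. B (fst p) (snd p)"] open_res_ball by metis
      have pos: "p \<in> I \<Longrightarrow> 0 < snd p" for p using I(1) by (auto simp: P_def)
      obtain J where J: "J \<subseteq> I" "disjoint_family_on (\<lambda>p. B (fst p) (snd p)) J"
        "\<forall>i\<in>I. \<exists>j\<in>J. B (fst i) (snd i) \<subseteq> B (fst j) (3 * snd j)"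
        using finite_vitali[OF I(2), of snd fst] pos by blast
      have fJ: "finite J" using J(1) I(2) finite_subset by blast
      have m: "(\<Union>j\<in>J. B (fst j) (3 * snd j)) \<in> sets \<mu>"
        unfolding sets_mu by (intro borel_open open_UN ballI open_res_ball)
      have "measure \<mu> K \<le> measure \<mu> (\<Union>j\<in>J. B (fst j) (3 * snd j))"
        using I(3) J(3) fJ by (intro finite_measure_mono m) blast
      also have "\<dots> \<le> (\<Sum>j\<in>J. measure \<mu> (B (fst j) (3 * snd j)))"
        by (rule finite_measure_subadditive_finite[OF fJ]) auto
      also have "\<dots> \<le> (\<Sum>j\<in>J. C / l * ?I (B (fst j) (snd j)))"
      proof (rule sum_mono)
        fix j assume "j \<in> J"
        then have Pj: "P (fst j) (snd j)" using J(1) I(1) by auto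
        then have "measure \<mu> (B (fst j) (3 * snd j)) \<le> C * measure \<mu> (B (fst j) (snd j))" by (intro C) (auto simp: P_def)
        also have "\<dots> \<le> C * (?I (B (fst j) (snd j)) / l)"
          using Pj C(1) l by (intro mult_left_mono) (auto simp: P_def field_simps)
        finally show "measure \<mu> (B (fst j) (3 * snd j)) \<le> C / l * ?I (B (fst j) (snd j))" by simp
      qed
      also have "\<dots> = C / l * (LINT y|\<mu>. (\<Sum>j\<in>J. indicator (B (fst j) (snd j)) y) * \<bar>f y\<bar>)"
        unfolding sum_distrib_right sum_distrib_left[symmetric]
        by (subst Bochner_Integration.integral_sum) (auto intro!: intI)
      also have "\<dots> \<le> C / l * (LINT y|\<mu>. \<bar>f y\<bar>)"
      proof (intro mult_left_mono integral_mono)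
        show "integrable \<mu> (\<lambda>y. (\<Sum>j\<in>J. indicator (B (fst j) (snd j)) y) * \<bar>f y\<bar>)"
          unfolding sum_distrib_right by (intro Bochner_Integration.integrable_sum intI) simp
        show "integrable \<mu> (\<lambda>y. \<bar>f y\<bar>)" using f by simp
        fix y
        have "(\<Sum>j\<in>J. indicator (B (fst j) (snd j)) y :: real) = indicator (\<Union>j\<in>J. B (fst j) (snd j)) y"
          by (rule indicator_UN_disjoint[OF fJ J(2), symmetric])
        then show "(\<Sum>j\<in>J. indicator (B (fst j) (snd j)) y) * \<bar>f y\<bar> \<le> \<bar>f y\<bar>"
          by (simp add: indicator_def)
      qed (use C l in auto)
      finally show ?thesis .
    qed
    have "measure \<mu> A \<le> C / l * (LINT x|\<mu>. \<bar>f x\<bar>)"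
    proof (rule LIMSEQ_le_const2[OF inner_part_lim[OF oA]], intro exI allI impI)
      fix k
      have "inner_part A k \<subseteq> A" using inner_part_Union[OF oA] by blast
      then show "measure \<mu> (inner_part A k) \<le> C / l * (LINT x|\<mu>. \<bar>f x\<bar>)"
        by (rule cpt[OF compact_inner_part])
    qed
    then show ?thesis using oA big by blast
  qed
  with C(1) show ?thesis by (rule that)
qed

end

section \<open>Density of the form domain\<close>

context pcf_measure
begin

definition approx :: "('a \<Rightarrow> real) \<Rightarrow> bool" where
  "approx f \<longleftrightarrow> (\<forall>\<epsilon>>0. \<exists>v\<in>Dom. (LINT x|\<mu>. \<bar>f x - v x\<bar>) < \<epsilon>)"

lemma Dom_int: "v \<in> Dom \<Longrightarrow> integrable \<mu> v"
  by (intro cont_int Dom_cont)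

lemma approx_Dom: "v \<in> Dom \<Longrightarrow> approx v"
  unfolding approx_def by (intro allI impI bexI[of _ v]) auto

lemma approx_closed:
  assumes f: "integrable \<mu> f"
    and g: "\<And>\<epsilon>. 0 < \<epsilon> \<Longrightarrow> \<exists>g. integrable \<mu> g \<and> approx g \<and> (LINT x|\<mu>. \<bar>f x - g x\<bar>) < \<epsilon>"
  shows "approx f"
  unfolding approx_def
proof (intro allI impI)
  fix \<epsilon> :: real assume \<epsilon>: "0 < \<epsilon>"
  obtain g where g: "integrable \<mu> g" "approx g" "(LINT x|\<mu>. \<bar>f x - g x\<bar>) < \<epsilon> / 2" using g[of "\<epsilon> / 2"] \<epsilon> by auto
  obtain v where v: "v \<in> Dom" "(LINT x|\<mu>. \<bar>g x - v x\<bar>) < \<epsilon> / 2" using g(2) \<epsilon> unfolding approx_def by (meson half_gt_zero)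
  have "(LINT x|\<mu>. \<bar>f x - v x\<bar>) \<le> (LINT x|\<mu>. \<bar>f x - g x\<bar> + \<bar>g x - v x\<bar>)"
    using f g(1) Dom_int[OF v(1)] by (intro integral_mono) auto
  also have "\<dots> = (LINT x|\<mu>. \<bar>f x - g x\<bar>) + (LINT x|\<mu>. \<bar>g x - v x\<bar>)"
    using f g(1) Dom_int[OF v(1)] by (intro Bochner_Integration.integral_add) auto
  finally show "\<exists>v\<in>Dom. (LINT x|\<mu>. \<bar>f x - v x\<bar>) < \<epsilon>" using g(3) v by (intro bexI[of _ v]) auto
qed

lemma approx_add:
  assumes "integrable \<mu> f" "approx f" "integrable \<mu> g" "approx g" shows "approx (\<lambda>x. f x + g x)"
  unfolding approx_def
proof (intro allI impI)
  fix \<epsilon> :: real assume \<epsilon>: "0 < \<epsilon>"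
  obtain u v where u: "u \<in> Dom" "(LINT x|\<mu>. \<bar>f x - u x\<bar>) < \<epsilon> / 2" and v: "v \<in> Dom" "(LINT x|\<mu>. \<bar>g x - v x\<bar>) < \<epsilon> / 2"
    using assms(2,4) \<epsilon> unfolding approx_def by (meson half_gt_zero)
  have "(LINT x|\<mu>. \<bar>f x + g x - (u x + v x)\<bar>) \<le> (LINT x|\<mu>. \<bar>f x - u x\<bar> + \<bar>g x - v x\<bar>)"
    using assms Dom_int[OF v(1)] Dom_int[OF u(1)] by (intro integral_mono) auto
  also have "\<dots> = (LINT x|\<mu>. \<bar>f x - u x\<bar>) + (LINT x|\<mu>. \<bar>g x - v x\<bar>)"
    using assms Dom_int[OF v(1)] Dom_int[OF u(1)] by (intro Bochner_Integration.integral_add) auto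
  finally show "\<exists>v\<in>Dom. (LINT x|\<mu>. \<bar>f x + g x - v x\<bar>) < \<epsilon>"
    using u v by (intro bexI[of _ "\<lambda>x. u x + v x"]) auto
qed

lemma approx_scale: assumes "approx f" shows "approx (\<lambda>x. c * f x)"
  unfolding approx_def
proof (intro allI impI)
  fix \<epsilon> :: real assume \<epsilon>: "0 < \<epsilon>"
  have "0 < \<epsilon> / (\<bar>c\<bar> + 1)" using \<epsilon> by (intro divide_pos_pos) auto
  then obtain u where u: "u \<in> Dom" "(LINT x|\<mu>. \<bar>f x - u x\<bar>) < \<epsilon> / (\<bar>c\<bar> + 1)"
    using assms unfolding approx_def by blast
  have "(LINT x|\<mu>. \<bar>c * f x - c * u x\<bar>) = \<bar>c\<bar> * (LINT x|\<mu>. \<bar>f x - u x\<bar>)"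
    by (simp add: abs_mult flip: right_diff_distrib)
  also have "\<dots> \<le> (\<bar>c\<bar> + 1) * (LINT x|\<mu>. \<bar>f x - u x\<bar>)" by (intro mult_right_mono) auto
  also have "\<dots> < (\<bar>c\<bar> + 1) * (\<epsilon> / (\<bar>c\<bar> + 1))" using u(2) by (intro mult_strict_left_mono) auto
  also have "\<dots> = \<epsilon>" by simp
  finally show "\<exists>v\<in>Dom. (LINT x|\<mu>. \<bar>c * f x - v x\<bar>) < \<epsilon>"
    using u by (intro bexI[of _ "\<lambda>x. c * u x"]) auto
qed

lemma ind_int [simp]: "A \<in> sets borel \<Longrightarrow> integrable \<mu> (indicator A :: 'a \<Rightarrow> real)"
  by (intro integrable_real_indicator) (simp_all add: emeasure_eq_measure)

lemma integral_ind_diff: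
  assumes "A \<subseteq> A'" "A \<in> sets borel" "A' \<in> sets borel"
  shows "(LINT x|\<mu>. \<bar>indicator A' x - indicator A x\<bar>) = measure \<mu> A' - measure \<mu> A"
proof -
  have "(LINT x|\<mu>. \<bar>indicator A' x - indicator A x :: real\<bar>) = (LINT x|\<mu>. indicator A' x - indicator A x)"
    using assms(1) by (intro Bochner_Integration.integral_cong refl) (auto simp: indicator_def)
  also have "\<dots> = measure \<mu> A' - measure \<mu> A"
    using assms by (subst Bochner_Integration.integral_diff) auto
  finally show ?thesis .
qed

text \<open>A bounded cutoff that is 1 on a compact inner part and 0 off \<open>A\<close> differs
  from the indicator only on the remainder, whose measure tends to 0.\<close>

lemma approx_open: assumes A: "open A" shows "approx (indicator A)"
  unfolding approx_def
proof (intro allI impI)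
  fix \<epsilon> :: real assume \<epsilon>: "0 < \<epsilon>"
  obtain C where C: "0 < C"
    "\<And>X \<delta>. 0 < \<delta> \<Longrightarrow> \<exists>\<psi>\<in>Dom. (\<forall>x\<in>X. \<psi> x = 1) \<and> (\<forall>y. (\<forall>x\<in>X. \<delta> < R x y) \<longrightarrow> \<psi> y = 0) \<and>
       (\<forall>x. \<bar>\<psi> x\<bar> \<le> C)"
    by (rule set_cutoff) (rule that)
  have "((\<lambda>k. measure \<mu> A - measure \<mu> (inner_part A k)) \<longlonglongrightarrow> measure \<mu> A - measure \<mu> A)"
    by (intro tendsto_intros inner_part_lim A)
  then have "\<forall>\<^sub>F k in sequentially. measure \<mu> A - measure \<mu> (inner_part A k) < \<epsilon> / (C + 1)"
    using \<epsilon> C(1) by (intro order_tendstoD) auto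
  then obtain k where k: "measure \<mu> A - measure \<mu> (inner_part A k) < \<epsilon> / (C + 1)"
    by (auto simp: eventually_sequentially)
  let ?P = "inner_part A k"
  have P: "?P \<subseteq> A" "?P \<in> sets borel"
    using inner_part_Union[OF A] compact_inner_part[of A k] by (blast, auto intro!: borel_closed compact_imp_closed)
  \<comment> \<open>One more than \<open>Suc k\<close>: points off \<open>A\<close> are at distance
    at least \<open>1 / Suc k\<close> from the inner part, and the cutoff needs a strict
    inequality.\<close>
  have "0 < 1 / (real (Suc k) + 1)" by simp
  from C(2)[OF this, of ?P] obtain \<psi> where \<psi>: "\<psi> \<in> Dom" "\<forall>x\<in>?P. \<psi> x = 1"
    "\<forall>y. (\<forall>x\<in>?P. 1 / (real (Suc k) + 1) < R x y) \<longrightarrow> \<psi> y = 0" "\<forall>x. \<bar>\<psi> x\<bar> \<le> C"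
    by (elim bexE conjE) (rule that)
  have zero: "\<psi> y = 0" if "y \<notin> A" for y
  proof -
    have "1 / (real (Suc k) + 1) < R x y" if "x \<in> ?P" for x
    proof -
      have "1 / (real (Suc k) + 1) < 1 / real (Suc k)" by (intro divide_strict_left_mono) auto
      also have "\<dots> \<le> R x y" using that \<open>y \<notin> A\<close> by (simp add: inner_part_def)
      finally show ?thesis .
    qed
    then show ?thesis using \<psi>(3) by blast
  qed
  have le: "\<bar>indicator A x - \<psi> x\<bar> \<le> (C + 1) * \<bar>indicator A x - indicator ?P x\<bar>" for x
  proof (cases "x \<in> A \<and> x \<notin> ?P")
    case True
    have "\<bar>1 - \<psi> x\<bar> \<le> 1 + \<bar>\<psi> x\<bar>" by linarith
    also have "\<dots> \<le> 1 + C" using \<psi>(4) by simp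
    finally show ?thesis using True by simp
  next
    case False
    then show ?thesis using \<psi>(2) zero[of x] P(1) C(1) by (auto simp: indicator_def)
  qed
  have "(LINT x|\<mu>. \<bar>indicator A x - \<psi> x\<bar>) \<le> (LINT x|\<mu>. (C + 1) * \<bar>indicator A x - indicator ?P x\<bar>)"
    using A P Dom_int[OF \<psi>(1)] by (intro integral_mono le) auto
  also have "\<dots> = (C + 1) * (measure \<mu> A - measure \<mu> ?P)"
    using A P by (simp add: integral_ind_diff)
  also have "\<dots> < (C + 1) * (\<epsilon> / (C + 1))" using k C(1) by (intro mult_strict_left_mono) auto
  also have "\<dots> = \<epsilon>" using C(1) by simp
  finally show "\<exists>v\<in>Dom. (LINT x|\<mu>. \<bar>indicator A x - v x\<bar>) < \<epsilon>" using \<psi>(1) by blast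
qed

lemma approx_indicator: assumes "A \<in> sets borel" shows "approx (indicator A)"
proof -
  have A: "A \<in> sigma_sets UNIV {S. open S}" using assms by (simp add: borel_def)
  have sb: "X \<in> sigma_sets UNIV {S. open S} \<Longrightarrow> X \<in> sets borel" for X :: "'a set" by (simp add: borel_def)
  show ?thesis
  proof (rule sigma_sets_induct_disjoint[OF _ _ A])
    show "Int_stable {S :: 'a set. open S}" by (auto simp: Int_stable_def)
    have "(indicator {} :: 'a \<Rightarrow> real) = (\<lambda>_. 0)" by (simp add: fun_eq_iff)
    then show "approx (indicator {})" using approx_Dom[of "\<lambda>_. 0"] by simp
  next
    fix X :: "'a set" assume X: "X \<in> sigma_sets UNIV {S. open S}" "approx (indicator X)"
    have "approx (\<lambda>x. 1 + (-1) * indicator X x)"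
      using sb[OF X(1)] by (intro approx_add approx_Dom approx_scale X(2)) auto
    moreover have "(\<lambda>x. 1 + (-1) * indicator X x :: real) = indicator (UNIV - X)"
      by (auto simp: indicator_def)
    ultimately show "approx (indicator (UNIV - X))" by simp
  next
    fix X :: "nat \<Rightarrow> 'a set"
    assume X: "disjoint_family X" "range X \<subseteq> sigma_sets UNIV {S. open S}" "\<And>i. approx (indicator (X i))"
    have m: "X i \<in> sets borel" for i using X(2) sb by auto
    define Y where "Y n = (\<Union>i<n. X i)" for n
    have mY: "Y n \<in> sets borel" for n using m by (auto simp: Y_def)
    have ap: "approx (indicator (Y n))" for n
    proof (induction n)
      case 0
      have "(indicator (Y 0) :: 'a \<Rightarrow> real) = (\<lambda>_. 0)" by (simp add: fun_eq_iff Y_def)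
      then show ?case using approx_Dom[of "\<lambda>_. 0"] by simp
    next
      case (Suc n)
      have "X i \<inter> X n = {}" if "i < n" for i using X(1) that by (auto simp: disjoint_family_on_def)
      then have "Y n \<inter> X n = {}" by (auto simp: Y_def)
      then have "(indicator (Y (Suc n)) :: 'a \<Rightarrow> real) = (\<lambda>x. indicator (Y n) x + indicator (X n) x)"
        by (auto simp: Y_def indicator_def lessThan_Suc fun_eq_iff)
      then show ?case using approx_add[OF _ Suc _ X(3)[of n]] mY m by simp
    qed
    have UY: "(\<Union>n. Y n) = (\<Union>i. X i)" by (force simp: Y_def)
    have "(\<lambda>n. measure \<mu> (Y n)) \<longlonglongrightarrow> measure \<mu> (\<Union>n. Y n)"
      by (intro finite_Lim_measure_incseq) (use mY in \<open>auto simp: incseq_def Y_def\<close>, force)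
    then have lim: "(\<lambda>n. measure \<mu> (\<Union>i. X i) - measure \<mu> (Y n)) \<longlonglongrightarrow> measure \<mu> (\<Union>i. X i) - measure \<mu> (\<Union>i. X i)"
      unfolding UY by (intro tendsto_intros)
    show "approx (indicator (\<Union>i. X i))"
    proof (rule approx_closed)
      fix \<epsilon> :: real assume "0 < \<epsilon>"
      then have "\<forall>\<^sub>F n in sequentially. measure \<mu> (\<Union>i. X i) - measure \<mu> (Y n) < \<epsilon>"
        using order_tendstoD(2)[OF lim, of \<epsilon>] by simp
      then obtain n where n: "measure \<mu> (\<Union>i. X i) - measure \<mu> (Y n) < \<epsilon>" by (auto simp: eventually_sequentially)
      have "(LINT x|\<mu>. \<bar>indicator (\<Union>i. X i) x - indicator (Y n) x\<bar>) = measure \<mu> (\<Union>i. X i) - measure \<mu> (Y n)"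
        using m mY by (intro integral_ind_diff) (auto simp: Y_def)
      then show "\<exists>g. integrable \<mu> g \<and> approx g \<and> (LINT x|\<mu>. \<bar>indicator (\<Union>i. X i) x - g x\<bar>) < \<epsilon>"
        using n ap[of n] mY[of n] by (intro exI[of _ "indicator (Y n)"]) simp
    qed (use m in auto)
  qed (auto simp: approx_open)
qed

lemma Dom_dense: "integrable \<mu> f \<Longrightarrow> approx f"
proof (induction f rule: integrable_induct)
  case (base A c)
  have "approx (\<lambda>x. c * indicator A x)" using base by (intro approx_scale approx_indicator) simp
  then show ?case by (simp add: mult.commute)
next
  case (add f g)
  then show ?case by (intro approx_add)
next
  case (lim f s)
  have c: "(\<lambda>i. s i x) \<longlonglongrightarrow> f x" and b: "norm (s i x) \<le> 2 * norm (f x)" for i x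
    using lim by simp_all
  have l: "(\<lambda>i. LINT x|\<mu>. \<bar>f x - s i x\<bar>) \<longlonglongrightarrow> (LINT x|\<mu>. 0)"
  proof (rule integral_dominated_convergence[where w = "\<lambda>x. 3 * \<bar>f x\<bar>"])
    show "AE x in \<mu>. (\<lambda>i. \<bar>f x - s i x\<bar>) \<longlonglongrightarrow> 0"
    proof (rule AE_I2)
      fix x assume "x \<in> space \<mu>"
      then have "(\<lambda>i. \<bar>f x - s i x\<bar>) \<longlonglongrightarrow> \<bar>f x - f x\<bar>" by (intro tendsto_intros c)
      then show "(\<lambda>i. \<bar>f x - s i x\<bar>) \<longlonglongrightarrow> 0" by simp
    qed
    show "AE x in \<mu>. norm \<bar>f x - s i x\<bar> \<le> 3 * \<bar>f x\<bar>" for i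
    proof (rule AE_I2)
      fix x assume "x \<in> space \<mu>"
      from b[of i x] show "norm \<bar>f x - s i x\<bar> \<le> 3 * \<bar>f x\<bar>" by simp
    qed
  qed (use lim in auto)
  show ?case
  proof (rule approx_closed)
    fix \<epsilon> :: real assume "0 < \<epsilon>"
    then have "\<forall>\<^sub>F i in sequentially. (LINT x|\<mu>. \<bar>f x - s i x\<bar>) < \<epsilon>" using order_tendstoD(2)[OF l] by simp
    then obtain i where "(LINT x|\<mu>. \<bar>f x - s i x\<bar>) < \<epsilon>" by (auto simp: eventually_sequentially)
    then show "\<exists>g. integrable \<mu> g \<and> approx g \<and> (LINT x|\<mu>. \<bar>f x - g x\<bar>) < \<epsilon>"
      using lim by (intro exI[of _ "s i"]) auto
  qed (use lim in simp)
qed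

text \<open>Small balls around the finite set \<open>Z\<close> have small measure, so an
  approximating form function can be multiplied by one minus a bounded cutoff near \<open>Z\<close>
  at small cost in L1.\<close>

lemma dense_vanishing:
  assumes Z: "finite Z" and f: "integrable \<mu> f" and \<epsilon>: "0 < \<epsilon>"
  shows "\<exists>v\<in>Dom. (\<forall>z\<in>Z. v z = 0) \<and> (LINT x|\<mu>. \<bar>f x - v x\<bar>) < \<epsilon>"
proof -
  obtain v where v: "v \<in> Dom" "(LINT x|\<mu>. \<bar>f x - v x\<bar>) < \<epsilon> / 2"
    using Dom_dense[OF f] \<epsilon> unfolding approx_def by (meson half_gt_zero)
  obtain b where b: "0 < b" "\<And>x. \<bar>v x\<bar> \<le> b" using cont_bounded[OF Dom_cont[OF v(1)]] by metis
  obtain C where C: "0 < C"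
    "\<And>X \<delta>. 0 < \<delta> \<Longrightarrow> \<exists>\<psi>\<in>Dom. (\<forall>x\<in>X. \<psi> x = 1) \<and> (\<forall>y. (\<forall>x\<in>X. \<delta> < R x y) \<longrightarrow> \<psi> y = 0) \<and>
       (\<forall>x. \<bar>\<psi> x\<bar> \<le> C)"
    by (rule set_cutoff) (rule that)
  obtain Cu where Cu: "0 < Cu" "\<And>x \<rho>. 0 < \<rho> \<Longrightarrow> measure \<mu> (B x \<rho>) \<le> Cu * \<rho> powr d"
    by (rule ball_upper) (rule that)
  define K where "K = b * C * (real (card Z) * Cu) + 1"
  have K: "0 < K" "b * C * (real (card Z) * Cu) \<le> K" using b C Cu by (auto simp: K_def add_nonneg_pos)
  \<comment> \<open>The radius for which \<open>K * \<rho> powr d\<close> is half of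
    \<epsilon>.\<close>
  define \<rho> where "\<rho> = (\<epsilon> / (2 * K)) powr (1 / d)"
  have \<rho>: "0 < \<rho>" "\<rho> powr d = \<epsilon> / (2 * K)" using \<epsilon> K d_pos by (auto simp: \<rho>_def powr_powr)
  have "0 < \<rho> / 2" using \<rho> by simp
  from C(2)[OF this, of Z] obtain \<psi> where \<psi>: "\<psi> \<in> Dom" "\<forall>x\<in>Z. \<psi> x = 1"
    "\<forall>y. (\<forall>x\<in>Z. \<rho> / 2 < R x y) \<longrightarrow> \<psi> y = 0" "\<forall>x. \<bar>\<psi> x\<bar> \<le> C"
    by (elim bexE conjE) (rule that)
  let ?v = "\<lambda>x. v x * (1 - \<psi> x)"
  have vD: "?v \<in> Dom" by (intro Dom_mult Dom_diff v \<psi> Dom_const)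
  let ?s = "\<lambda>x. \<Sum>z\<in>Z. indicator (B z \<rho>) x :: real"
  have le: "\<bar>v x - ?v x\<bar> \<le> b * C * ?s x" for x
  proof (cases "\<forall>z\<in>Z. \<rho> / 2 < R z x")
    case True
    then have "\<psi> x = 0" using \<psi>(3) by blast
    then show ?thesis using b C by (simp add: sum_nonneg)
  next
    case False
    then obtain z where z: "z \<in> Z" "x \<in> B z \<rho>" using \<rho>(1) by (force simp: res_ball_def)
    have "1 = (indicator (B z \<rho>) x :: real)" using z by simp
    also have "\<dots> \<le> ?s x" using Z z by (intro member_le_sum) auto
    finally have 1: "1 \<le> ?s x" .
    have "\<bar>v x - ?v x\<bar> = \<bar>v x\<bar> * \<bar>\<psi> x\<bar>" by (simp add: algebra_simps abs_mult)
    also have "\<dots> \<le> b * C" using b \<psi>(4) by (intro mult_mono) auto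
    also have "\<dots> \<le> b * C * ?s x" using 1 b C mult_left_mono[of 1 "?s x" "b * C"] by simp
    finally show ?thesis .
  qed
  have "(LINT x|\<mu>. \<bar>v x - ?v x\<bar>) \<le> (LINT x|\<mu>. b * C * ?s x)"
    using Dom_int[OF v(1)] Dom_int[OF vD]
    by (intro integral_mono le integrable_mult_right Bochner_Integration.integrable_sum) auto
  also have "\<dots> = b * C * (\<Sum>z\<in>Z. measure \<mu> (B z \<rho>))"
    by (simp add: Bochner_Integration.integral_sum)
  also have "\<dots> \<le> b * C * (\<Sum>z\<in>Z. Cu * \<rho> powr d)"
    using b C Cu \<rho> by (intro mult_left_mono sum_mono Cu) auto
  also have "\<dots> = b * C * (real (card Z) * Cu) * (\<epsilon> / (2 * K))" by (simp add: \<rho>(2))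
  also have "\<dots> \<le> K * (\<epsilon> / (2 * K))" using K \<epsilon> by (intro mult_right_mono) auto
  also have "\<dots> = \<epsilon> / 2" using K by simp
  finally have vv: "(LINT x|\<mu>. \<bar>v x - ?v x\<bar>) \<le> \<epsilon> / 2" .
  have "(LINT x|\<mu>. \<bar>f x - ?v x\<bar>) \<le> (LINT x|\<mu>. \<bar>f x - v x\<bar> + \<bar>v x - ?v x\<bar>)"
    using f Dom_int[OF v(1)] Dom_int[OF vD] by (intro integral_mono) auto
  also have "\<dots> = (LINT x|\<mu>. \<bar>f x - v x\<bar>) + (LINT x|\<mu>. \<bar>v x - ?v x\<bar>)"
    using f Dom_int[OF v(1)] Dom_int[OF vD] by (intro Bochner_Integration.integral_add) auto
  finally have "(LINT x|\<mu>. \<bar>f x - ?v x\<bar>) < \<epsilon>" using v(2) vv by simp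
  then show ?thesis using vD \<psi>(2) by (intro bexI[of _ ?v]) auto
qed

text \<open>Makes the Laplacian unique: two continuous functions with equal integrals against all
  form functions that vanish on \<open>Z\<close> coincide. The proof of the theorem uses this to
  read the Neumann condition.\<close>

lemma cont_orthogonal_zero:
  assumes Z: "finite Z" and h: "continuous_on UNIV h"
    and orth: "\<And>v. v \<in> Dom \<Longrightarrow> \<forall>z\<in>Z. v z = 0 \<Longrightarrow> (LINT x|\<mu>. h x * v x) = 0"
  shows "h x = 0"
proof (rule cont_integral_sq_zero[OF h])
  obtain b where b: "0 < b" "\<And>x. \<bar>h x\<bar> \<le> b" using cont_bounded[OF h] by metis
  have "(LINT x|\<mu>. (h x)\<^sup>2) \<le> b * \<epsilon>" if \<epsilon>: "0 < \<epsilon>" for \<epsilon>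
  proof -
    obtain v where v: "v \<in> Dom" "\<forall>z\<in>Z. v z = 0" "(LINT x|\<mu>. \<bar>h x - v x\<bar>) < \<epsilon>"
      using dense_vanishing[OF Z cont_int[OF h] \<epsilon>] by auto
    note cv = Dom_cont[OF v(1)]
    have "(LINT x|\<mu>. (h x)\<^sup>2) = (LINT x|\<mu>. (h x)\<^sup>2 - h x * v x)"
      using orth[OF v(1,2)] h cv
      by (subst Bochner_Integration.integral_diff) (auto intro!: cont_int continuous_intros)
    also have "\<dots> \<le> (LINT x|\<mu>. b * \<bar>h x - v x\<bar>)"
    proof (intro integral_mono cont_int continuous_intros h cv)
      fix x
      have "(h x)\<^sup>2 - h x * v x = h x * (h x - v x)" by (simp add: power2_eq_square algebra_simps)
      also have "\<dots> \<le> \<bar>h x\<bar> * \<bar>h x - v x\<bar>" by (metis abs_ge_self abs_mult)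
      also have "\<dots> \<le> b * \<bar>h x - v x\<bar>" using b by (intro mult_right_mono) auto
      finally show "(h x)\<^sup>2 - h x * v x \<le> b * \<bar>h x - v x\<bar>" .
    qed
    also have "\<dots> \<le> b * \<epsilon>" using v(3) b by simp
    finally show ?thesis .
  qed
  from this[of "e / b" for e] have "(LINT x|\<mu>. (h x)\<^sup>2) \<le> 0 + e" if "0 < e" for e
    using b that by simp
  then show "(LINT x|\<mu>. (h x)\<^sup>2) \<le> 0" by (rule field_le_epsilon)
qed

end

section \<open>Eigenfunction expansions and decay of resolvents\<close>

context pcf_measure
begin

lemma En_cauchy_schwarz:
  assumes u: "u \<in> Dom" and v: "v \<in> Dom" shows "(En u v)\<^sup>2 \<le> En u u * En v v"
proof -
  have q: "0 \<le> En u u + 2 * c * En u v + c\<^sup>2 * En v v" for c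
    unfolding En_quadratic[OF u v, symmetric] using u v by (intro En_nonneg) auto
  show ?thesis
  proof (cases "En v v = 0")
    case True
    have "En u v = 0"
    proof (rule ccontr)
      assume "En u v \<noteq> 0"
      then show False using q[of "- (En u u + 1) / (2 * En u v)"] True by (simp add: field_simps)
    qed
    then show ?thesis using True by simp
  next
    case False
    then have p: "0 < En v v" using En_nonneg[OF v] by simp
    have "En u u + 2 * (- En u v / En v v) * En u v + (- En u v / En v v)\<^sup>2 * En v v
        = En u u - (En u v)\<^sup>2 / En v v"
      using p by (simp add: power2_eq_square field_simps)
    then have "0 \<le> En u u - (En u v)\<^sup>2 / En v v" using q[of "- En u v / En v v"] by simp
    then show ?thesis using p by (simp add: field_simps)
  qed
qed

text \<open>\<open>E m\<close> involves finitely many points only, so pointwise convergence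
  suffices. Uniform bounds on all \<open>E m\<close> thus pass to pointwise limits, which gives
  lower semicontinuity of the energy.\<close>

lemma E_tendsto:
  assumes "\<And>x. (\<lambda>N. f N x) \<longlonglongrightarrow> u x" shows "(\<lambda>N. E m (f N) (f N)) \<longlonglongrightarrow> E m u u"
  unfolding E_edges by (intro tendsto_sum tendsto_mult tendsto_diff tendsto_const assms)

abbreviation ip :: "('a \<Rightarrow> real) \<Rightarrow> ('a \<Rightarrow> real) \<Rightarrow> real" where
  "ip u v \<equiv> LINT x|\<mu>. u x * v x"

lemma ip_int: "continuous_on UNIV u \<Longrightarrow> continuous_on UNIV v \<Longrightarrow> integrable \<mu> (\<lambda>x. u x * v x :: real)"
  by (intro cont_int continuous_intros)

lemma ip_sum_left:
  assumes "finite A" "\<And>i. i \<in> A \<Longrightarrow> continuous_on UNIV (u i)" "continuous_on UNIV v"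
  shows "ip (\<lambda>x. \<Sum>i\<in>A. c i * u i x) v = (\<Sum>i\<in>A. c i * ip (u i) v)"
  unfolding sum_distrib_right mult.assoc
  using assms by (subst Bochner_Integration.integral_sum) (auto intro!: integrable_mult_right ip_int)

lemma ip_diff_left:
  assumes "continuous_on UNIV u" "continuous_on UNIV u'" "continuous_on UNIV v"
  shows "ip (\<lambda>x. u x - u' x) v = ip u v - ip u' v"
  unfolding left_diff_distrib using assms by (intro Bochner_Integration.integral_diff ip_int)

end

text \<open>\<open>Z\<close> is \<open>V0 F\<close> for the Dirichlet and empty for the Neumann boundary condition.\<close>

locale pcf_eigen = pcf_measure F \<pi> r D d \<mu>
  for F :: "'i::finite \<Rightarrow> 'a::metric_space \<Rightarrow> 'a" and \<pi> r D d \<mu> +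
  fixes lam :: "nat \<Rightarrow> real" and \<phi> :: "nat \<Rightarrow> 'a \<Rightarrow> real" and Z :: "'a set"
  assumes finite_Z: "finite Z"
    and lam_nonneg: "0 \<le> lam n"
    and phi_Dom: "\<phi> n \<in> Dom"
    and phi_Z: "z \<in> Z \<Longrightarrow> \<phi> n z = 0"
    and eigen: "v \<in> Dom \<Longrightarrow> \<forall>z\<in>Z. v z = 0 \<Longrightarrow> En (\<phi> n) v = lam n * (LINT x|\<mu>. \<phi> n x * v x)"
    and complete: "complete_orthonormal_system \<mu> \<phi>"
begin

text \<open>The domain of the form that belongs to the boundary condition encoded by
  \<open>Z\<close>.\<close>

definition Fb :: "('a \<Rightarrow> real) set" where "Fb = {v \<in> Dom. \<forall>z\<in>Z. v z = 0}"

lemma Fb_Dom: "v \<in> Fb \<Longrightarrow> v \<in> Dom" by (simp add: Fb_def)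
lemma Fb_cont: "v \<in> Fb \<Longrightarrow> continuous_on UNIV v" by (intro Dom_cont Fb_Dom)
lemma phi_Fb: "\<phi> n \<in> Fb" by (simp add: Fb_def phi_Dom phi_Z)
lemma phi_cont: "continuous_on UNIV (\<phi> n)" by (intro Fb_cont phi_Fb)

lemma Fb_diff: "u \<in> Fb \<Longrightarrow> v \<in> Fb \<Longrightarrow> (\<lambda>x. u x - v x) \<in> Fb"
  by (auto simp: Fb_def)

lemma Fb_mult: "u \<in> Fb \<Longrightarrow> v \<in> Dom \<Longrightarrow> (\<lambda>x. u x * v x) \<in> Fb"
  by (auto simp: Fb_def)

lemma En_phi: "v \<in> Fb \<Longrightarrow> En (\<phi> n) v = lam n * ip (\<phi> n) v"
  by (auto simp: Fb_def intro: eigen)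

lemma orth: "ip (\<phi> m) (\<phi> n) = (if m = n then 1 else 0)"
  using complete by (simp add: complete_orthonormal_system_def)

lemma complete_cont:
  assumes f: "continuous_on UNIV f" and o: "\<And>n. ip (\<phi> n) f = 0" shows "f x = 0"
proof (rule cont_AE_zero[OF f])
  have "(\<lambda>x. \<bar>f x\<bar> powr 2) = (\<lambda>x. (f x)\<^sup>2)" by (auto simp: powr_numeral)
  moreover have "integrable \<mu> (\<lambda>x. (f x)\<^sup>2)" using f by (intro cont_int continuous_intros)
  ultimately have "in_Lp \<mu> 2 f" using f by (auto simp: in_Lp_def cont_meas)
  moreover have "(LINT x|\<mu>. f x * \<phi> n x) = 0" for n using o[of n] by (simp add: mult.commute)
  ultimately show "AE x in \<mu>. f x = 0" using complete by (simp add: complete_orthonormal_system_def)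
qed

section \<open>Finite eigenfunction sums and coefficient series\<close>

definition comb :: "nat set \<Rightarrow> (nat \<Rightarrow> real) \<Rightarrow> 'a \<Rightarrow> real" where
  "comb A c x = (\<Sum>n\<in>A. c n * \<phi> n x)"

lemma comb_Fb: "comb A c \<in> Fb"
proof -
  have "(\<lambda>x. \<Sum>n\<in>A. c n * \<phi> n x) \<in> Fb" using phi_Z by (auto simp: Fb_def intro!: Dom_sum Dom_scale phi_Dom)
  then show ?thesis by (simp add: comb_def[abs_def])
qed

lemma En_comb: assumes "finite A" "v \<in> Fb"
  shows "En (comb A c) v = (\<Sum>n\<in>A. lam n * c n * ip (\<phi> n) v)"
proof -
  have "En (comb A c) v = (\<Sum>n\<in>A. En (\<lambda>x. c n * \<phi> n x) v)"
    unfolding comb_def[abs_def] using assms by (intro En_sum_left) (auto intro: phi_Dom Fb_Dom)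
  also have "\<dots> = (\<Sum>n\<in>A. lam n * c n * ip (\<phi> n) v)"
    using assms by (intro sum.cong refl) (simp add: En_scale_left phi_Dom Fb_Dom En_phi)
  finally show ?thesis .
qed

lemma ip_comb: assumes "finite A" "continuous_on UNIV v"
  shows "ip (comb A c) v = (\<Sum>n\<in>A. c n * ip (\<phi> n) v)"
  unfolding comb_def[abs_def] using assms phi_cont by (intro ip_sum_left) auto

lemma ip_phi_comb: assumes "finite A" "n \<in> A" shows "ip (\<phi> n) (comb A c) = c n"
proof -
  have "ip (\<phi> n) (comb A c) = ip (comb A c) (\<phi> n)" by (simp add: mult.commute)
  also have "\<dots> = (\<Sum>k\<in>A. if k = n then c k else 0)"
    unfolding ip_comb[OF assms(1) phi_cont] by (intro sum.cong refl) (simp add: orth)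
  finally show ?thesis using assms by simp
qed

lemma En_comb_self: "finite A \<Longrightarrow> En (comb A c) (comb A c) = (\<Sum>n\<in>A. lam n * (c n)\<^sup>2)"
  unfolding En_comb[OF _ comb_Fb] by (intro sum.cong refl) (simp add: ip_phi_comb power2_eq_square)

lemma ip_comb_self: "finite A \<Longrightarrow> ip (comb A c) (comb A c) = (\<Sum>n\<in>A. (c n)\<^sup>2)"
  unfolding ip_comb[OF _ Fb_cont[OF comb_Fb]] by (intro sum.cong refl) (simp add: ip_phi_comb power2_eq_square)

definition coef :: "('a \<Rightarrow> real) \<Rightarrow> nat \<Rightarrow> real" where "coef f n = ip (\<phi> n) f"

lemma bessel:
  assumes f: "f \<in> Fb" shows "(\<Sum>n<N. (1 + lam n) * (coef f n)\<^sup>2) \<le> En f f + ip f f"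
proof -
  let ?S = "comb {..<N} (coef f)"
  have Sf: "En ?S f = (\<Sum>n<N. lam n * (coef f n)\<^sup>2)" "ip ?S f = (\<Sum>n<N. (coef f n)\<^sup>2)"
    using f by (simp_all add: En_comb ip_comb Fb_cont coef_def power2_eq_square mult.assoc)
  have "0 \<le> En (\<lambda>x. f x - ?S x) (\<lambda>x. f x - ?S x)" by (intro En_nonneg Fb_Dom Fb_diff f comb_Fb)
  also have "\<dots> = En f f - (\<Sum>n<N. lam n * (coef f n)\<^sup>2)"
    using Sf by (simp add: En_diff_left En_diff_right Dom_diff Fb_Dom f comb_Fb En_sym[of f ?S] En_comb_self)
  finally have 1: "(\<Sum>n<N. lam n * (coef f n)\<^sup>2) \<le> En f f" by simp
  have c: "continuous_on UNIV f" "continuous_on UNIV ?S" using Fb_cont f comb_Fb by auto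
  have cd: "continuous_on UNIV (\<lambda>x. f x - ?S x)" using c by (intro continuous_intros)
  have "0 \<le> ip (\<lambda>x. f x - ?S x) (\<lambda>x. f x - ?S x)" by simp
  also have "\<dots> = ip f (\<lambda>x. f x - ?S x) - ip ?S (\<lambda>x. f x - ?S x)" by (rule ip_diff_left[OF c cd])
  also have "ip f (\<lambda>x. f x - ?S x) = ip f f - ip ?S f"
    using ip_diff_left[OF c c(1)] by (simp add: mult.commute)
  also have "ip ?S (\<lambda>x. f x - ?S x) = ip f ?S - ip ?S ?S"
    using ip_diff_left[OF c c(2)] by (simp add: mult.commute)
  also have "ip f ?S = ip ?S f" by (simp add: mult.commute)
  finally have 2: "(\<Sum>n<N. (coef f n)\<^sup>2) \<le> ip f f" using Sf by (simp add: ip_comb_self)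
  show ?thesis using 1 2 by (simp add: distrib_right sum.distrib)
qed

lemma coef_summable: assumes "f \<in> Fb" shows "summable (\<lambda>n. (1 + lam n) * (coef f n)\<^sup>2)"
proof (rule summableI_nonneg_bounded)
  show "(\<Sum>i<n. (1 + lam i) * (coef f i)\<^sup>2) \<le> En f f + ip f f" for n by (rule bessel[OF assms])
qed (simp add: lam_nonneg)

text \<open>Closedness of the form in terms of coefficients. By \<open>sup_bound\<close> at \<sigma>
  = 1 the summability yields uniform convergence of the partial sums, and the bounds for each
  \<open>E m\<close> survive the pointwise limit.\<close>

lemma series_limit:
  assumes c: "summable (\<lambda>n. (1 + lam n) * (c n)\<^sup>2)"
  obtains u where "u \<in> Fb" "uniform_limit UNIV (\<lambda>N. comb {..<N} c) u sequentially"
    "\<And>v. v \<in> Fb \<Longrightarrow> (\<lambda>n. lam n * c n * ip (\<phi> n) v) sums En u v"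
    "\<And>v. v \<in> Fb \<Longrightarrow> (\<lambda>n. c n * ip (\<phi> n) v) sums ip u v"
proof -
  obtain C where C: "0 < C"
    "\<And>\<sigma> u y. 0 < \<sigma> \<Longrightarrow> u \<in> Dom \<Longrightarrow> (u y)\<^sup>2 \<le> C * kappa \<sigma> * (En u u + \<sigma> * (LINT x|\<mu>. (u x)\<^sup>2))"
    by (rule sup_bound) (rule that)
  let ?S = "\<lambda>N. comb {..<N} c"
  let ?a = "\<lambda>n. (1 + lam n) * (c n)\<^sup>2"
  have a0: "0 \<le> ?a n" for n using lam_nonneg[of n] by simp
  have diff: "?S m x - ?S n x = comb {n..<m} c x" if "n \<le> m" for m n x
    unfolding comb_def using that by (simp add: sum_diff_nat_ivl lessThan_atLeast0)
  have bnd: "(comb A c y)\<^sup>2 \<le> C * sum ?a A" if "finite A" for A y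
  proof -
    have "(comb A c y)\<^sup>2 \<le> C * kappa 1 * (En (comb A c) (comb A c) + 1 * (LINT x|\<mu>. (comb A c x)\<^sup>2))"
      by (intro C Fb_Dom comb_Fb) simp
    also have "(LINT x|\<mu>. (comb A c x)\<^sup>2) = (\<Sum>n\<in>A. (c n)\<^sup>2)"
      using ip_comb_self[OF that, of c] by (simp add: power2_eq_square)
    finally show ?thesis by (simp add: En_comb_self[OF that] kappa_def distrib_right sum.distrib add.commute)
  qed
  have tail: "\<exists>N. \<forall>m\<ge>N. \<forall>n. sum ?a {m..<n} < e" if e: "0 < e" for e
  proof -
    obtain N where N: "\<forall>m\<ge>N. \<forall>n. norm (sum ?a {m..<n}) < e"
      using c e unfolding summable_Cauchy by blast
    have "sum ?a {m..<n} < e" if "m \<ge> N" for m n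
      using N that abs_ge_self[of "sum ?a {m..<n}"] unfolding real_norm_def by (meson le_less_trans)
    then show ?thesis by blast
  qed
  have "uniformly_Cauchy_on UNIV ?S"
    unfolding uniformly_Cauchy_on_def
  proof (intro allI impI)
    fix e :: real assume e: "0 < e"
    then have "0 < e\<^sup>2 / C" using C by simp
    then obtain N where N: "\<forall>m\<ge>N. \<forall>n. sum ?a {m..<n} < e\<^sup>2 / C" using tail by blast
    have le: "\<bar>?S m x - ?S n x\<bar> < e" if "N \<le> n" "n \<le> m" for m n x
    proof -
      have "(?S m x - ?S n x)\<^sup>2 \<le> C * sum ?a {n..<m}" unfolding diff[OF that(2)] by (rule bnd) simp
      also have "\<dots> < C * (e\<^sup>2 / C)" using N that(1) C by (intro mult_strict_left_mono) auto
      also have "\<dots> = e\<^sup>2" using C by simp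
      finally have "\<bar>?S m x - ?S n x\<bar>\<^sup>2 < e\<^sup>2" by (simp only: power2_abs)
      then show ?thesis by (rule power2_less_imp_less[OF _ less_imp_le[OF e]])
    qed
    have "dist (?S m x) (?S n x) < e" if "N \<le> n" "N \<le> m" for m n x
    proof (cases "n \<le> m")
      case True
      then show ?thesis using le[OF that(1) True] by (simp add: dist_real_def)
    next
      case False
      then show ?thesis using le[of m n x] that by (simp add: dist_real_def abs_minus_commute)
    qed
    then show "\<exists>M. \<forall>x\<in>UNIV. \<forall>m\<ge>M. \<forall>n\<ge>M. dist (?S m x) (?S n x) < e" by blast
  qed
  then have "uniformly_convergent_on UNIV ?S" by (rule Cauchy_uniformly_convergent)
  then obtain u where u: "uniform_limit UNIV ?S u sequentially" by (auto simp: uniformly_convergent_on_def)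
  have pw: "(\<lambda>N. ?S N x) \<longlonglongrightarrow> u x" for x using tendsto_uniform_limitI[OF u] by simp
  have uc: "continuous_on UNIV u"
    by (rule uniform_limit_theorem[OF _ u]) (auto intro!: always_eventually Fb_cont comb_Fb)
  have Ebd: "E m (?S N) (?S N) \<le> suminf ?a" for m N
  proof -
    have "E m (?S N) (?S N) \<le> En (?S N) (?S N)" by (intro E_le_En Fb_Dom comb_Fb)
    also have "\<dots> = (\<Sum>n<N. lam n * (c n)\<^sup>2)" by (simp add: En_comb_self)
    also have "\<dots> \<le> (\<Sum>n<N. ?a n)" by (intro sum_mono) (simp add: distrib_right)
    also have "\<dots> \<le> suminf ?a" by (rule sum_le_suminf[OF c]) (auto simp: a0)
    finally show ?thesis .
  qed
  have "E m u u \<le> suminf ?a" for m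
    by (rule LIMSEQ_le_const2[OF E_tendsto[OF pw]]) (use Ebd in auto)
  then have uD: "u \<in> Dom" using uc by (auto simp: in_Dom_iff)
  have "u z = 0" if "z \<in> Z" for z
  proof -
    have "?S N z = 0" for N using comb_Fb[of "{..<N}" c] that by (simp add: Fb_def)
    then show ?thesis using pw[of z] by (simp add: LIMSEQ_const_iff)
  qed
  then have uF: "u \<in> Fb" using uD by (simp add: Fb_def)
  let ?g = "\<lambda>N x. u x - ?S N x"
  have gF: "?g N \<in> Fb" for N by (intro Fb_diff uF comb_Fb)
  \<comment> \<open>For fixed \<open>m\<close> the bound for the tails passes to the limit in the
    upper index \<open>M\<close>; only then does \<open>m\<close> tend to infinity.\<close>
  have G: "(\<lambda>N. En (?g N) (?g N)) \<longlonglongrightarrow> 0"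
  proof (rule LIMSEQ_I)
    fix e :: real assume e: "0 < e"
    obtain N0 where N0: "\<forall>m\<ge>N0. \<forall>n. sum ?a {m..<n} < e / 2" using tail[of "e / 2"] e by auto
    have "norm (En (?g N) (?g N) - 0) < e" if N: "N0 \<le> N" for N
    proof -
      have "E m (?g N) (?g N) \<le> e / 2" for m
      proof (rule LIMSEQ_le_const2)
        show "(\<lambda>M. E m (\<lambda>x. ?S M x - ?S N x) (\<lambda>x. ?S M x - ?S N x)) \<longlonglongrightarrow> E m (?g N) (?g N)"
          by (intro E_tendsto tendsto_diff pw tendsto_const)
        have "E m (\<lambda>x. ?S M x - ?S N x) (\<lambda>x. ?S M x - ?S N x) \<le> e / 2" if "N \<le> M" for M
        proof -
          have "E m (\<lambda>x. ?S M x - ?S N x) (\<lambda>x. ?S M x - ?S N x) = E m (comb {N..<M} c) (comb {N..<M} c)"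
            by (simp add: diff[OF that])
          also have "\<dots> \<le> En (comb {N..<M} c) (comb {N..<M} c)" by (intro E_le_En Fb_Dom comb_Fb)
          also have "\<dots> = (\<Sum>n\<in>{N..<M}. lam n * (c n)\<^sup>2)" by (simp add: En_comb_self)
          also have "\<dots> \<le> sum ?a {N..<M}" by (intro sum_mono) (simp add: distrib_right)
          also have "\<dots> \<le> e / 2" using N0 N less_imp_le by blast
          finally show ?thesis .
        qed
        then show "\<exists>M0. \<forall>M\<ge>M0. E m (\<lambda>x. ?S M x - ?S N x) (\<lambda>x. ?S M x - ?S N x) \<le> e / 2" by blast
      qed
      then have "En (?g N) (?g N) \<le> e / 2"
        by (intro LIMSEQ_le_const2[OF En_lim_diag[OF Fb_Dom[OF gF]]]) auto
      then show ?thesis using En_nonneg[OF Fb_Dom[OF gF[of N]]] e by simp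
    qed
    then show "\<exists>N0. \<forall>N\<ge>N0. norm (En (?g N) (?g N) - 0) < e" by blast
  qed
  have Es: "(\<lambda>n. lam n * c n * ip (\<phi> n) v) sums En u v" if v: "v \<in> Fb" for v
  proof -
    have z: "(\<lambda>N. sqrt (En (?g N) (?g N) * En v v)) \<longlonglongrightarrow> sqrt (0 * En v v)"
      by (intro tendsto_real_sqrt tendsto_mult G tendsto_const)
    have "(\<lambda>N. En (?g N) v) \<longlonglongrightarrow> 0"
    proof (rule Lim_null_comparison)
      have "\<bar>En (?g N) v\<bar> \<le> sqrt (En (?g N) (?g N) * En v v)" for N
        by (rule real_le_rsqrt) (simp add: En_cauchy_schwarz Fb_Dom gF v)
      then show "\<forall>\<^sub>F N in sequentially. norm (En (?g N) v) \<le> sqrt (En (?g N) (?g N) * En v v)" by simp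
      show "(\<lambda>N. sqrt (En (?g N) (?g N) * En v v)) \<longlonglongrightarrow> 0" using z by simp
    qed
    then have "(\<lambda>N. En u v - En (?g N) v) \<longlonglongrightarrow> En u v - 0" by (intro tendsto_intros)
    moreover have "En u v - En (?g N) v = (\<Sum>n<N. lam n * c n * ip (\<phi> n) v)" for N
      using En_diff_left[OF uD Fb_Dom[OF comb_Fb] Fb_Dom[OF v], of "{..<N}" c] En_comb[of "{..<N}" v c] v by simp
    ultimately show ?thesis by (simp add: sums_def)
  qed
  have Is: "(\<lambda>n. c n * ip (\<phi> n) v) sums ip u v" if v: "v \<in> Fb" for v
    unfolding sums_def
  proof (rule LIMSEQ_I)
    fix e :: real assume e: "0 < e"
    let ?I = "LINT x|\<mu>. \<bar>v x\<bar>"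
    have I: "0 \<le> ?I" by simp
    define e' where "e' = e / (?I + 1)"
    have "0 < ?I + 1" using I by linarith
    then have e'0: "0 < e'" and "e' * (?I + 1) = e" using e by (simp_all add: e'_def)
    then have e': "0 < e'" "e' * ?I < e" unfolding distrib_left by linarith+
    obtain N0 where N0: "\<And>N x. N0 \<le> N \<Longrightarrow> dist (?S N x) (u x) < e'"
      using uniform_limitD[OF u e'(1)] by (auto simp: eventually_sequentially)
    have "norm ((\<Sum>n<N. c n * ip (\<phi> n) v) - ip u v) < e" if N: "N0 \<le> N" for N
    proof -
      have cv: "continuous_on UNIV v" by (rule Fb_cont[OF v])
      have cS: "continuous_on UNIV (?S N)" by (intro Fb_cont comb_Fb)
      have "(\<Sum>n<N. c n * ip (\<phi> n) v) - ip u v = ip (\<lambda>x. ?S N x - u x) v"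
        using ip_comb[of "{..<N}" v c] cv by (simp add: ip_diff_left[OF cS uc cv])
      also have "norm \<dots> \<le> (LINT x|\<mu>. norm ((?S N x - u x) * v x))" by (rule integral_norm_bound)
      also have "\<dots> \<le> (LINT x|\<mu>. e' * \<bar>v x\<bar>)"
      proof (intro integral_mono)
        show "integrable \<mu> (\<lambda>x. norm ((?S N x - u x) * v x))" "integrable \<mu> (\<lambda>x. e' * \<bar>v x\<bar>)"
          using cv cS uc by (auto intro!: cont_int continuous_intros)
        fix x show "norm ((?S N x - u x) * v x) \<le> e' * \<bar>v x\<bar>"
          using N0[OF N, of x] by (auto simp: abs_mult dist_real_def intro!: mult_right_mono)
      qed
      also have "\<dots> = e' * ?I" by simp
      finally show ?thesis using e' by simp
    qed
    then show "\<exists>N0. \<forall>N\<ge>N0. norm ((\<Sum>n<N. c n * ip (\<phi> n) v) - ip u v) < e" by blast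
  qed
  show ?thesis by (rule that[OF uF u Es Is])
qed

text \<open>The limit of the series has the same coefficients as \<open>f\<close>, so completeness
  and continuity identify the two at every point. The second claim is Parseval's identity.\<close>

lemma expansion:
  assumes f: "f \<in> Fb"
  shows "uniform_limit UNIV (\<lambda>N. comb {..<N} (coef f)) f sequentially"
    and "\<And>v. v \<in> Fb \<Longrightarrow> (\<lambda>n. coef f n * coef v n) sums ip f v"
proof -
  obtain u where u: "u \<in> Fb" "uniform_limit UNIV (\<lambda>N. comb {..<N} (coef f)) u sequentially"
    "\<And>v. v \<in> Fb \<Longrightarrow> (\<lambda>n. coef f n * ip (\<phi> n) v) sums ip u v"
    by (rule series_limit[OF coef_summable[OF f]]) (rule that)
  have "u x - f x = 0" for x
  proof (rule complete_cont)
    show "continuous_on UNIV (\<lambda>x. u x - f x)" by (intro Fb_cont Fb_diff u f)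
    fix k
    have "(\<lambda>n. if n = k then coef f k else 0) sums ip u (\<phi> k)"
      using u(3)[OF phi_Fb[of k]] by (simp add: orth if_distrib cong: if_cong)
    moreover have "(\<lambda>n. if n = k then coef f k else 0) sums coef f k" using sums_single[of k "\<lambda>_. coef f k"] by simp
    ultimately have "ip u (\<phi> k) = coef f k" by (rule sums_unique2)
    then have "ip (\<lambda>x. u x - f x) (\<phi> k) = 0"
      using ip_diff_left[OF Fb_cont[OF u(1)] Fb_cont[OF f] phi_cont, of k] by (simp add: coef_def mult.commute)
    then show "ip (\<phi> k) (\<lambda>x. u x - f x) = 0" by (simp add: mult.commute)
  qed
  then have "u = f" by auto
  with u show "uniform_limit UNIV (\<lambda>N. comb {..<N} (coef f)) f sequentially"
    and "\<And>v. v \<in> Fb \<Longrightarrow> (\<lambda>n. coef f n * coef v n) sums ip f v" by (auto simp: coef_def)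
qed

section \<open>Caccioppoli inequality and decay of resolvents\<close>

lemma edge_short: assumes "e \<in> edges m" shows "R (src e) (tgt e) \<le> rmax ^ m * D0"
proof -
  obtain w p q where e: "e = (w, p, q)" "length w = m" using assms by (auto simp: edges_def words_def)
  have "R (Fw F w p) (Fw F w q) \<le> rw r w * R p q" by (rule R_Fw_le)
  also have "\<dots> \<le> rmax ^ m * D0"
    using rw_le_power[of w] rmax_pos D0 e(2) rw_pos[of w] by (intro mult_mono) auto
  finally show ?thesis by (simp add: e src_def tgt_def)
qed

text \<open>An edge on which \<psi> changes has an end at distance at least \<rho> from
  \<open>x\<close>. By \<open>edge_short\<close> the edges of level \<open>m\<close> become short,
  so for large \<open>m\<close> the other end is at distance at least \<open>\<rho> / 2\<close>, and
  the discrete inequality applies with the bound \<open>M\<close>.\<close>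

lemma caccioppoli:
  assumes u: "u \<in> Dom" and p: "\<psi> \<in> Dom" and \<rho>: "0 < \<rho>"
    and zero: "\<And>y. R x y < \<rho> \<Longrightarrow> \<psi> y = 0"
    and M: "\<And>y. \<rho> / 2 \<le> R x y \<Longrightarrow> \<bar>u y\<bar> \<le> M"
  shows "En (\<lambda>y. u y * \<psi> y) (\<lambda>y. u y * \<psi> y) \<le> En u (\<lambda>y. u y * (\<psi> y)\<^sup>2) + M\<^sup>2 * En \<psi> \<psi>"
proof -
  have "(\<lambda>m. rmax ^ m * D0) \<longlonglongrightarrow> 0 * D0"
    using rmax_pos rmax_less_1 by (intro tendsto_intros LIMSEQ_realpow_zero) auto
  then have "\<forall>\<^sub>F m in sequentially. rmax ^ m * D0 < \<rho> / 2" using \<rho> by (intro order_tendstoD) auto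
  then have ev: "\<forall>\<^sub>F m in sequentially. E m (\<lambda>y. u y * \<psi> y) (\<lambda>y. u y * \<psi> y)
     \<le> E m u (\<lambda>y. u y * (\<psi> y)\<^sup>2) + M\<^sup>2 * E m \<psi> \<psi>"
  proof eventually_elim
    case (elim m)
    show ?case
    proof (rule E_caccioppoli)
      fix e assume e: "e \<in> edges m" "\<psi> (src e) \<noteq> \<psi> (tgt e)"
      have s: "R (src e) (tgt e) < \<rho> / 2" using edge_short[OF e(1)] elim by simp
      have "\<rho> \<le> R x (src e) \<or> \<rho> \<le> R x (tgt e)" using e(2) zero by (metis not_le)
      then have "\<rho> / 2 \<le> R x (src e)" "\<rho> / 2 \<le> R x (tgt e)"
        using s R_tri[of x "src e" "tgt e"] R_tri[of x "tgt e" "src e"] R_sym[of "src e" "tgt e"] \<rho> by linarith+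
      then show "\<bar>u (src e)\<bar> \<le> M \<and> \<bar>u (tgt e)\<bar> \<le> M" using M by blast
    qed
  qed
  show ?thesis
  proof (rule tendsto_le[OF _ _ _ ev])
    show "(\<lambda>m. E m u (\<lambda>y. u y * (\<psi> y)\<^sup>2) + M\<^sup>2 * E m \<psi> \<psi>) \<longlonglongrightarrow> En u (\<lambda>y. u y * (\<psi> y)\<^sup>2) + M\<^sup>2 * En \<psi> \<psi>"
      using u p by (intro tendsto_add tendsto_mult tendsto_const En_lim) auto
    show "(\<lambda>m. E m (\<lambda>y. u y * \<psi> y) (\<lambda>y. u y * \<psi> y)) \<longlonglongrightarrow> En (\<lambda>y. u y * \<psi> y) (\<lambda>y. u y * \<psi> y)"
      using u p by (intro En_lim) auto
  qed simp
qed

text \<open>Away from the support of \<open>f\<close> the Caccioppoli inequality and \<open>sup_bound\<close> gain a factor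
  \<open>kappa \<sigma> / \<rho>\<close> each time the distance is multiplied by \<open>Q\<close>.\<close>

lemma resolvent_decay:
  obtains C Q where "0 < C" "1 \<le> Q"
    "\<And>f \<sigma> x \<rho>. f \<in> Fb \<Longrightarrow> 0 < \<sigma> \<Longrightarrow> 0 < \<rho> \<Longrightarrow> \<forall>y. \<rho> \<le> R x y \<longrightarrow> f y = 0 \<Longrightarrow>
       \<exists>w\<in>Fb. (\<forall>v\<in>Fb. (\<lambda>n. coef f n * coef v n / (\<sigma> + lam n)) sums ip w v) \<and>
         (\<forall>k y. (k = 0 \<or> Q ^ k * \<rho> \<le> R x y) \<longrightarrow>
            (w y)\<^sup>2 \<le> (C * kappa \<sigma> / \<rho>) ^ k * (C * kappa \<sigma> * (LINT x|\<mu>. \<bar>f x\<bar>))\<^sup>2)"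
proof -
  obtain C1 where C1: "0 < C1"
    "\<And>\<sigma> u y. 0 < \<sigma> \<Longrightarrow> u \<in> Dom \<Longrightarrow> (u y)\<^sup>2 \<le> C1 * kappa \<sigma> * (En u u + \<sigma> * (LINT x|\<mu>. (u x)\<^sup>2))"
    by (rule sup_bound) (rule that)
  obtain C2 where C2: "1 \<le> C2"
    "\<And>x \<rho>. 0 < \<rho> \<Longrightarrow> \<exists>\<psi>\<in>Dom. (\<forall>y. R x y < \<rho> \<longrightarrow> \<psi> y = 0) \<and> (\<forall>y. C2 * \<rho> \<le> R x y \<longrightarrow> \<psi> y = 1) \<and>
       En \<psi> \<psi> \<le> C2 / \<rho>"
    by (rule ball_cutoff) (rule that)
  define C where "C = C1 * C2"
  define Q where "Q = 2 * C2"
  have C: "0 < C" "C1 \<le> C" and Q: "1 \<le> Q" using C1 C2 mult_left_mono[of 1 C2 C1] by (auto simp: C_def Q_def)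
  show ?thesis
  proof (rule that[OF C(1) Q])
    fix f and \<sigma> :: real and x and \<rho> :: real assume f: "f \<in> Fb" and \<sigma>: "0 < \<sigma>" and \<rho>: "0 < \<rho>" and supp: "\<forall>y. \<rho> \<le> R x y \<longrightarrow> f y = 0"
    let ?c = "\<lambda>n. coef f n / (\<sigma> + lam n)"
    have pos: "0 < \<sigma> + lam n" for n using \<sigma> lam_nonneg[of n] by simp
    have "summable (\<lambda>n. (1 + lam n) * (?c n)\<^sup>2)"
    proof (rule summable_comparison_test)
      show "summable (\<lambda>n. ((1 + lam n) * (coef f n)\<^sup>2) * (1 / \<sigma>\<^sup>2))"
        by (intro summable_mult2 coef_summable f)
      have "norm ((1 + lam n) * (?c n)\<^sup>2) \<le> ((1 + lam n) * (coef f n)\<^sup>2) * (1 / \<sigma>\<^sup>2)" for n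
      proof -
        have "\<sigma>\<^sup>2 \<le> (\<sigma> + lam n)\<^sup>2" using \<sigma> lam_nonneg[of n] by (intro power_mono) auto
        then have "1 / (\<sigma> + lam n)\<^sup>2 \<le> 1 / \<sigma>\<^sup>2" using \<sigma> pos[of n] by (intro divide_left_mono) auto
        then have "((1 + lam n) * (coef f n)\<^sup>2) * (1 / (\<sigma> + lam n)\<^sup>2) \<le> ((1 + lam n) * (coef f n)\<^sup>2) * (1 / \<sigma>\<^sup>2)"
          using lam_nonneg[of n] by (intro mult_left_mono) auto
        then show ?thesis using lam_nonneg[of n] by (simp add: power_divide)
      qed
      then show "\<exists>N. \<forall>n\<ge>N. norm ((1 + lam n) * (?c n)\<^sup>2) \<le> ((1 + lam n) * (coef f n)\<^sup>2) * (1 / \<sigma>\<^sup>2)" by blast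
    qed
    then obtain w where w: "w \<in> Fb"
      "\<And>v. v \<in> Fb \<Longrightarrow> (\<lambda>n. lam n * ?c n * ip (\<phi> n) v) sums En w v"
      "\<And>v. v \<in> Fb \<Longrightarrow> (\<lambda>n. ?c n * ip (\<phi> n) v) sums ip w v"
      by (rule series_limit) (rule that)
    \<comment> \<open>The weak equation for the resolvent: multiplication by
      \<open>\<sigma> + lam n\<close> restores the coefficients of \<open>f\<close>.\<close>
    have weak: "En w v + \<sigma> * ip w v = ip f v" if v: "v \<in> Fb" for v
    proof -
      have "(\<lambda>n. lam n * ?c n * ip (\<phi> n) v + \<sigma> * (?c n * ip (\<phi> n) v)) sums (En w v + \<sigma> * ip w v)"
        by (intro sums_add sums_mult w v)
      moreover have "lam n * ?c n * ip (\<phi> n) v + \<sigma> * (?c n * ip (\<phi> n) v) = coef f n * coef v n" for n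
      proof -
        have "lam n * b * i + \<sigma> * (b * i) = (\<sigma> + lam n) * b * i" for b i :: real by (simp add: algebra_simps)
        moreover have "(\<sigma> + lam n) * ?c n = coef f n" using pos[of n] by simp
        ultimately show ?thesis by (simp only: coef_def[of v])
      qed
      ultimately have "(\<lambda>n. coef f n * coef v n) sums (En w v + \<sigma> * ip w v)" by simp
      then show ?thesis using expansion(2)[OF f v] sums_unique2 by blast
    qed
    let ?L = "LINT x|\<mu>. \<bar>f x\<bar>"
    have L: "0 \<le> ?L" by simp
    have kp: "0 < kappa \<sigma>" by (rule kappa_pos[OF \<sigma>])
    define A where "A = En w w + \<sigma> * ip w w"
    have A0: "0 \<le> A" unfolding A_def using En_nonneg[OF Fb_Dom[OF w(1)]] \<sigma> by simp
    have wA: "(w y)\<^sup>2 \<le> C1 * kappa \<sigma> * A" for y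
      using C1(2)[OF \<sigma> Fb_Dom[OF w(1)], of y] by (simp add: A_def power2_eq_square)
    have cf: "continuous_on UNIV f" and cw: "continuous_on UNIV w" using Fb_cont f w(1) by auto
    \<comment> \<open>Testing with \<open>w\<close> itself bounds \<open>A\<close> by a multiple of
      its own square root, hence by the square of the L1 norm of \<open>f\<close>.\<close>
    have "A = ip f w" unfolding A_def by (rule weak[OF w(1)])
    also have "\<dots> \<le> (LINT x|\<mu>. sqrt (C1 * kappa \<sigma> * A) * \<bar>f x\<bar>)"
    proof (intro integral_mono)
      show "integrable \<mu> (\<lambda>x. f x * w x)" "integrable \<mu> (\<lambda>x. sqrt (C1 * kappa \<sigma> * A) * \<bar>f x\<bar>)"
        using cf cw by (auto intro!: cont_int continuous_intros)
      fix y
      have "\<bar>w y\<bar> \<le> sqrt (C1 * kappa \<sigma> * A)" using wA[of y] by (simp add: real_le_rsqrt)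
      then have "\<bar>f y\<bar> * \<bar>w y\<bar> \<le> \<bar>f y\<bar> * sqrt (C1 * kappa \<sigma> * A)" by (intro mult_left_mono) auto
      moreover have "f y * w y \<le> \<bar>f y\<bar> * \<bar>w y\<bar>" by (metis abs_ge_self abs_mult)
      ultimately show "f y * w y \<le> sqrt (C1 * kappa \<sigma> * A) * \<bar>f y\<bar>" by (simp add: mult.commute)
    qed
    also have "\<dots> = sqrt (C1 * kappa \<sigma> * A) * ?L" by simp
    finally have "A\<^sup>2 \<le> (sqrt (C1 * kappa \<sigma> * A) * ?L)\<^sup>2" using A0 by (intro power_mono) auto
    also have "\<dots> = C1 * kappa \<sigma> * A * ?L\<^sup>2" using A0 C1(1) kp by (simp add: power_mult_distrib)
    finally have "A * A \<le> A * (C1 * kappa \<sigma> * ?L\<^sup>2)" by (simp add: power2_eq_square mult_ac)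
    then have AL: "A \<le> C1 * kappa \<sigma> * ?L\<^sup>2"
      using A0 C1(1) kp by (cases "A = 0") (auto simp: mult_le_cancel_left)
    have base: "(w y)\<^sup>2 \<le> (C * kappa \<sigma> * ?L)\<^sup>2" for y
    proof -
      have "(w y)\<^sup>2 \<le> C1 * kappa \<sigma> * (C1 * kappa \<sigma> * ?L\<^sup>2)"
        using C1(1) kp by (intro order.trans[OF wA mult_left_mono[OF AL]]) simp
      also have "\<dots> = (C1 * kappa \<sigma> * ?L)\<^sup>2" by (simp add: power2_eq_square mult_ac)
      also have "\<dots> \<le> (C * kappa \<sigma> * ?L)\<^sup>2" using C C1(1) kp L by (intro power_mono mult_right_mono) auto
      finally show ?thesis .
    qed
    have iter: "(w y)\<^sup>2 \<le> (C * kappa \<sigma> / \<rho>) ^ k * (C * kappa \<sigma> * ?L)\<^sup>2" if "k = 0 \<or> Q ^ k * \<rho> \<le> R x y" for k y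
      using that
    proof (induction k arbitrary: y)
      case 0
      then show ?case using base[of y] by simp
    next
      case (Suc k)
      \<comment> \<open>Half of this radius is the distance where the induction hypothesis holds,
        and \<open>C2 * \<rho>'\<close> is the next distance
        \<open>Q ^ Suc k * \<rho>\<close>.\<close>
      define \<rho>' where "\<rho>' = 2 * (Q ^ k * \<rho>)"
      have Qk: "1 \<le> Q ^ k" using Q by (rule one_le_power)
      then have "\<rho> \<le> Q ^ k * \<rho>" using \<rho> by simp
      then have \<rho>': "0 < \<rho>'" "\<rho> \<le> \<rho>'" using \<rho> by (auto simp: \<rho>'_def)
      obtain \<psi> where \<psi>: "\<psi> \<in> Dom" "\<forall>y. R x y < \<rho>' \<longrightarrow> \<psi> y = 0" "\<forall>y. C2 * \<rho>' \<le> R x y \<longrightarrow> \<psi> y = 1"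
        "En \<psi> \<psi> \<le> C2 / \<rho>'"
        using C2(2)[OF \<rho>'(1), of x] by (elim bexE conjE) (rule that)
      have y1: "\<psi> y = 1"
      proof -
        have "C2 * \<rho>' = Q ^ Suc k * \<rho>" by (simp add: \<rho>'_def Q_def)
        then show ?thesis using Suc.prems \<psi>(3) by auto
      qed
      let ?T = "(C * kappa \<sigma> / \<rho>) ^ k * (C * kappa \<sigma> * ?L)\<^sup>2"
      have T0: "0 \<le> ?T" using C kp \<rho> by (intro mult_nonneg_nonneg) auto
      define M where "M = sqrt ?T"
      have M2: "M\<^sup>2 = ?T" using T0 by (simp add: M_def)
      have bM: "\<bar>w z\<bar> \<le> M" if "\<rho>' / 2 \<le> R x z" for z
        unfolding M_def using Suc.IH[of z] that by (intro real_le_rsqrt) (simp add: \<rho>'_def)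
      let ?wp = "\<lambda>y. w y * \<psi> y"
      have wpF: "?wp \<in> Fb" by (intro Fb_mult w \<psi>)
      have wp2F: "(\<lambda>y. w y * (\<psi> y)\<^sup>2) \<in> Fb" by (intro Fb_mult w Dom_power2 \<psi>)
      \<comment> \<open>The cutoff vanishes wherever \<open>f\<close> does not, so the right-hand
        side of the weak equation drops out.\<close>
      have "f y * (w y * (\<psi> y)\<^sup>2) = 0" for y
        using supp \<psi>(2) \<rho>' by (cases "R x y < \<rho>'") auto
      then have "ip f (\<lambda>y. w y * (\<psi> y)\<^sup>2) = (LINT y|\<mu>. 0)"
        by (intro Bochner_Integration.integral_cong refl)
      then have "En w (\<lambda>y. w y * (\<psi> y)\<^sup>2) + \<sigma> * ip w (\<lambda>y. w y * (\<psi> y)\<^sup>2) = 0" using weak[OF wp2F] by simp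
      moreover have "ip w (\<lambda>y. w y * (\<psi> y)\<^sup>2) = (LINT y|\<mu>. (?wp y)\<^sup>2)"
        by (intro Bochner_Integration.integral_cong refl) (simp add: power2_eq_square mult_ac)
      moreover have "En ?wp ?wp \<le> En w (\<lambda>y. w y * (\<psi> y)\<^sup>2) + M\<^sup>2 * En \<psi> \<psi>"
        by (rule caccioppoli[OF Fb_Dom[OF w(1)] \<psi>(1) \<rho>'(1), of x]) (use \<psi>(2) bM in auto)
      ultimately have en: "En ?wp ?wp + \<sigma> * (LINT y|\<mu>. (?wp y)\<^sup>2) \<le> M\<^sup>2 * En \<psi> \<psi>" by simp
      have "(w y)\<^sup>2 = (?wp y)\<^sup>2" by (simp add: y1)
      also have "\<dots> \<le> C1 * kappa \<sigma> * (En ?wp ?wp + \<sigma> * (LINT y|\<mu>. (?wp y)\<^sup>2))"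
        by (rule C1(2)[OF \<sigma> Fb_Dom[OF wpF]])
      also have "\<dots> \<le> C1 * kappa \<sigma> * (M\<^sup>2 * (C2 / \<rho>))"
      proof (intro mult_left_mono order.trans[OF en])
        \<comment> \<open>The better factor \<open>C2 / \<rho>'\<close> is given up so that the gain
          per step does not depend on \<open>k\<close>.\<close>
        have "C2 / \<rho>' \<le> C2 / \<rho>" using \<rho>' \<rho> C2(1) by (intro divide_left_mono) auto
        then show "En \<psi> \<psi> \<le> C2 / \<rho>" using \<psi>(4) by simp
      qed (use C1 kp in auto)
      also have "\<dots> = (C * kappa \<sigma> / \<rho>) * ?T" unfolding M2 C_def by simp
      also have "\<dots> = (C * kappa \<sigma> / \<rho>) ^ Suc k * (C * kappa \<sigma> * ?L)\<^sup>2" by simp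
      finally show ?case .
    qed
    show "\<exists>w\<in>Fb. (\<forall>v\<in>Fb. (\<lambda>n. coef f n * coef v n / (\<sigma> + lam n)) sums ip w v) \<and>
         (\<forall>k y. (k = 0 \<or> Q ^ k * \<rho> \<le> R x y) \<longrightarrow>
            (w y)\<^sup>2 \<le> (C * kappa \<sigma> / \<rho>) ^ k * (C * kappa \<sigma> * (LINT x|\<mu>. \<bar>f x\<bar>))\<^sup>2)"
    proof (intro bexI[of _ w] conjI ballI allI impI w(1))
      fix v assume "v \<in> Fb"
      from w(3)[OF this] show "(\<lambda>n. coef f n * coef v n / (\<sigma> + lam n)) sums ip w v"
        by (simp add: coef_def)
    qed (rule iter)
  qed
qed

end

section \<open>Subordination to resolvents\<close>

lemma nn_integral_abs_real:
  fixes f :: "real \<Rightarrow> ennreal"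
  assumes [measurable]: "f \<in> borel_measurable borel"
  shows "(\<integral>\<^sup>+x. f \<bar>x\<bar> \<partial>lborel) \<le> 2 * (\<integral>\<^sup>+x\<in>{0..}. f x \<partial>lborel)"
proof -
  let ?I = "\<integral>\<^sup>+x\<in>{0..}. f x \<partial>lborel"
  have r: "?I = (\<integral>\<^sup>+x. f (- x) * indicator {0..} (- x) \<partial>lborel)"
    by (subst nn_integral_real_affine[where c = "-1" and t = 0]) auto
  have "(\<integral>\<^sup>+x. f \<bar>x\<bar> \<partial>lborel) \<le> (\<integral>\<^sup>+x. f x * indicator {0..} x + f (- x) * indicator {0..} (- x) \<partial>lborel)"
    by (intro nn_integral_mono) (auto simp: indicator_def)
  also have "\<dots> = ?I + (\<integral>\<^sup>+x. f (- x) * indicator {0..} (- x) \<partial>lborel)"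
    by (intro nn_integral_add) auto
  finally show ?thesis by (simp add: r[symmetric] mult_2)
qed

text \<open>The input for Levy's inversion formula: with \<open>a = sqrt lam\<close> the real part
  of this quotient is \<open>lam / (s\<^sup>2 + lam)\<close>.\<close>

lemma char_exponential:
  assumes a: "0 < a"
  shows "char (density lborel (exponential_density a)) s = a / (a - \<i> * s)"
proof -
  let ?g = "exponential_density a"
  have g0: "0 \<le> ?g x" for x using a by (simp add: exponential_density_def)
  interpret P: prob_space "density lborel ?g" by (rule prob_space_exponential_density[OF a])
  have gi: "integrable lborel ?g"
  proof (rule integrableI_nonneg)
    have "(\<integral>\<^sup>+x. ennreal (?g x) \<partial>lborel) = emeasure (density lborel ?g) UNIV"
      by (simp add: emeasure_density)
    also have "\<dots> = 1" using P.emeasure_space_1 by simp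
    finally show "(\<integral>\<^sup>+x. ennreal (?g x) \<partial>lborel) < \<infinity>" by simp
  qed (auto simp: g0)
  let ?c = "\<i> * s - a"
  have c0: "?c \<noteq> 0" using a by (auto simp: complex_eq_iff)
  let ?f = "\<lambda>x::real. a * exp (?c * x)"
  have eq: "?g x *\<^sub>R iexp (s * x) = indicator {0..} x *\<^sub>R ?f x" for x
  proof (cases "0 \<le> x")
    case True
    have "?f x = a * (exp (\<i> * (s * x)) * exp (- (x * a)))"
      by (simp add: algebra_simps flip: exp_add exp_of_real)
    then show ?thesis using True by (auto simp: exponential_density_def scaleR_conv_of_real mult_ac simp flip: exp_of_real)
  qed (simp add: exponential_density_def)
  have int: "integrable lborel (\<lambda>x. ?g x *\<^sub>R iexp (s * x))"
    by (rule Bochner_Integration.integrable_bound[OF gi]) (auto simp: g0)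
  have si: "set_integrable lborel (einterval (ereal 0) \<infinity>) ?f"
  proof -
    have "set_integrable lborel {0..} ?f" using int unfolding eq set_integrable_def .
    then show ?thesis by (rule set_integrable_subset) (auto simp: einterval_def)
  qed
  have "char (density lborel ?g) s = (LINT x|lborel. ?g x *\<^sub>R iexp (s * x))"
    unfolding char_def by (rule integral_density) (auto simp: g0)
  also have "\<dots> = (LINT x:{0..}|lborel. ?f x)" unfolding eq set_lebesgue_integral_def ..
  also have "\<dots> = (LINT x:einterval (ereal 0) \<infinity>|lborel. ?f x)"
    by (rule set_integral_discrete_difference[where X = "{0}"]) (auto simp: einterval_def)
  also have "\<dots> = (LBINT x=ereal 0..\<infinity>. ?f x)" by (simp add: interval_lebesgue_integral_def)
  also have "\<dots> = 0 - a / ?c"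
  proof (rule interval_integral_FTC_integrable[where F = "\<lambda>x. a * exp (?c * x) / ?c"])
    show "((\<lambda>x. a * exp (?c * x) / ?c) has_vector_derivative ?f x) (at x)" for x :: real
    proof -
      have "((\<lambda>z. a * exp (?c * z) / ?c) has_field_derivative ?f x) (at (of_real x))"
        using c0 by (auto intro!: derivative_eq_intros)
      then show ?thesis by (rule has_vector_derivative_real_field)
    qed
    show "isCont ?f x" for x by (intro continuous_intros)
    show "set_integrable lborel (einterval (ereal 0) \<infinity>) ?f" by (rule si)
    have "continuous (at_right 0) (\<lambda>x::real. a * exp (?c * x) / ?c)"
      using c0 by (intro continuous_intros) auto
    then have "((\<lambda>x::real. a * exp (?c * x) / ?c) \<longlongrightarrow> a * exp (?c * 0) / ?c) (at_right 0)"
      by (simp add: continuous_within)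
    then show "(((\<lambda>x. a * exp (?c * x) / ?c) \<circ> real_of_ereal) \<longlongrightarrow> a / ?c) (at_right (ereal 0))"
      unfolding ereal_tendsto_simps by simp
    have "((\<lambda>x::real. a * exp (?c * x) / ?c) \<longlongrightarrow> 0) at_top"
    proof (rule tendsto_norm_zero_cancel)
      have "norm (a * exp (?c * x) / ?c) = a * exp (- (a * x)) / norm ?c" for x :: real
        using a by (simp add: norm_mult norm_divide)
      moreover have "((\<lambda>x. a * exp (- (a * x)) / norm ?c) \<longlongrightarrow> a * 0 / norm ?c) at_top"
        by (intro tendsto_intros filterlim_compose[OF exp_at_bot]) (use c0 a in \<open>auto simp: filterlim_uminus_at_bot intro!: filterlim_tendsto_pos_mult_at_top[OF tendsto_const _ filterlim_ident]\<close>)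
      ultimately show "((\<lambda>x::real. norm (a * exp (?c * x) / ?c)) \<longlongrightarrow> 0) at_top" by simp
    qed
    then show "(((\<lambda>x. a * exp (?c * x) / ?c) \<circ> real_of_ereal) \<longlongrightarrow> 0) (at_left \<infinity>)"
      unfolding ereal_tendsto_simps by simp
  qed simp
  also have "\<dots> = a / (a - \<i> * s)"
    by (metis diff_0 minus_diff_eq minus_divide_right)
  finally show ?thesis .
qed

lemma lorentz_integrable: "integrable lborel (\<lambda>x::real. 1 / (1 + x\<^sup>2))"
proof (rule integrableI_nonneg)
  have "set_integrable lborel (einterval 0 \<infinity>) (\<lambda>x::real. 1 / (1 + x\<^sup>2))"
    using integrable_I0i_1_div_plus_square by (simp add: interval_lebesgue_integrable_def)
  then have "(\<integral>\<^sup>+x. ennreal (norm (indicator (einterval 0 \<infinity>) x *\<^sub>R (1 / (1 + x\<^sup>2)))) \<partial>lborel) < \<infinity>"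
    unfolding set_integrable_def integrable_iff_bounded by blast
  also have "(\<integral>\<^sup>+x. ennreal (norm (indicator (einterval 0 \<infinity>) x *\<^sub>R (1 / (1 + x\<^sup>2)))) \<partial>lborel)
      = (\<integral>\<^sup>+x\<in>{0..}. ennreal (1 / (1 + x\<^sup>2)) \<partial>lborel)"
  proof (rule nn_integral_cong_AE)
    show "AE x in lborel. ennreal (norm (indicator (einterval 0 \<infinity>) x *\<^sub>R (1 / (1 + x\<^sup>2))))
       = ennreal (1 / (1 + x\<^sup>2)) * indicator {0..} x"
      using AE_lborel_singleton[of 0]
      by eventually_elim (auto simp: indicator_def einterval_def zero_ereal_def)
  qed
  finally have "2 * (\<integral>\<^sup>+x\<in>{0..}. ennreal (1 / (1 + x\<^sup>2)) \<partial>lborel) < \<infinity>"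
    by (simp add: ennreal_mult_less_top)
  then show "(\<integral>\<^sup>+x. ennreal (1 / (1 + x\<^sup>2)) \<partial>lborel) < \<infinity>"
    using nn_integral_abs_real[of "\<lambda>x. ennreal (1 / (1 + x\<^sup>2))"] by (auto intro: le_less_trans)
qed auto

lemma abs_sin_div_le: "\<bar>sin (t * s) / s\<bar> \<le> \<bar>t\<bar>" for t s :: real
proof (cases "s = 0")
  case False
  have "\<bar>sin (t * s)\<bar> \<le> \<bar>t\<bar> * \<bar>s\<bar>" using abs_sin_x_le_abs_x[of "t * s"] by (simp add: abs_mult)
  then show ?thesis using False by (simp add: abs_divide divide_le_eq)
qed simp

text \<open>One integrable majorant for all \<open>lam\<close>, at the price of the factor
  \<open>1 + lam\<close>; this is the weight under which products of coefficients of form functions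
  are summable.\<close>

lemma rational_le_lorentz:
  fixes lam s :: real assumes "0 \<le> lam" shows "lam / (s\<^sup>2 + lam) \<le> (1 + lam) * (1 / (1 + s\<^sup>2))"
proof (cases "lam = 0")
  case False
  then have p: "0 < lam" using assms by simp
  have "lam * (1 + s\<^sup>2) \<le> (1 + lam) * (s\<^sup>2 + lam)" using p by (simp add: algebra_simps)
  moreover have "0 < s\<^sup>2 + lam" "0 < 1 + s\<^sup>2" using p by (auto intro: add_nonneg_pos add_pos_nonneg)
  ultimately show ?thesis by (simp add: divide_simps mult_ac)
qed simp

lemma sine_kernel_integrable:
  fixes lam t :: real assumes "0 \<le> lam"
  shows "integrable lborel (\<lambda>s. sin (t * s) / s * (lam / (s\<^sup>2 + lam)))"
proof (rule Bochner_Integration.integrable_bound)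
  show "integrable lborel (\<lambda>s::real. \<bar>t\<bar> * ((1 + lam) * (1 / (1 + s\<^sup>2))))"
    by (intro integrable_mult_right lorentz_integrable)
  have "\<bar>sin (t * s) / s * (lam / (s\<^sup>2 + lam))\<bar> \<le> \<bar>t\<bar> * ((1 + lam) * (1 / (1 + s\<^sup>2)))" for s
  proof -
    have "\<bar>sin (t * s) / s * (lam / (s\<^sup>2 + lam))\<bar> = \<bar>sin (t * s) / s\<bar> * (lam / (s\<^sup>2 + lam))"
      using assms by (simp add: abs_mult)
    also have "\<dots> \<le> \<bar>t\<bar> * ((1 + lam) * (1 / (1 + s\<^sup>2)))"
      using assms by (intro mult_mono abs_sin_div_le rational_le_lorentz) auto
    finally show ?thesis .
  qed
  then show "AE s in lborel. norm (sin (t * s) / s * (lam / (s\<^sup>2 + lam))) \<le> norm (\<bar>t\<bar> * ((1 + lam) * (1 / (1 + s\<^sup>2))))"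
    using assms by (intro AE_I2) (simp add: abs_mult)
qed measurable

text \<open>This is the real part of Levy's inversion formula for the exponential distribution of rate
  \<open>sqrt lam\<close> on the interval from \<open>- t\<close> to \<open>t\<close>.\<close>

lemma sine_identity:
  fixes lam t :: real assumes "0 \<le> lam" and t: "0 < t"
  shows "(LINT s|lborel. sin (t * s) / s * (lam / (s\<^sup>2 + lam))) = pi * (1 - exp (- sqrt lam * t))"
proof (cases "lam = 0")
  case False
  define a where "a = sqrt lam"
  have a: "0 < a" "a\<^sup>2 = lam" using assms False by (auto simp: a_def)
  let ?g = "exponential_density a"
  let ?M = "density lborel ?g"
  let ?q = "\<lambda>s. sin (t * s) / s * (lam / (s\<^sup>2 + lam))"
  have g0: "0 \<le> ?g x" for x using a by (simp add: exponential_density_def)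
  interpret P: prob_space ?M by (rule prob_space_exponential_density[OF a(1)])
  interpret RD: real_distribution ?M by unfold_locales simp
  \<comment> \<open>The inversion formula recovers the measure of an interval whose ends are not
    atoms.\<close>
  have pt: "measure ?M {x} = 0" for x
  proof -
    have "emeasure ?M {x} = (\<integral>\<^sup>+y. ennreal (?g y) * indicator {x} y \<partial>lborel)" by (simp add: emeasure_density)
    also have "\<dots> = 0" by (subst nn_integral_indicator_singleton) auto
    finally show ?thesis by (simp add: measure_def)
  qed
  have m: "measure ?M {-t<..t} = 1 - exp (- t * a)"
  proof -
    have D: "distributed ?M lborel (\<lambda>x. x) ?g"
      unfolding distributed_def by (auto simp: distr_id2 g0)
    have "measure ?M {..t} = 1 - exp (- t * a)"
      using P.exponential_distributedD_le[OF D less_imp_le[OF t] a(1)] by (simp add: atMost_def)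
    moreover have "measure ?M {..-t} = 0"
    proof -
      have "emeasure ?M {..-t} = (\<integral>\<^sup>+y. ennreal (?g y) * indicator {..-t} y \<partial>lborel)" by (simp add: emeasure_density)
      also have "\<dots> = (\<integral>\<^sup>+(y::real). 0 \<partial>lborel)"
        using t by (intro nn_integral_cong) (auto simp: indicator_def exponential_density_def)
      finally show ?thesis by (simp add: measure_def)
    qed
    moreover have "measure ?M ({..t} - {..-t}) = measure ?M {..t} - measure ?M {..-t}"
      using t by (intro P.finite_measure_Diff) auto
    moreover have "{..t} - {..-t} = {-t<..t}" by auto
    ultimately show ?thesis by simp
  qed
  let ?F = "\<lambda>s. (iexp (- (s * (- t))) - iexp (- (s * t))) / (\<i> * s) * char ?M s"
  \<comment> \<open>At \<open>s = 0\<close> both sides are 0, because division by zero gives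
    0.\<close>
  have ReF: "Re (?F s) = 2 * ?q s" for s
  proof (cases "s = 0")
    case False
    have e: "iexp (s * t) - iexp (- (s * t)) = 2 * \<i> * sin (t * s)"
      by (simp add: complex_eq_iff Re_exp Im_exp mult.commute)
    have n: "a - \<i> * s \<noteq> 0" using a by (auto simp: complex_eq_iff)
    have "a / (a - \<i> * s) = a * (a + \<i> * s) / ((a - \<i> * s) * (a + \<i> * s))"
    proof -
      have "a + \<i> * s \<noteq> 0" using a by (auto simp: complex_eq_iff)
      then show ?thesis by simp
    qed
    also have "(a - \<i> * s) * (a + \<i> * s) = complex_of_real (s\<^sup>2 + lam)"
      unfolding a(2)[symmetric] by (simp add: algebra_simps power2_eq_square complex_eq_iff)
    finally have ch: "char ?M s = a * (a + \<i> * s) / complex_of_real (s\<^sup>2 + lam)"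
      by (simp add: char_exponential[OF a(1)])
    have "?F s = complex_of_real (2 * sin (t * s) / s) * (a * (a + \<i> * s) / complex_of_real (s\<^sup>2 + lam))"
      using False e unfolding ch by (simp add: field_simps)
    also have "\<dots> = complex_of_real (2 * sin (t * s) / s / (s\<^sup>2 + lam)) * (a * (a + \<i> * s))" by simp
    finally have F: "?F s = complex_of_real (2 * sin (t * s) / s / (s\<^sup>2 + lam)) * (a * (a + \<i> * s))" .
    have "Re (?F s) = 2 * sin (t * s) / s / (s\<^sup>2 + lam) * Re (a * (a + \<i> * s))"
      unfolding F by (simp only: times_complex.sel(1) Re_complex_of_real Im_complex_of_real mult_zero_left diff_zero)
    then have "Re (?F s) = 2 * sin (t * s) / s / (s\<^sup>2 + lam) * (a * a)" by simp
    then show ?thesis using a(2) by (simp add: power2_eq_square)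
  qed simp
  have lev: "(\<lambda>T. 1 / (2 * pi) * (CLBINT s=-real T..real T. ?F s)) \<longlonglongrightarrow> complex_of_real (measure ?M {-t<..t})"
    using RD.Levy_Inversion[of "-t" t] t pt by simp
  have Fm: "?F \<in> borel_measurable lborel" by measurable
  have Fb: "norm (?F s) \<le> 2 * t" for s
  proof (cases "s = 0")
    case False
    have "cmod ((iexp (s * t) - iexp (s * (- t))) / (\<i> * s)) \<le> t - (- t)"
      by (rule Levy_Inversion_aux2) (use t False in auto)
    then have "norm (?F s) \<le> (2 * t) * 1"
      unfolding norm_mult using RD.cmod_char_le_1[of s] t by (intro mult_mono) auto
    then show ?thesis by simp
  qed (use t in simp)
  have "Re (CLBINT s=-real T..real T. ?F s) = (LINT s|lborel. indicator (einterval (-real T) (real T)) s * (2 * ?q s))" for T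
  proof -
    have i: "integrable lborel (\<lambda>s. indicator (einterval (-real T) (real T)) s *\<^sub>R ?F s)"
      by (rule integrableI_bounded_set_indicator[where B = "2 * t"]) (use Fm Fb in auto)
    have "(CLBINT s=-real T..real T. ?F s) = (LINT s|lborel. indicator (einterval (-real T) (real T)) s *\<^sub>R ?F s)"
      by (simp add: interval_lebesgue_integral_def set_lebesgue_integral_def)
    then have "Re (CLBINT s=-real T..real T. ?F s) = (LINT s|lborel. Re (indicator (einterval (-real T) (real T)) s *\<^sub>R ?F s))"
      using integral_Re[OF i] by simp
    then show ?thesis by (simp only: scaleR_complex.sel ReF)
  qed
  then have lim1: "(\<lambda>T. 1 / (2 * pi) * (LINT s|lborel. indicator (einterval (-real T) (real T)) s * (2 * ?q s)))
     \<longlonglongrightarrow> measure ?M {-t<..t}"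
    using tendsto_Re[OF lev] by simp
  \<comment> \<open>The inversion formula gives a limit over symmetric intervals;
    \<open>sine_kernel_integrable\<close> identifies it with the integral over the line.\<close>
  have "(\<lambda>T. LINT s|lborel. indicator (einterval (-real T) (real T)) s * (2 * ?q s)) \<longlonglongrightarrow> (LINT s|lborel. 2 * ?q s)"
  proof (rule integral_dominated_convergence[where w = "\<lambda>s. \<bar>2 * ?q s\<bar>"])
    show "integrable lborel (\<lambda>s. \<bar>2 * ?q s\<bar>)"
      using sine_kernel_integrable[OF assms(1), of t] by (intro integrable_abs integrable_mult_right)
    show "AE s in lborel. (\<lambda>T. indicator (einterval (-real T) (real T)) s * (2 * ?q s)) \<longlonglongrightarrow> 2 * ?q s"
    proof (rule AE_I2)
      fix s :: real
      obtain N :: nat where N: "\<bar>s\<bar> < real N" using reals_Archimedean2 by blast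
      have "\<forall>\<^sub>F T in sequentially. indicator (einterval (-real T) (real T)) s * (2 * ?q s) = 2 * ?q s"
        using eventually_ge_at_top[of N]
      proof eventually_elim
        case (elim T)
        then have "\<bar>s\<bar> < real T" using N by linarith
        then show ?case by (auto simp: einterval_def indicator_def)
      qed
      then show "(\<lambda>T. indicator (einterval (-real T) (real T)) s * (2 * ?q s)) \<longlonglongrightarrow> 2 * ?q s"
        by (rule tendsto_eventually)
    qed
    show "AE s in lborel. norm (indicator (einterval (-real T) (real T)) s * (2 * ?q s)) \<le> \<bar>2 * ?q s\<bar>" for T
      by (intro AE_I2) (auto simp: indicator_def)
  qed measurable
  then have "(\<lambda>T. 1 / (2 * pi) * (LINT s|lborel. indicator (einterval (-real T) (real T)) s * (2 * ?q s)))
     \<longlonglongrightarrow> 1 / (2 * pi) * (LINT s|lborel. 2 * ?q s)" by (intro tendsto_intros)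
  then have "1 / (2 * pi) * (LINT s|lborel. 2 * ?q s) = 1 - exp (- t * a)"
    using LIMSEQ_unique[OF _ lim1] m by simp
  moreover have "(LINT s|lborel. 2 * ?q s) = 2 * (LINT s|lborel. ?q s)" by (rule integral_mult_right_zero)
  ultimately have "(LINT s|lborel. ?q s) = pi * (1 - exp (- t * a))" by (simp add: field_simps)
  then show ?thesis by (simp add: a_def mult.commute)
qed simp

text \<open>Applied with \<open>g n\<close> the product of the coefficients of two functions with disjoint supports: the
  sum of the \<open>g n\<close> then vanishes, which removes the non-integrable part of the sine representation.\<close>

lemma subordination_bound:
  fixes lam g :: "nat \<Rightarrow> real" and t :: real
  assumes lam: "\<And>n. 0 \<le> lam n" and t: "0 < t"
    and sm: "summable (\<lambda>n. (1 + lam n) * \<bar>g n\<bar>)"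
    and g0: "g sums 0"
    and L: "\<And>s. s \<noteq> 0 \<Longrightarrow> (\<lambda>n. g n / (s\<^sup>2 + lam n)) sums L \<bar>s\<bar>"
    and H: "\<And>s. 0 < s \<Longrightarrow> s\<^sup>2 * \<bar>L s\<bar> \<le> H s" and Hm: "H \<in> borel_measurable borel"
    and HI: "(\<integral>\<^sup>+s\<in>{0..}. ennreal (H s) \<partial>lborel) \<le> ennreal K" and K: "0 \<le> K"
  shows "summable (\<lambda>n. exp (- sqrt (lam n) * t) * g n)" "\<bar>\<Sum>n. exp (- sqrt (lam n) * t) * g n\<bar> \<le> t * K"
proof -
  let ?q = "\<lambda>n s. sin (t * s) / s * (lam n / (s\<^sup>2 + lam n))"
  have sg: "summable (\<lambda>n. \<bar>g n\<bar>)"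
  proof (rule summable_comparison_test[OF _ sm])
    have "norm \<bar>g n\<bar> \<le> (1 + lam n) * \<bar>g n\<bar>" for n
      using mult_right_mono[of 1 "1 + lam n" "\<bar>g n\<bar>"] lam[of n] by simp
    then show "\<exists>N. \<forall>n\<ge>N. norm \<bar>g n\<bar> \<le> (1 + lam n) * \<bar>g n\<bar>" by blast
  qed
  have e1: "exp (- sqrt (lam n) * t) \<le> 1" for n using lam[of n] t by simp
  show se: "summable (\<lambda>n. exp (- sqrt (lam n) * t) * g n)"
  proof (rule summable_comparison_test[OF _ sg])
    show "\<exists>N. \<forall>n\<ge>N. norm (exp (- sqrt (lam n) * t) * g n) \<le> \<bar>g n\<bar>"
      using e1 by (auto simp: abs_mult mult_left_le_one_le)
  qed
  define S where "S = (\<Sum>n. exp (- sqrt (lam n) * t) * g n)"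
  let ?c = "\<Sum>n. (1 + lam n) * \<bar>g n\<bar>"
  let ?f = "\<lambda>N s. \<Sum>n<N. g n * ?q n s"
  let ?lim = "\<lambda>s. - (s * sin (t * s) * L \<bar>s\<bar>)"
  have f_int: "integrable lborel (?f N)" for N
    by (intro Bochner_Integration.integrable_sum integrable_mult_right sine_kernel_integrable lam)
  \<comment> \<open>Since \<open>lam n / (s\<^sup>2 + lam n) = 1 - s\<^sup>2 / (s\<^sup>2 + lam
    n)\<close> and the \<open>g n\<close> sum to 0, only the resolvent series remains.\<close>
  have pw: "(\<lambda>N. ?f N s) \<longlonglongrightarrow> ?lim s" if s: "s \<noteq> 0" for s
  proof -
    have "(\<lambda>n. sin (t * s) / s * (g n - s\<^sup>2 * (g n / (s\<^sup>2 + lam n)))) sums (sin (t * s) / s * (0 - s\<^sup>2 * L \<bar>s\<bar>))"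
      by (intro sums_mult sums_diff g0 L s)
    moreover have "sin (t * s) / s * (g n - s\<^sup>2 * (g n / (s\<^sup>2 + lam n))) = g n * ?q n s" for n
    proof -
      have "s\<^sup>2 + lam n \<noteq> 0" using s lam[of n] by (metis add_nonneg_eq_0_iff power2_eq_square mult_eq_0_iff zero_le_power2)
      then have "g n - s\<^sup>2 * (g n / (s\<^sup>2 + lam n)) = g n * (lam n / (s\<^sup>2 + lam n))" by (simp add: field_simps)
      then show ?thesis by simp
    qed
    moreover have "sin (t * s) / s * (0 - s\<^sup>2 * L \<bar>s\<bar>) = ?lim s" using s by (simp add: power2_eq_square)
    ultimately show ?thesis by (simp add: sums_def)
  qed
  \<comment> \<open>Measurability is inherited from the partial sums: off 0 the function is their
    limit, and at 0 it vanishes.\<close>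
  have lim_meas: "?lim \<in> borel_measurable lborel"
  proof -
    let ?l = "\<lambda>s. if s = 0 then 0 else lim (\<lambda>N. ?f N s)"
    have "?l \<in> borel_measurable lborel" using lam by measurable
    moreover have "?l = ?lim" using pw by (auto simp: fun_eq_iff limI)
    ultimately show ?thesis by simp
  qed
  have fb: "\<bar>?f N s\<bar> \<le> t * ?c * (1 / (1 + s\<^sup>2))" for N s
  proof -
    have "\<bar>?f N s\<bar> \<le> (\<Sum>n<N. \<bar>g n * ?q n s\<bar>)" by (rule sum_abs)
    also have "\<dots> \<le> (\<Sum>n<N. (1 + lam n) * \<bar>g n\<bar> * (t * (1 / (1 + s\<^sup>2))))"
    proof (rule sum_mono)
      fix n
      have "\<bar>?q n s\<bar> = \<bar>sin (t * s) / s\<bar> * (lam n / (s\<^sup>2 + lam n))" using lam[of n] by (simp add: abs_mult)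
      also have "\<dots> \<le> \<bar>t\<bar> * ((1 + lam n) * (1 / (1 + s\<^sup>2)))"
        using lam[of n] by (intro mult_mono abs_sin_div_le rational_le_lorentz) auto
      finally have "\<bar>g n\<bar> * \<bar>?q n s\<bar> \<le> \<bar>g n\<bar> * (\<bar>t\<bar> * ((1 + lam n) * (1 / (1 + s\<^sup>2))))" by (intro mult_left_mono) auto
      then show "\<bar>g n * ?q n s\<bar> \<le> (1 + lam n) * \<bar>g n\<bar> * (t * (1 / (1 + s\<^sup>2)))"
        using t by (simp add: abs_mult mult_ac)
    qed
    also have "\<dots> = (\<Sum>n<N. (1 + lam n) * \<bar>g n\<bar>) * (t * (1 / (1 + s\<^sup>2)))" by (rule sum_distrib_right[symmetric])
    also have "\<dots> \<le> ?c * (t * (1 / (1 + s\<^sup>2)))"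
      using t lam by (intro mult_right_mono sum_le_suminf sm) auto
    finally show ?thesis by (simp add: mult_ac)
  qed
  have n0: "AE s in lborel. s \<noteq> (0::real)" by (rule AE_lborel_singleton)
  have c: "(\<lambda>N. LINT s|lborel. ?f N s) \<longlonglongrightarrow> (LINT s|lborel. ?lim s)"
  proof (rule integral_dominated_convergence[where w = "\<lambda>s. t * ?c * (1 / (1 + s\<^sup>2))"])
    show "integrable lborel (\<lambda>s::real. t * ?c * (1 / (1 + s\<^sup>2)))" by (intro integrable_mult_right lorentz_integrable)
    show "AE s in lborel. (\<lambda>N. ?f N s) \<longlonglongrightarrow> ?lim s" using n0 by eventually_elim (rule pw)
    show "AE s in lborel. norm (?f N s) \<le> t * ?c * (1 / (1 + s\<^sup>2))" for N using fb by (intro AE_I2) simp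
  qed (use lim_meas f_int in auto)
  have "(LINT s|lborel. ?f N s) = pi * ((\<Sum>n<N. g n) - (\<Sum>n<N. exp (- sqrt (lam n) * t) * g n))" for N
  proof -
    have "(LINT s|lborel. ?f N s) = (\<Sum>n<N. LINT s|lborel. g n * ?q n s)"
      by (intro Bochner_Integration.integral_sum integrable_mult_right sine_kernel_integrable lam)
    also have "\<dots> = (\<Sum>n<N. g n * (pi * (1 - exp (- sqrt (lam n) * t))))"
      by (intro sum.cong refl) (simp only: integral_mult_right_zero sine_identity[OF lam t])
    also have "\<dots> = pi * ((\<Sum>n<N. g n) - (\<Sum>n<N. exp (- sqrt (lam n) * t) * g n))"
      by (simp add: sum_distrib_left sum_subtractf algebra_simps)
    finally show ?thesis .
  qed
  moreover have "(\<lambda>N. pi * ((\<Sum>n<N. g n) - (\<Sum>n<N. exp (- sqrt (lam n) * t) * g n))) \<longlonglongrightarrow> pi * (0 - S)"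
    using g0 summable_sums[OF se] unfolding sums_def S_def by (intro tendsto_intros)
  ultimately have eq: "(LINT s|lborel. ?lim s) = - (pi * S)" using LIMSEQ_unique[OF c] by simp
  have "ennreal \<bar>LINT s|lborel. ?lim s\<bar> \<le> (\<integral>\<^sup>+s. ennreal (t * H \<bar>s\<bar>) \<partial>lborel)"
  proof -
    have i: "integrable lborel ?lim"
    proof (rule Bochner_Integration.integrable_bound[where f = "\<lambda>s. t * ?c * (1 / (1 + s\<^sup>2))"])
      show "integrable lborel (\<lambda>s::real. t * ?c * (1 / (1 + s\<^sup>2)))" by (intro integrable_mult_right lorentz_integrable)
      show "AE s in lborel. norm (?lim s) \<le> norm (t * ?c * (1 / (1 + s\<^sup>2)))"
        using n0
      proof eventually_elim
        case (elim s)
        have "\<bar>?lim s\<bar> \<le> t * ?c * (1 / (1 + s\<^sup>2))"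
          by (rule LIMSEQ_le_const2[OF tendsto_rabs[OF pw[OF elim]]]) (use fb in auto)
        from order.trans[OF this abs_ge_self] show ?case by (simp only: real_norm_def)
      qed
    qed (rule lim_meas)
    have "ennreal \<bar>LINT s|lborel. ?lim s\<bar> \<le> (\<integral>\<^sup>+s. ennreal (norm (?lim s)) \<partial>lborel)"
      using integral_norm_bound_ennreal[OF i] by simp
    also have "\<dots> \<le> (\<integral>\<^sup>+s. ennreal (t * H \<bar>s\<bar>) \<partial>lborel)"
    proof (rule nn_integral_mono_AE)
      show "AE s in lborel. ennreal (norm (?lim s)) \<le> ennreal (t * H \<bar>s\<bar>)"
        using n0
      proof eventually_elim
        case (elim s)
        \<comment> \<open>This bound produces the factor \<open>t\<close> of the claim and the
          second factor of \<open>s\<close> in the hypothesis on \<open>H\<close>.\<close>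
        have "\<bar>sin (t * s)\<bar> \<le> t * \<bar>s\<bar>" using abs_sin_x_le_abs_x[of "t * s"] t by (simp add: abs_mult)
        then have "norm (?lim s) \<le> \<bar>s\<bar> * (t * \<bar>s\<bar>) * \<bar>L \<bar>s\<bar>\<bar>"
          by (simp add: abs_mult mult_left_mono mult_right_mono)
        also have "\<dots> = t * (\<bar>s\<bar>\<^sup>2 * \<bar>L \<bar>s\<bar>\<bar>)" by (simp add: power2_eq_square mult_ac del: power2_abs abs_mult_self_eq)
        also have "\<dots> \<le> t * H \<bar>s\<bar>" using H[of "\<bar>s\<bar>"] elim t by (intro mult_left_mono) auto
        finally show ?case by (rule ennreal_leI)
      qed
    qed
    finally show ?thesis .
  qed
  also have "\<dots> \<le> 2 * (\<integral>\<^sup>+s\<in>{0..}. ennreal (t * H s) \<partial>lborel)"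
    using Hm by (intro nn_integral_abs_real[of "\<lambda>s. ennreal (t * H s)"]) measurable
  also have "\<dots> = 2 * (ennreal t * (\<integral>\<^sup>+s\<in>{0..}. ennreal (H s) \<partial>lborel))"
    using Hm t by (subst nn_integral_cmult[symmetric]) (auto simp: ennreal_mult' mult.assoc intro!: nn_integral_cong)
  also have "\<dots> \<le> 2 * (ennreal t * ennreal K)" by (intro mult_left_mono HI) auto
  also have "\<dots> = ennreal (2 * (t * K))" using t K by (simp add: ennreal_mult)
  finally have "\<bar>LINT s|lborel. ?lim s\<bar> \<le> 2 * (t * K)" using t K by (simp add: ennreal_le_iff)
  then have "pi * \<bar>S\<bar> \<le> 2 * (t * K)" unfolding eq by (simp add: abs_mult)
  \<comment> \<open>The factor 2 from folding the line onto the half line is absorbed by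
    \<open>pi\<close>.\<close>
  moreover have "2 * \<bar>S\<bar> \<le> pi * \<bar>S\<bar>" using pi_ge_two by (intro mult_right_mono) auto
  ultimately show "\<bar>\<Sum>n. exp (- sqrt (lam n) * t) * g n\<bar> \<le> t * K" by (simp add: S_def)
qed

section \<open>Poisson kernel estimates\<close>

context pcf_eigen
begin

text \<open>\<open>gam\<close> is the decay exponent of the Poisson kernel in space, and \<open>t powr bet\<close> is the spatial scale
  \<open>\<epsilon>\<close> that belongs to time \<open>t\<close>, given by \<open>\<epsilon> powr (d + 1) = t\<^sup>2\<close>.\<close>

definition gam :: real where "gam = (3 * d + 1) / 2"
definition bet :: real where "bet = 2 / (d + 1)"

lemma gam_pos: "0 < gam" and bet_pos: "0 < bet" and bet_less_2: "bet < 2"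
  and gam_bet: "(3 - bet) / bet = gam"
  using d_pos by (auto simp: gam_def bet_def field_simps)

section \<open>The bilinear bound for disjoint supports\<close>

abbreviation nrm :: "('a \<Rightarrow> real) \<Rightarrow> real" where "nrm f \<equiv> LINT x|\<mu>. \<bar>f x\<bar>"

lemma ip_bound:
  assumes "continuous_on UNIV w" "continuous_on UNIV h" "\<And>y. h y \<noteq> 0 \<Longrightarrow> \<bar>w y\<bar> \<le> b"
  shows "\<bar>ip w h\<bar> \<le> b * nrm h"
proof -
  have "\<bar>ip w h\<bar> \<le> (LINT y|\<mu>. \<bar>w y * h y\<bar>)" by (rule integral_abs_bound)
  also have "\<dots> \<le> (LINT y|\<mu>. b * \<bar>h y\<bar>)"
  proof (intro integral_mono)
    show "integrable \<mu> (\<lambda>y. \<bar>w y * h y\<bar>)" "integrable \<mu> (\<lambda>y. b * \<bar>h y\<bar>)"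
      using assms(1,2) by (auto intro!: cont_int continuous_intros)
    show "\<bar>w y * h y\<bar> \<le> b * \<bar>h y\<bar>" for y
      using assms(3)[of y] by (cases "h y = 0") (auto simp: abs_mult intro!: mult_right_mono)
  qed
  finally show ?thesis by simp
qed

text \<open>Between frequency 1 and \<open>s0\<close> resolvents are estimated without decay, since
  the decay factor \<open>C * kappa (s\<^sup>2) / \<rho>\<close> is at least 1 there; beyond
  \<open>s0\<close> a fixed number of decay steps makes the integrand integrable. Each of these
  ranges contributes at most a multiple of \<open>s0 powr (3 - bet)\<close>, which is
  \<open>\<rho> powr (- gam)\<close> up to a constant; frequencies below 1 contribute a
  constant.\<close>

lemma pair_bound:
  obtains C Q where "0 < C" "1 \<le> Q"
    "\<And>f h x \<rho> t. f \<in> Fb \<Longrightarrow> h \<in> Fb \<Longrightarrow> 0 < \<rho> \<Longrightarrow> \<rho> \<le> D0 \<Longrightarrow> 0 < t \<Longrightarrow>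
       \<forall>y. \<rho> \<le> R x y \<longrightarrow> f y = 0 \<Longrightarrow> \<forall>y. R x y < Q * \<rho> \<longrightarrow> h y = 0 \<Longrightarrow>
       summable (\<lambda>n. exp (- sqrt (lam n) * t) * (coef f n * coef h n)) \<and>
       \<bar>\<Sum>n. exp (- sqrt (lam n) * t) * (coef f n * coef h n)\<bar> \<le> t * (C * \<rho> powr (- gam) * (nrm f * nrm h))"
proof -
  obtain C Q where C: "0 < C" and Q: "1 \<le> Q" and dec:
    "\<And>f \<sigma> x \<rho>. f \<in> Fb \<Longrightarrow> 0 < \<sigma> \<Longrightarrow> 0 < \<rho> \<Longrightarrow> \<forall>y. \<rho> \<le> R x y \<longrightarrow> f y = 0 \<Longrightarrow>
       \<exists>w\<in>Fb. (\<forall>v\<in>Fb. (\<lambda>n. coef f n * coef v n / (\<sigma> + lam n)) sums ip w v) \<and>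
         (\<forall>k y. (k = 0 \<or> Q ^ k * \<rho> \<le> R x y) \<longrightarrow>
            (w y)\<^sup>2 \<le> (C * kappa \<sigma> / \<rho>) ^ k * (C * kappa \<sigma> * (LINT x|\<mu>. \<bar>f x\<bar>))\<^sup>2)"
    by (rule resolvent_decay) (rule that)
  \<comment> \<open>With this \<open>j\<close> the exponent in \<open>G3\<close> is less than -2.
    The decay estimate concerns the square of the resolvent, so \<open>2 * j\<close> steps yield the
    decay factor to the power \<open>j\<close>.\<close>
  obtain j :: nat where "4 / bet < real j" using reals_Archimedean2 by blast
  then have j: "4 < bet * real j" using bet_pos by (simp add: field_simps)
  let ?Q = "Q ^ (2 * j)"
  \<comment> \<open>\<open>D0 powr gam\<close> absorbs the contribution of low frequencies, because
    \<rho> is at most \<open>D0\<close>.\<close>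
  define C' where "C' = C * (D0 powr gam + 2 * C powr gam)"
  have C': "0 < C'" using C D0(1) by (auto simp: C'_def intro!: mult_pos_pos add_pos_pos)
  show ?thesis
  proof (rule that[OF C' one_le_power[OF Q, of "2 * j"]])
    fix f h x and \<rho> t :: real
    assume f: "f \<in> Fb" and h: "h \<in> Fb" and \<rho>: "0 < \<rho>" "\<rho> \<le> D0" and t: "0 < t"
      and sf: "\<forall>y. \<rho> \<le> R x y \<longrightarrow> f y = 0" and sh: "\<forall>y. R x y < ?Q * \<rho> \<longrightarrow> h y = 0"
    define s0 where "s0 = (C / \<rho>) powr (1 / bet)"
    have s0: "0 < s0" "s0 powr bet = C / \<rho>" using C \<rho> bet_pos by (auto simp: s0_def powr_powr)
    let ?g = "\<lambda>n. coef f n * coef h n"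
    define N where "N = nrm f * nrm h"
    have nf: "0 \<le> nrm f" and nh: "0 \<le> nrm h" by simp_all
    have N0: "0 \<le> N" using nf nh by (simp add: N_def)
    define L where "L s = (\<Sum>n. ?g n / (s\<^sup>2 + lam n))" for s
    \<comment> \<open>The majorant on three frequency ranges: below 1, where
      \<open>s\<^sup>2 * kappa (s\<^sup>2)\<close> is 1; up to \<open>s0\<close>, without decay; and
      beyond \<open>s0\<close>, with decay.\<close>
    define G1 where "G1 s = indicator {0..1} s * (1::real)" for s :: real
    define G2 where "G2 s = indicator {0..s0} s * s powr (2 - bet)" for s
    define G3 where "G3 s = indicator {s0..} s * (s0 powr (bet * j) * s powr (2 - bet - bet * j))" for s
    have G0: "0 \<le> G1 s" "0 \<le> G2 s" "0 \<le> G3 s" for s by (auto simp: G1_def G2_def G3_def)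
    define H where "H s = N * C * (G1 s + G2 s + G3 s)" for s
    have fh0: "f y * h y = 0" for y
    proof (cases "\<rho> \<le> R x y")
      case False
      then have "R x y < ?Q * \<rho>" using one_le_power[OF Q, of "2 * j"] \<rho> mult_right_mono[of 1 ?Q \<rho>] by linarith
      then show ?thesis using sh by simp
    qed (simp add: sf)
    have sm: "summable (\<lambda>n. (1 + lam n) * \<bar>?g n\<bar>)"
    proof (rule summable_comparison_test[OF _ summable_add[OF coef_summable[OF f] coef_summable[OF h]]])
      have "norm ((1 + lam n) * \<bar>?g n\<bar>) \<le> (1 + lam n) * (coef f n)\<^sup>2 + (1 + lam n) * (coef h n)\<^sup>2" for n
      proof -
        have "2 * (\<bar>coef f n\<bar> * \<bar>coef h n\<bar>) \<le> (coef f n)\<^sup>2 + (coef h n)\<^sup>2"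
          using sum_squares_bound[of "\<bar>coef f n\<bar>" "\<bar>coef h n\<bar>"] by (simp add: mult.assoc)
        moreover have "0 \<le> \<bar>coef f n\<bar> * \<bar>coef h n\<bar>" by simp
        ultimately have "\<bar>?g n\<bar> \<le> (coef f n)\<^sup>2 + (coef h n)\<^sup>2" unfolding abs_mult by linarith
        then have "(1 + lam n) * \<bar>?g n\<bar> \<le> (1 + lam n) * ((coef f n)\<^sup>2 + (coef h n)\<^sup>2)"
          using lam_nonneg[of n] by (intro mult_left_mono) auto
        then show ?thesis using lam_nonneg[of n] by (simp add: distrib_left)
      qed
      then show "\<exists>N. \<forall>n\<ge>N. norm ((1 + lam n) * \<bar>?g n\<bar>) \<le> (1 + lam n) * (coef f n)\<^sup>2 + (1 + lam n) * (coef h n)\<^sup>2" by blast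
    qed
    have g0: "?g sums 0"
    proof -
      have "ip f h = (LINT y|\<mu>. 0)" by (intro Bochner_Integration.integral_cong refl fh0)
      then show ?thesis using expansion(2)[OF f h] by simp
    qed
    have Lw: "(\<lambda>n. ?g n / (s\<^sup>2 + lam n)) sums L s \<and> s\<^sup>2 * \<bar>L s\<bar> \<le> H s" if s: "0 < s" for s
    proof -
      let ?k = "kappa (s\<^sup>2)"
      have s2: "0 < s\<^sup>2" using s by simp
      obtain w where w: "w \<in> Fb" "\<forall>v\<in>Fb. (\<lambda>n. coef f n * coef v n / (s\<^sup>2 + lam n)) sums ip w v"
        "\<forall>k y. (k = 0 \<or> Q ^ k * \<rho> \<le> R x y) \<longrightarrow> (w y)\<^sup>2 \<le> (C * ?k / \<rho>) ^ k * (C * ?k * nrm f)\<^sup>2"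
        using dec[OF f s2 \<rho>(1) sf] by (elim bexE conjE) (rule that)
      have ws: "(\<lambda>n. ?g n / (s\<^sup>2 + lam n)) sums ip w h" using w(2) h by blast
      then have Le: "L s = ip w h" unfolding L_def by (rule sums_unique[symmetric])
      have kp: "0 < ?k" by (rule kappa_pos[OF s2])
      have b0: "\<bar>w y\<bar> \<le> C * ?k * nrm f" for y
      proof -
        have "(w y)\<^sup>2 \<le> (C * ?k * nrm f)\<^sup>2" using w(3)[rule_format, of 0 y] by simp
        then show ?thesis using C kp nf by (simp add: abs_le_square_iff[symmetric])
      qed
      have bj: "\<bar>w y\<bar> \<le> (C * ?k / \<rho>) ^ j * (C * ?k * nrm f)" if "h y \<noteq> 0" for y
      proof -
        have "?Q * \<rho> \<le> R x y" using sh that by (meson not_less)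
        then have "(w y)\<^sup>2 \<le> (C * ?k / \<rho>) ^ (2 * j) * (C * ?k * nrm f)\<^sup>2" using w(3) by blast
        also have "\<dots> = ((C * ?k / \<rho>) ^ j * (C * ?k * nrm f))\<^sup>2"
          by (simp add: power_mult_distrib power_mult[symmetric] mult.commute[of j 2] power_divide)
        finally show ?thesis using C kp nf \<rho> by (simp add: abs_le_square_iff[symmetric])
      qed
      have cw: "continuous_on UNIV w" and ch: "continuous_on UNIV h" using Fb_cont w(1) h by auto
      have I0: "\<bar>L s\<bar> \<le> C * ?k * nrm f * nrm h" unfolding Le by (rule ip_bound[OF cw ch b0])
      have Ij: "\<bar>L s\<bar> \<le> (C * ?k / \<rho>) ^ j * (C * ?k * nrm f) * nrm h" unfolding Le by (rule ip_bound[OF cw ch bj])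
      have "s\<^sup>2 * \<bar>L s\<bar> \<le> H s"
      proof (cases "s < 1")
        case True
        then have "s\<^sup>2 < 1" using s by (simp add: power_less_one_iff)
        then have k: "?k = 1 / s\<^sup>2" by (simp add: kappa_def)
        have "s\<^sup>2 * \<bar>L s\<bar> \<le> s\<^sup>2 * (C * ?k * nrm f * nrm h)" using I0 by (rule mult_left_mono) simp
        also have "\<dots> = N * C * 1" unfolding k N_def using s by (simp add: field_simps)
        also have "\<dots> \<le> H s" unfolding H_def
          using True s G0[of s] N0 C by (intro mult_left_mono) (auto simp: G1_def)
        finally show ?thesis .
      next
        case False
        then have "1 \<le> s\<^sup>2" by (simp add: one_le_power)
        then have "?k = (s\<^sup>2) powr (- 1 / (d + 1))" by (simp add: kappa_def)
        also have "\<dots> = s powr (2 * (- 1 / (d + 1)))" using s by (simp add: powr_powr powr_numeral[symmetric] del: powr_numeral)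
        also have "2 * (- 1 / (d + 1)) = - bet" by (simp add: bet_def)
        finally have k: "?k = s powr (- bet)" .
        have sp: "s\<^sup>2 * s powr e = s powr (2 + e)" for e using s by (simp add: powr_add powr_numeral)
        show ?thesis
        proof (cases "s \<le> s0")
          case True
          have "s\<^sup>2 * \<bar>L s\<bar> \<le> s\<^sup>2 * (C * ?k * nrm f * nrm h)" using I0 by (rule mult_left_mono) simp
          also have "\<dots> = N * C * (s\<^sup>2 * s powr (- bet))" unfolding k N_def by simp
          also have "\<dots> = N * C * s powr (2 - bet)" by (simp add: sp)
          also have "\<dots> \<le> H s" unfolding H_def
            using True s G0[of s] N0 C by (intro mult_left_mono) (auto simp: G2_def)
          finally show ?thesis .
        next
          case False
          have "C * ?k / \<rho> = s0 powr bet * s powr (- bet)" unfolding k s0(2) by simp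
          then have pw: "(C * ?k / \<rho>) ^ j = s0 powr (bet * j) * s powr (- (bet * j))"
            using s s0(1) by (simp add: power_mult_distrib powr_power mult.commute)
          have "s\<^sup>2 * \<bar>L s\<bar> \<le> s\<^sup>2 * ((C * ?k / \<rho>) ^ j * (C * ?k * nrm f) * nrm h)" using Ij by (rule mult_left_mono) simp
          also have "\<dots> = N * C * (s0 powr (bet * j) * (s\<^sup>2 * s powr (- bet) * s powr (- (bet * j))))"
            unfolding pw unfolding k N_def by simp
          also have "s\<^sup>2 * s powr (- bet) * s powr (- (bet * j)) = s powr (2 - bet - bet * j)"
            unfolding sp using s by (simp add: powr_add[symmetric])
          also have "N * C * (s0 powr (bet * j) * s powr (2 - bet - bet * j)) \<le> H s" unfolding H_def
            using False s G0[of s] N0 C by (intro mult_left_mono) (auto simp: G3_def)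
          finally show ?thesis .
        qed
      qed
      then show ?thesis using ws Le by simp
    qed
    have Ls: "(\<lambda>n. ?g n / (s\<^sup>2 + lam n)) sums L \<bar>s\<bar>" if "s \<noteq> 0" for s
      using Lw[of "\<bar>s\<bar>"] that by simp
    have Hs: "s\<^sup>2 * \<bar>L s\<bar> \<le> H s" if "0 < s" for s using Lw[OF that] by simp
    have Gm [measurable]: "G1 \<in> borel_measurable borel" "G2 \<in> borel_measurable borel" "G3 \<in> borel_measurable borel"
      unfolding G1_def[abs_def] G2_def[abs_def] G3_def[abs_def] by measurable
    have Hm: "H \<in> borel_measurable borel" unfolding H_def[abs_def] by measurable
    let ?K = "N * C * (1 + 2 * s0 powr (3 - bet))"
    have K0: "0 \<le> ?K" using N0 C by simp
    have i1: "(\<integral>\<^sup>+s. ennreal (G1 s) \<partial>lborel) = ennreal 1"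
      unfolding G1_def by (simp add: ennreal_indicator)
    have i2: "(\<integral>\<^sup>+s. ennreal (G2 s) \<partial>lborel) \<le> ennreal (s0 powr (3 - bet))"
    proof -
      have "((\<lambda>s. s powr (2 - bet)) has_integral (s0 powr (2 - bet + 1) / (2 - bet + 1))) {0..s0}"
        using bet_less_2 s0 by (intro has_integral_powr_from_0) auto
      then have "(\<integral>\<^sup>+s. ennreal (G2 s) \<partial>lborel) = ennreal (s0 powr (2 - bet + 1) / (2 - bet + 1))"
        unfolding G2_def by (intro nn_integral_has_integral_lebesgue) auto
      also have "\<dots> \<le> ennreal (s0 powr (3 - bet))"
      proof (rule ennreal_leI)
        have "s0 powr (3 - bet) * 1 \<le> s0 powr (3 - bet) * (3 - bet)" using bet_less_2 by (intro mult_left_mono) auto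
        then show "s0 powr (2 - bet + 1) / (2 - bet + 1) \<le> s0 powr (3 - bet)" using bet_less_2 by (simp add: field_simps)
      qed
      finally show ?thesis .
    qed
    have i3: "(\<integral>\<^sup>+s. ennreal (G3 s) \<partial>lborel) \<le> ennreal (s0 powr (3 - bet))"
    proof -
      define e where "e = 2 - bet - bet * real j"
      have e: "e < -1" "1 \<le> - (e + 1)" using j bet_pos by (auto simp: e_def)
      have "((\<lambda>s. s powr e) has_integral (- (s0 powr (e + 1)) / (e + 1))) {s0..}"
        by (rule has_integral_powr_to_inf[OF e(1) s0(1)])
      then have "((\<lambda>s. s0 powr (bet * j) * s powr e) has_integral (s0 powr (bet * j) * (- (s0 powr (e + 1)) / (e + 1)))) {s0..}"
        by (rule has_integral_mult_right)
      then have "(\<integral>\<^sup>+s. ennreal (G3 s) \<partial>lborel) = ennreal (s0 powr (bet * j) * (- (s0 powr (e + 1)) / (e + 1)))"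
        unfolding G3_def e_def[symmetric] by (intro nn_integral_has_integral_lebesgue) auto
      also have "s0 powr (bet * j) * (- (s0 powr (e + 1)) / (e + 1)) = s0 powr (bet * j) * s0 powr (e + 1) / (- (e + 1))"
        by (metis minus_divide_left minus_divide_right times_divide_eq_right)
      also have "s0 powr (bet * j) * s0 powr (e + 1) = s0 powr (3 - bet)"
        by (simp add: powr_add[symmetric] e_def)
      also have "ennreal (s0 powr (3 - bet) / (- (e + 1))) \<le> ennreal (s0 powr (3 - bet))"
      proof (rule ennreal_leI)
        have "s0 powr (3 - bet) / (- (e + 1)) \<le> s0 powr (3 - bet) / 1" using e by (intro divide_left_mono) auto
        then show "s0 powr (3 - bet) / (- (e + 1)) \<le> s0 powr (3 - bet)" by simp
      qed
      finally show ?thesis .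
    qed
    have HI: "(\<integral>\<^sup>+s\<in>{0..}. ennreal (H s) \<partial>lborel) \<le> ennreal ?K"
    proof -
      have "(\<integral>\<^sup>+s\<in>{0..}. ennreal (H s) \<partial>lborel)
          \<le> (\<integral>\<^sup>+s. ennreal (N * C) * (ennreal (G1 s) + ennreal (G2 s) + ennreal (G3 s)) \<partial>lborel)"
        unfolding H_def using N0 C G0
        by (intro nn_integral_mono) (auto simp: indicator_def ennreal_mult' ennreal_plus[symmetric] simp del: ennreal_plus)
      also have "\<dots> = ennreal (N * C) * ((\<integral>\<^sup>+s. ennreal (G1 s) \<partial>lborel) + (\<integral>\<^sup>+s. ennreal (G2 s) \<partial>lborel) + (\<integral>\<^sup>+s. ennreal (G3 s) \<partial>lborel))"
        by (simp add: nn_integral_cmult nn_integral_add)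
      also have "\<dots> \<le> ennreal (N * C) * (ennreal 1 + ennreal (s0 powr (3 - bet)) + ennreal (s0 powr (3 - bet)))"
        by (intro mult_left_mono add_mono i2 i3) (simp_all add: i1)
      also have "\<dots> = ennreal ?K"
        using N0 C by (simp add: ennreal_mult'[symmetric] ennreal_plus[symmetric] del: ennreal_plus ennreal_1)
      finally show ?thesis .
    qed
    note sb = subordination_bound[OF lam_nonneg t sm g0 Ls Hs Hm HI K0]
    have "?K \<le> C' * \<rho> powr (- gam) * N"
    proof -
      have "s0 powr (3 - bet) = (C / \<rho>) powr gam" unfolding s0_def powr_powr using gam_bet by simp
      also have "\<dots> = C powr gam * \<rho> powr (- gam)" using C \<rho> by (simp add: powr_divide powr_minus_divide)
      finally have e1: "s0 powr (3 - bet) = C powr gam * \<rho> powr (- gam)" .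
      have "1 = D0 powr gam * D0 powr (- gam)" using D0(1) by (simp add: powr_minus)
      also have "\<dots> \<le> D0 powr gam * \<rho> powr (- gam)"
        using \<rho> gam_pos by (intro mult_left_mono powr_mono2') auto
      finally have "1 + 2 * s0 powr (3 - bet) \<le> (D0 powr gam + 2 * C powr gam) * \<rho> powr (- gam)"
        unfolding e1 by (simp add: distrib_right)
      then have "N * C * (1 + 2 * s0 powr (3 - bet)) \<le> N * C * ((D0 powr gam + 2 * C powr gam) * \<rho> powr (- gam))"
        using N0 C by (intro mult_left_mono) auto
      then show ?thesis by (simp add: C'_def mult_ac)
    qed
    then have "t * ?K \<le> t * (C' * \<rho> powr (- gam) * N)" using t by (intro mult_left_mono) auto
    then show "summable (\<lambda>n. exp (- sqrt (lam n) * t) * ?g n) \<and>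
       \<bar>\<Sum>n. exp (- sqrt (lam n) * t) * ?g n\<bar> \<le> t * (C' * \<rho> powr (- gam) * (nrm f * nrm h))"
      using sb order.trans unfolding N_def by blast
  qed
qed

section \<open>On-diagonal bounds and equicontinuity\<close>

lemma diag_resolvent:
  obtains C where "0 < C" "\<And>\<sigma> x N. 0 < \<sigma> \<Longrightarrow> (\<Sum>n<N. (\<phi> n x)\<^sup>2 / (\<sigma> + lam n)) \<le> C * kappa \<sigma>"
proof -
  obtain C where C: "0 < C"
    "\<And>\<sigma> u y. 0 < \<sigma> \<Longrightarrow> u \<in> Dom \<Longrightarrow> (u y)\<^sup>2 \<le> C * kappa \<sigma> * (En u u + \<sigma> * (LINT x|\<mu>. (u x)\<^sup>2))"
    by (rule sup_bound) (rule that)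
  have "(\<Sum>n<N. (\<phi> n x)\<^sup>2 / (\<sigma> + lam n)) \<le> C * kappa \<sigma>" if \<sigma>: "0 < \<sigma>" for \<sigma> x N
  proof -
    \<comment> \<open>The partial resolvent kernel with pole \<open>x\<close>: its value at
      \<open>x\<close> equals its energy plus \<sigma> times its squared L2 norm, so
      \<open>sup_bound\<close> bounds the square of this number by a multiple of the number
      itself.\<close>
    let ?c = "\<lambda>n. \<phi> n x / (\<sigma> + lam n)"
    let ?u = "comb {..<N} ?c"
    let ?s = "\<Sum>n<N. (\<phi> n x)\<^sup>2 / (\<sigma> + lam n)"
    have p: "0 < \<sigma> + lam n" for n using \<sigma> lam_nonneg[of n] by simp
    have ux: "?u x = ?s" unfolding comb_def by (intro sum.cong refl) (simp add: power2_eq_square)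
    have "(LINT x|\<mu>. (?u x)\<^sup>2) = (\<Sum>n<N. (?c n)\<^sup>2)"
      using ip_comb_self[of "{..<N}" ?c] by (simp add: power2_eq_square)
    then have "En ?u ?u + \<sigma> * (LINT x|\<mu>. (?u x)\<^sup>2) = (\<Sum>n<N. (\<sigma> + lam n) * (?c n)\<^sup>2)"
      by (simp add: En_comb_self sum_distrib_left distrib_right sum.distrib)
    also have "\<dots> = ?s"
    proof (intro sum.cong refl)
      fix n
      show "(\<sigma> + lam n) * (?c n)\<^sup>2 = (\<phi> n x)\<^sup>2 / (\<sigma> + lam n)"
        using p[of n] by (simp add: power_divide power2_eq_square)
    qed
    finally have "?s\<^sup>2 \<le> C * kappa \<sigma> * ?s"
      using C(2)[OF \<sigma> Fb_Dom[OF comb_Fb], of "{..<N}" ?c x] ux by simp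
    moreover have "0 \<le> ?s" using p by (intro sum_nonneg divide_nonneg_pos) auto
    ultimately show ?thesis
      using C(1) kappa_pos[OF \<sigma>] by (cases "?s = 0") (auto simp: power2_eq_square mult_le_cancel_right less_imp_le)
  qed
  with C(1) show ?thesis by (rule that)
qed

text \<open>Compares the Poisson semigroup with the resolvent at
  \<open>\<sigma> = 1 / t\<^sup>2\<close>, through
  \<open>exp a \<ge> (1 + a\<^sup>2) / 2\<close>.\<close>

lemma exp_sqrt_le:
  fixes l t :: real assumes "0 \<le> l" "0 < t" shows "exp (- sqrt l * t) \<le> 2 / t\<^sup>2 * (1 / (1 / t\<^sup>2 + l))"
proof -
  let ?a = "sqrt l * t"
  have a: "0 \<le> ?a" "?a\<^sup>2 = l * t\<^sup>2" using assms by (auto simp: power_mult_distrib)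
  have "1 + ?a + ?a\<^sup>2 / 2 \<le> exp ?a" by (rule exp_lower_Taylor_quadratic[OF a(1)])
  then have "(1 + l * t\<^sup>2) / 2 \<le> exp ?a" using a by simp
  moreover have "0 < (1 + l * t\<^sup>2) / 2" using assms by (simp add: add_pos_nonneg)
  ultimately have "inverse (exp ?a) \<le> inverse ((1 + l * t\<^sup>2) / 2)" by (intro le_imp_inverse_le)
  moreover have "inverse ((1 + l * t\<^sup>2) / 2) = 2 / t\<^sup>2 * (1 / (1 / t\<^sup>2 + l))"
  proof -
    have "1 / t\<^sup>2 + l = (1 + l * t\<^sup>2) / t\<^sup>2" using assms by (simp add: field_simps)
    then show ?thesis using assms by simp
  qed
  ultimately show ?thesis by (simp add: exp_minus)
qed

text \<open>The order of the bound on the diagonal; it equals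
  \<open>t powr (- 2 * d / (d + 1))\<close> for \<open>t \<le> 1\<close> and 1 for larger
  \<open>t\<close>.\<close>

definition diag_size :: "real \<Rightarrow> real" where "diag_size t = kappa (1 / t\<^sup>2) / t\<^sup>2"

lemma diag_size_pos: "0 < t \<Longrightarrow> 0 < diag_size t"
  by (simp add: diag_size_def kappa_pos)

lemma diag_partial:
  obtains C where "0 < C"
    "\<And>t x N. 0 < t \<Longrightarrow> (\<Sum>n<N. exp (- sqrt (lam n) * t) * (\<phi> n x)\<^sup>2) \<le> C * diag_size t"
proof -
  obtain C where C: "0 < C" "\<And>\<sigma> x N. 0 < \<sigma> \<Longrightarrow> (\<Sum>n<N. (\<phi> n x)\<^sup>2 / (\<sigma> + lam n)) \<le> C * kappa \<sigma>"
    by (rule diag_resolvent) (rule that)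
  have "(\<Sum>n<N. exp (- sqrt (lam n) * t) * (\<phi> n x)\<^sup>2) \<le> 2 * C * diag_size t" if t: "0 < t" for t x N
  proof -
    have "(\<Sum>n<N. exp (- sqrt (lam n) * t) * (\<phi> n x)\<^sup>2)
       \<le> (\<Sum>n<N. 2 / t\<^sup>2 * (1 / (1 / t\<^sup>2 + lam n)) * (\<phi> n x)\<^sup>2)"
      by (intro sum_mono mult_right_mono exp_sqrt_le lam_nonneg t) auto
    also have "\<dots> = 2 / t\<^sup>2 * (\<Sum>n<N. (\<phi> n x)\<^sup>2 / (1 / t\<^sup>2 + lam n))" by (simp add: sum_distrib_left)
    also have "\<dots> \<le> 2 / t\<^sup>2 * (C * kappa (1 / t\<^sup>2))" using t by (intro mult_left_mono C) auto
    finally show ?thesis by (simp add: diag_size_def)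
  qed
  with C(1) show ?thesis by (intro that[of "2 * C"]) auto
qed

abbreviation P :: "real \<Rightarrow> 'a \<Rightarrow> 'a \<Rightarrow> real" where "P \<equiv> poisson_kernel lam \<phi>"

text \<open>Partial sums belong to \<open>Fb\<close> in each variable, so the energy controls them;
  estimates uniform in \<open>N\<close> then pass to the kernel.\<close>

definition PN :: "nat \<Rightarrow> real \<Rightarrow> 'a \<Rightarrow> 'a \<Rightarrow> real" where
  "PN N t x y = (\<Sum>n<N. exp (- sqrt (lam n) * t) * \<phi> n x * \<phi> n y)"

lemma PN_comb: "PN N t x = comb {..<N} (\<lambda>n. exp (- sqrt (lam n) * t) * \<phi> n x)"
  by (simp add: PN_def comb_def fun_eq_iff)

lemma PN_sym: "PN N t x y = PN N t y x"
  by (simp add: PN_def mult_ac)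

text \<open>Absolute convergence follows from the diagonal bound by the inequality of geometric and
  arithmetic means. The last claim is equicontinuity uniform in \<open>N\<close>: since
  \<open>lam n * exp (- sqrt (lam n) * t)\<close> is at most \<open>2 / t\<^sup>2\<close>, the
  diagonal controls the energy of a partial sum, and the resistance metric turns energy into a
  Hoelder bound.\<close>

lemma kernel_diag:
  obtains C where "0 < C" "\<And>t x y N. 0 < t \<Longrightarrow> \<bar>PN N t x y\<bar> \<le> C * diag_size t"
    "\<And>t x y. 0 < t \<Longrightarrow> (\<lambda>N. PN N t x y) \<longlonglongrightarrow> P t x y"
    "\<And>t x y. 0 < t \<Longrightarrow> \<bar>P t x y\<bar> \<le> C * diag_size t"
    "\<And>t x y x' y' N. 0 < t \<Longrightarrow> \<bar>PN N t x y - PN N t x' y'\<bar> \<le>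
        sqrt (2 / t\<^sup>2 * (C * diag_size t)) * (sqrt (R x x') + sqrt (R y y'))"
proof -
  obtain C where C: "0 < C" and
    C2: "\<And>t x N. 0 < t \<Longrightarrow> (\<Sum>n<N. exp (- sqrt (lam n) * t) * (\<phi> n x)\<^sup>2) \<le> C * diag_size t"
    by (rule diag_partial) (rule that)
  have ab: "(\<Sum>n<N. \<bar>exp (- sqrt (lam n) * t) * \<phi> n x * \<phi> n y\<bar>) \<le> C * diag_size t" if t: "0 < t" for t x y N
  proof -
    let ?e = "\<lambda>n. exp (- sqrt (lam n) * t)"
    have "(\<Sum>n<N. \<bar>?e n * \<phi> n x * \<phi> n y\<bar>) \<le> (\<Sum>n<N. (?e n * (\<phi> n x)\<^sup>2 + ?e n * (\<phi> n y)\<^sup>2) / 2)"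
    proof (rule sum_mono)
      fix n
      have "2 * (\<bar>\<phi> n x\<bar> * \<bar>\<phi> n y\<bar>) \<le> (\<phi> n x)\<^sup>2 + (\<phi> n y)\<^sup>2"
        using sum_squares_bound[of "\<bar>\<phi> n x\<bar>" "\<bar>\<phi> n y\<bar>"] by (simp add: mult.assoc)
      then have "?e n * (2 * (\<bar>\<phi> n x\<bar> * \<bar>\<phi> n y\<bar>)) \<le> ?e n * ((\<phi> n x)\<^sup>2 + (\<phi> n y)\<^sup>2)" by (intro mult_left_mono) auto
      then show "\<bar>?e n * \<phi> n x * \<phi> n y\<bar> \<le> (?e n * (\<phi> n x)\<^sup>2 + ?e n * (\<phi> n y)\<^sup>2) / 2"
        by (simp add: abs_mult algebra_simps)
    qed
    also have "\<dots> = ((\<Sum>n<N. ?e n * (\<phi> n x)\<^sup>2) + (\<Sum>n<N. ?e n * (\<phi> n y)\<^sup>2)) / 2"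
      by (simp add: sum.distrib sum_divide_distrib[symmetric])
    also have "\<dots> \<le> C * diag_size t" using C2[OF t, of x N] C2[OF t, of y N] by simp
    finally show ?thesis .
  qed
  have PNb: "\<bar>PN N t x y\<bar> \<le> C * diag_size t" if "0 < t" for t x y N
    unfolding PN_def using sum_abs ab[OF that] by (rule order.trans)
  have lim: "(\<lambda>N. PN N t x y) \<longlonglongrightarrow> P t x y" if "0 < t" for t x y
  proof -
    have "summable (\<lambda>n. \<bar>exp (- sqrt (lam n) * t) * \<phi> n x * \<phi> n y\<bar>)"
      by (rule summableI_nonneg_bounded[OF _ ab[OF that]]) simp
    then have "summable (\<lambda>n. exp (- sqrt (lam n) * t) * \<phi> n x * \<phi> n y)" by (rule summable_rabs_cancel)
    then show ?thesis unfolding PN_def poisson_kernel_def by (rule summable_LIMSEQ)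
  qed
  have Pb: "\<bar>P t x y\<bar> \<le> C * diag_size t" if "0 < t" for t x y
    by (rule LIMSEQ_le_const2[OF tendsto_rabs[OF lim[OF that]]]) (use PNb[OF that] in auto)
  have eq1: "\<bar>PN N t x y - PN N t x y'\<bar> \<le> sqrt (2 / t\<^sup>2 * (C * diag_size t)) * sqrt (R y y')" if t: "0 < t" for t x y y' N
  proof -
    let ?e = "\<lambda>n. exp (- sqrt (lam n) * t)"
    let ?u = "comb {..<N} (\<lambda>n. ?e n * \<phi> n x)"
    have "En ?u ?u = (\<Sum>n<N. lam n * (?e n * \<phi> n x)\<^sup>2)" by (simp add: En_comb_self)
    also have "\<dots> \<le> (\<Sum>n<N. 2 / t\<^sup>2 * (?e n * (\<phi> n x)\<^sup>2))"
    proof (rule sum_mono)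
      fix n
      have "?e n \<le> 2 / t\<^sup>2 * (1 / (1 / t\<^sup>2 + lam n))" by (rule exp_sqrt_le[OF lam_nonneg t])
      then have "lam n * ?e n \<le> lam n * (2 / t\<^sup>2 * (1 / (1 / t\<^sup>2 + lam n)))" by (rule mult_left_mono) (rule lam_nonneg)
      also have "\<dots> = 2 / t\<^sup>2 * (lam n / (1 / t\<^sup>2 + lam n))" by simp
      also have "\<dots> \<le> 2 / t\<^sup>2 * 1"
        using t lam_nonneg[of n] by (intro mult_left_mono) (auto simp: divide_le_eq_1 add_pos_nonneg)
      finally have "lam n * ?e n * (?e n * (\<phi> n x)\<^sup>2) \<le> 2 / t\<^sup>2 * (?e n * (\<phi> n x)\<^sup>2)"
        by (intro mult_right_mono) auto
      then show "lam n * (?e n * \<phi> n x)\<^sup>2 \<le> 2 / t\<^sup>2 * (?e n * (\<phi> n x)\<^sup>2)"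
        by (simp add: power2_eq_square mult_ac)
    qed
    also have "\<dots> = 2 / t\<^sup>2 * (\<Sum>n<N. ?e n * (\<phi> n x)\<^sup>2)" by (simp add: sum_distrib_left)
    also have "\<dots> \<le> 2 / t\<^sup>2 * (C * diag_size t)" by (intro mult_left_mono C2 t) simp
    finally have E: "En ?u ?u \<le> 2 / t\<^sup>2 * (C * diag_size t)" .
    have "(?u y - ?u y')\<^sup>2 \<le> R y y' * En ?u ?u" by (rule R_bound[OF Fb_Dom[OF comb_Fb]])
    also have "\<dots> \<le> R y y' * (2 / t\<^sup>2 * (C * diag_size t))" by (intro mult_left_mono E) simp
    finally have "\<bar>?u y - ?u y'\<bar> \<le> sqrt (R y y' * (2 / t\<^sup>2 * (C * diag_size t)))" by (intro real_le_rsqrt) simp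
    also have "sqrt (R y y' * (2 / t\<^sup>2 * (C * diag_size t))) = sqrt (2 / t\<^sup>2 * (C * diag_size t)) * sqrt (R y y')"
      by (subst real_sqrt_mult) (rule mult.commute)
    finally show ?thesis unfolding PN_comb .
  qed
  have eq2: "\<bar>PN N t x y - PN N t x' y'\<bar> \<le> sqrt (2 / t\<^sup>2 * (C * diag_size t)) * (sqrt (R x x') + sqrt (R y y'))"
    if t: "0 < t" for t x y x' y' N
    using eq1[OF t, of N x y y'] eq1[OF t, of N y' x x'] unfolding PN_sym[of N t y'] distrib_left by linarith
  show ?thesis by (rule that[OF C PNb lim Pb eq2])
qed

section \<open>Pointwise off-diagonal bounds\<close>

lemma bump:
  fixes s :: real
  assumes "x0 \<notin> Z" "0 < s"
  shows "\<exists>f\<in>Fb. (\<forall>y. 0 \<le> f y) \<and> 0 < (LINT x|\<mu>. f x) \<and> (\<forall>y. s \<le> R x0 y \<longrightarrow> f y = 0)"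
proof -
  obtain C where C: "0 < C"
    "\<And>X \<delta>. 0 < \<delta> \<Longrightarrow> \<exists>\<psi>\<in>Dom. (\<forall>x\<in>X. \<psi> x = 1) \<and> (\<forall>y. (\<forall>x\<in>X. \<delta> < R x y) \<longrightarrow> \<psi> y = 0) \<and>
       (\<forall>x. \<bar>\<psi> x\<bar> \<le> C)"
    by (rule set_cutoff) (rule that)
  \<comment> \<open>A radius within the prescribed one that also keeps the support away from the
    forced zeros in \<open>Z\<close>.\<close>
  define m where "m = Min (insert s (R x0 ` Z))"
  have fin: "finite (insert s (R x0 ` Z))" using finite_Z by simp
  have pos: "\<forall>a\<in>insert s (R x0 ` Z). 0 < a"
  proof -
    have "0 < R x0 z" if "z \<in> Z" for z
    proof -
      have "R x0 z \<noteq> 0" using assms(1) that by auto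
      then show ?thesis using R_nonneg[of x0 z] by linarith
    qed
    then show ?thesis using assms(2) by auto
  qed
  have m: "0 < m" using fin pos unfolding m_def by (subst Min_gr_iff) auto
  have mr: "m \<le> s" and mz: "z \<in> Z \<Longrightarrow> m \<le> R x0 z" for z using fin by (auto simp: m_def)
  have "0 < m / 2" using m by simp
  from C(2)[OF this, of "{x0}"] obtain \<psi> where \<psi>: "\<psi> \<in> Dom" "\<psi> x0 = 1" "\<forall>y. m / 2 < R x0 y \<longrightarrow> \<psi> y = 0"
    by auto
  have zero: "\<psi> y = 0" if "m \<le> R x0 y" for y using \<psi>(3) that m by auto
  \<comment> \<open>The square, because the cutoff itself need not be nonnegative.\<close>
  let ?f = "\<lambda>y. (\<psi> y)\<^sup>2"
  have "?f \<in> Fb" using \<psi>(1) zero mz by (auto simp: Fb_def)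
  moreover have "0 < (LINT x|\<mu>. ?f x)"
    by (rule cont_integral_pos[of _ x0]) (use \<psi> in \<open>auto intro!: continuous_intros Dom_cont\<close>)
  ultimately show ?thesis using zero mr by (intro bexI[of _ ?f]) auto
qed

text \<open>If the kernel exceeded the bound at one point, equicontinuity would make all late
  partial sums exceed it on a product of small balls; tested against bumps supported there, this
  contradicts \<open>pair_bound\<close>. Points of \<open>Z\<close> admit no bump, but the kernel
  vanishes there.\<close>

lemma kernel_off_diag:
  obtains C where "0 < C" "\<And>t x y. 0 < t \<Longrightarrow> x \<noteq> y \<Longrightarrow> \<bar>P t x y\<bar> \<le> C * (t * R x y powr (- gam))"
proof -
  obtain C Q where C: "0 < C" and Q: "1 \<le> Q" and pb:
    "\<And>f h x \<rho> t. f \<in> Fb \<Longrightarrow> h \<in> Fb \<Longrightarrow> 0 < \<rho> \<Longrightarrow> \<rho> \<le> D0 \<Longrightarrow> 0 < t \<Longrightarrow>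
       \<forall>y. \<rho> \<le> R x y \<longrightarrow> f y = 0 \<Longrightarrow> \<forall>y. R x y < Q * \<rho> \<longrightarrow> h y = 0 \<Longrightarrow>
       summable (\<lambda>n. exp (- sqrt (lam n) * t) * (coef f n * coef h n)) \<and>
       \<bar>\<Sum>n. exp (- sqrt (lam n) * t) * (coef f n * coef h n)\<bar> \<le> t * (C * \<rho> powr (- gam) * (nrm f * nrm h))"
    by (rule pair_bound) (rule that)
  obtain Cd where Cd: "0 < Cd" and lim: "\<And>t x y. 0 < t \<Longrightarrow> (\<lambda>N. PN N t x y) \<longlonglongrightarrow> P t x y"
    and eqc: "\<And>t x y x' y' N. 0 < t \<Longrightarrow> \<bar>PN N t x y - PN N t x' y'\<bar> \<le>
        sqrt (2 / t\<^sup>2 * (Cd * diag_size t)) * (sqrt (R x x') + sqrt (R y y'))"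
    by (rule kernel_diag) (rule that)
  have main: "\<bar>P t x0 y0\<bar> \<le> C * (2 * Q) powr gam * (t * R x0 y0 powr (- gam))" if t: "0 < t" and ne: "x0 \<noteq> y0" for t x0 y0
  proof (cases "x0 \<in> Z \<or> y0 \<in> Z")
    case True
    then have "P t x0 y0 = 0" by (auto simp: poisson_kernel_def phi_Z)
    then show ?thesis using C t by simp
  next
    case False
    \<comment> \<open>Then \<open>Q * \<rho>\<close> is half of the distance, and bumps of radius at
      most \<rho> around the two points satisfy the support conditions of
      \<open>pair_bound\<close>.\<close>
    define \<rho> where "\<rho> = R x0 y0 / (2 * Q)"
    have "R x0 y0 \<noteq> 0" using ne by simp
    then have R0: "0 < R x0 y0" using R_nonneg[of x0 y0] by linarith
    have \<rho>: "0 < \<rho>" using R0 Q by (simp add: \<rho>_def)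
    have Q\<rho>: "Q * \<rho> = R x0 y0 / 2" using Q by (simp add: \<rho>_def)
    have "\<rho> \<le> Q * \<rho>" using mult_right_mono[OF Q, of \<rho>] \<rho> by simp
    then have \<rho>2: "\<rho> \<le> R x0 y0 / 2" using Q\<rho> by simp
    have \<rho>D: "\<rho> \<le> D0" using \<rho>2 D0(2)[of x0 y0] R0 by linarith
    define B0 where "B0 = t * (C * \<rho> powr (- gam))"
    have B0: "0 \<le> B0" using t C by (simp add: B0_def)
    have "\<bar>P t x0 y0\<bar> \<le> B0"
    proof (rule ccontr)
      assume big: "\<not> \<bar>P t x0 y0\<bar> \<le> B0"
      define gap where "gap = (\<bar>P t x0 y0\<bar> - B0) / 3"
      have gap: "0 < gap" "\<bar>P t x0 y0\<bar> = B0 + 3 * gap" using big by (simp_all add: gap_def field_simps)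
      define s where "s = sgn (P t x0 y0)"
      have s: "\<bar>s\<bar> \<le> 1" "s * P t x0 y0 = \<bar>P t x0 y0\<bar>" by (auto simp: s_def sgn_if abs_if)
      define Kt where "Kt = sqrt (2 / t\<^sup>2 * (Cd * diag_size t))"
      have Kt: "0 \<le> Kt" using t Cd diag_size_pos[OF t] by (simp add: Kt_def)
      \<comment> \<open>At distances below \<eta> the partial sums change by at most
        \<open>gap\<close>; adding 1 keeps the denominator positive even for
        \<open>Kt = 0\<close>.\<close>
      define \<eta> where "\<eta> = min \<rho> ((gap / (2 * Kt + 1))\<^sup>2)"
      have \<eta>: "0 < \<eta>" "\<eta> \<le> \<rho>" using \<rho> gap Kt by (auto simp: \<eta>_def)
      have "sqrt \<eta> \<le> sqrt ((gap / (2 * Kt + 1))\<^sup>2)" by (intro real_sqrt_le_mono) (simp add: \<eta>_def)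
      also have "\<dots> = gap / (2 * Kt + 1)" using gap Kt by simp
      finally have sr: "sqrt \<eta> * (2 * Kt + 1) \<le> gap" using Kt by (simp add: field_simps)
      have Kr: "Kt * (sqrt \<eta> + sqrt \<eta>) \<le> gap"
      proof -
        have "Kt * (sqrt \<eta> + sqrt \<eta>) = sqrt \<eta> * (2 * Kt + 1) - sqrt \<eta>" by (simp add: algebra_simps)
        moreover have "0 \<le> sqrt \<eta>" using \<eta> by simp
        ultimately show ?thesis using sr by linarith
      qed
      obtain f where f: "f \<in> Fb" "\<And>y. 0 \<le> f y" "0 < (LINT x|\<mu>. f x)" "\<And>y. \<eta> \<le> R x0 y \<Longrightarrow> f y = 0"
        using bump[of x0 \<eta>] False \<eta> by auto
      obtain h where h: "h \<in> Fb" "\<And>y. 0 \<le> h y" "0 < (LINT x|\<mu>. h x)" "\<And>y. \<eta> \<le> R y0 y \<Longrightarrow> h y = 0"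
        using bump[of y0 \<eta>] False \<eta> by auto
      note cf = Fb_cont[OF f(1)] and ch = Fb_cont[OF h(1)]
      have nf: "nrm f = (LINT x|\<mu>. f x)" and nh: "nrm h = (LINT x|\<mu>. h x)" using f(2) h(2) by simp_all
      let ?e = "\<lambda>n. exp (- sqrt (lam n) * t)"
      have sf: "f y = 0" if "\<rho> \<le> R x0 y" for y using f(4)[of y] that \<eta> by simp
      have sh: "h y = 0" if "R x0 y < Q * \<rho>" for y
      proof (rule h(4))
        show "\<eta> \<le> R y0 y" using R_tri[of x0 y0 y] R_sym[of y y0] that Q\<rho> \<rho>2 \<eta> by linarith
      qed
      have b: "summable (\<lambda>n. ?e n * (coef f n * coef h n))"
        "\<bar>\<Sum>n. ?e n * (coef f n * coef h n)\<bar> \<le> t * (C * \<rho> powr (- gam) * (nrm f * nrm h))"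
        using pb[OF f(1) h(1) \<rho> \<rho>D t] sf sh by blast+
      let ?W = "(B0 + gap) * ((LINT x|\<mu>. f x) * (LINT x|\<mu>. h x))"
      have ge: "?W \<le> s * (\<Sum>n<N. ?e n * (coef f n * coef h n))" if N: "B0 + 2 * gap < s * PN N t x0 y0" for N
      proof -
        have pt: "B0 + gap \<le> s * PN N t x y" if "R x0 x < \<eta>" "R y0 y < \<eta>" for x y
        proof -
          have "\<bar>PN N t x0 y0 - PN N t x y\<bar> \<le> Kt * (sqrt (R x0 x) + sqrt (R y0 y))"
            unfolding Kt_def by (rule eqc[OF t])
          also have "\<dots> \<le> Kt * (sqrt \<eta> + sqrt \<eta>)" using Kt that by (intro mult_left_mono add_mono) auto
          also have "\<dots> \<le> gap" by (rule Kr)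
          finally have "\<bar>PN N t x0 y0 - PN N t x y\<bar> \<le> gap" .
          moreover have "\<bar>s * (PN N t x0 y0 - PN N t x y)\<bar> \<le> 1 * \<bar>PN N t x0 y0 - PN N t x y\<bar>"
            unfolding abs_mult using s(1) by (intro mult_right_mono) auto
          ultimately have "s * PN N t x0 y0 - s * PN N t x y \<le> gap" by (simp add: right_diff_distrib)
          then show ?thesis using N by simp
        qed
        define A where "A = comb {..<N} (\<lambda>n. ?e n * coef f n)"
        have cA: "continuous_on UNIV A" unfolding A_def by (intro Fb_cont comb_Fb)
        have Ay: "A y = ip (PN N t y) f" for y
          unfolding PN_comb A_def using cf by (simp add: ip_comb) (simp add: comb_def coef_def mult_ac)
        have Ab: "(B0 + gap) * (LINT x|\<mu>. f x) \<le> s * A y" if y: "R y0 y < \<eta>" for y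
        proof -
          have cP: "continuous_on UNIV (PN N t y)" unfolding PN_comb by (intro Fb_cont comb_Fb)
          have "(B0 + gap) * (LINT x|\<mu>. f x) = (LINT x|\<mu>. (B0 + gap) * f x)" by simp
          also have "\<dots> \<le> (LINT x|\<mu>. s * (PN N t y x * f x))"
          proof (intro integral_mono)
            show "integrable \<mu> (\<lambda>x. (B0 + gap) * f x)" "integrable \<mu> (\<lambda>x. s * (PN N t y x * f x))"
              using cf cP by (auto intro!: cont_int continuous_intros)
            fix x
            show "(B0 + gap) * f x \<le> s * (PN N t y x * f x)"
            proof (cases "R x0 x < \<eta>")
              case True
              have "(B0 + gap) * f x \<le> s * PN N t y x * f x"
                using pt[OF True y] f(2)[of x] unfolding PN_sym[of N t y x] by (intro mult_right_mono) auto
              then show ?thesis by (simp add: mult.assoc)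
            qed (simp add: f(4))
          qed
          finally show ?thesis by (simp add: Ay)
        qed
        have "?W = (LINT y|\<mu>. (B0 + gap) * (LINT x|\<mu>. f x) * h y)" by simp
        also have "\<dots> \<le> (LINT y|\<mu>. s * (A y * h y))"
        proof (intro integral_mono)
          show "integrable \<mu> (\<lambda>y. (B0 + gap) * (LINT x|\<mu>. f x) * h y)" "integrable \<mu> (\<lambda>y. s * (A y * h y))"
            using ch cA by (auto intro!: cont_int continuous_intros)
          fix y
          show "(B0 + gap) * (LINT x|\<mu>. f x) * h y \<le> s * (A y * h y)"
          proof (cases "R y0 y < \<eta>")
            case True
            have "(B0 + gap) * (LINT x|\<mu>. f x) * h y \<le> s * A y * h y"
              using Ab[OF True] h(2)[of y] by (intro mult_right_mono) auto
            then show ?thesis by (simp add: mult.assoc)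
          qed (simp add: h(4))
        qed
        also have "\<dots> = s * ip A h" by simp
        also have "ip A h = (\<Sum>n<N. ?e n * (coef f n * coef h n))"
          unfolding A_def using ch by (simp add: ip_comb coef_def mult.assoc)
        finally show ?thesis .
      qed
      have "(\<lambda>N. s * PN N t x0 y0) \<longlonglongrightarrow> s * P t x0 y0" by (intro tendsto_mult tendsto_const lim t)
      then have "\<forall>\<^sub>F N in sequentially. B0 + 2 * gap < s * PN N t x0 y0"
        by (rule order_tendstoD(1)) (use s(2) gap in simp)
      then have ev: "\<forall>\<^sub>F N in sequentially. ?W \<le> s * (\<Sum>n<N. ?e n * (coef f n * coef h n))"
        by eventually_elim (rule ge)
      have "(\<lambda>N. s * (\<Sum>n<N. ?e n * (coef f n * coef h n))) \<longlonglongrightarrow> s * (\<Sum>n. ?e n * (coef f n * coef h n))"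
        by (intro tendsto_mult tendsto_const summable_LIMSEQ b(1))
      then have "?W \<le> s * (\<Sum>n. ?e n * (coef f n * coef h n))"
        by (rule tendsto_lowerbound[OF _ ev]) simp
      also have "\<dots> \<le> 1 * \<bar>\<Sum>n. ?e n * (coef f n * coef h n)\<bar>"
      proof -
        have "s * (\<Sum>n. ?e n * (coef f n * coef h n)) \<le> \<bar>s\<bar> * \<bar>\<Sum>n. ?e n * (coef f n * coef h n)\<bar>"
          using abs_ge_self[of "s * (\<Sum>n. ?e n * (coef f n * coef h n))"] unfolding abs_mult .
        also have "\<dots> \<le> 1 * \<bar>\<Sum>n. ?e n * (coef f n * coef h n)\<bar>" using s(1) by (intro mult_right_mono) auto
        finally show ?thesis .
      qed
      also have "\<dots> \<le> B0 * ((LINT x|\<mu>. f x) * (LINT x|\<mu>. h x))" using b(2) unfolding nf nh B0_def by (simp add: mult.assoc)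
      finally have "gap * ((LINT x|\<mu>. f x) * (LINT x|\<mu>. h x)) \<le> 0" by (simp add: distrib_right)
      moreover have "0 < gap * ((LINT x|\<mu>. f x) * (LINT x|\<mu>. h x))" using gap(1) f(3) h(3) by simp
      ultimately show False by simp
    qed
    also have "B0 = C * (2 * Q) powr gam * (t * R x0 y0 powr (- gam))"
      unfolding B0_def \<rho>_def using R0 Q by (simp add: powr_divide powr_minus_divide)
    finally show ?thesis .
  qed
  show ?thesis
  proof (rule that)
    show "0 < C * (2 * Q) powr gam" using C Q by simp
  qed (rule main)
qed

end

section \<open>Nontangential maximal function and limits\<close>

context pcf_eigen
begin

abbreviation u :: "('a \<Rightarrow> real) \<Rightarrow> real \<Rightarrow> 'a \<Rightarrow> real" where
  "u \<equiv> poisson_integral \<mu> lam \<phi>"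

abbreviation MF :: "('a \<Rightarrow> real) \<Rightarrow> 'a \<Rightarrow> ennreal" where
  "MF \<equiv> maximal_function F r D \<mu>"

section \<open>Domination by the maximal function\<close>

lemma abs_indicator_measurable:
  assumes "f \<in> borel_measurable \<mu>"
  shows "(\<lambda>z. ennreal \<bar>f z\<bar> * indicator (B x e) z) \<in> borel_measurable \<mu>"
  by (intro borel_measurable_times_ennreal borel_measurable_indicator
      measurable_compose[OF borel_measurable_abs[OF assms] measurable_ennreal]) simp

lemma ball_integral_le:
  assumes "0 < e" shows "(\<integral>\<^sup>+y\<in>B x e. ennreal \<bar>f y\<bar> \<partial>\<mu>) \<le> emeasure \<mu> (B x e) * MF f x"
proof -
  let ?a = "\<integral>\<^sup>+y\<in>B x e. ennreal \<bar>f y\<bar> \<partial>\<mu>" and ?m = "emeasure \<mu> (B x e)"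
  have m: "?m \<noteq> 0" "?m \<noteq> top" using ball_pos[OF assms, of x] by (auto simp: emeasure_eq_measure)
  have "?a = ?a * ?m / ?m" using m by (simp add: mult_divide_eq_ennreal)
  also have "\<dots> = ?m * (?a / ?m)" by (simp add: ennreal_times_divide mult.commute)
  also have "?a / ?m \<le> MF f x" unfolding maximal_function_def using assms by (intro SUP_upper) auto
  finally show ?thesis by (simp add: mult_left_mono)
qed

lemma diag_size_small: assumes "0 < t" "t \<le> 1" shows "diag_size t = (t powr bet) powr (- d)"
proof -
  have "t\<^sup>2 \<le> 1" using assms by (simp add: power_le_one)
  then have "1 \<le> 1 / t\<^sup>2" using assms by (simp add: field_simps)
  then have "diag_size t = (1 / t\<^sup>2) powr (- 1 / (d + 1)) / t\<^sup>2" by (simp add: diag_size_def kappa_def)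
  also have "1 / t\<^sup>2 = t powr (- 2)" using assms by (simp add: powr_minus_divide powr_numeral)
  also have "(t powr (- 2)) powr (- 1 / (d + 1)) = t powr bet" by (simp add: powr_powr bet_def)
  also have "t powr bet / t\<^sup>2 = t powr (bet - 2)" using assms by (simp add: powr_diff powr_numeral)
  also have "bet - 2 = bet * (- d)" using d_pos by (simp add: bet_def field_simps)
  finally show ?thesis by (simp add: powr_powr)
qed

lemma diag_size_large: assumes "1 < t" shows "diag_size t = 1"
proof -
  have "1 < t\<^sup>2" using assms by (simp add: one_less_power)
  then have "1 / t\<^sup>2 < 1" using assms by (simp add: field_simps)
  then have "kappa (1 / t\<^sup>2) = 1 / (1 / t\<^sup>2)" unfolding kappa_def by (simp only: not_le[symmetric] if_False)
  then show ?thesis using assms by (simp add: diag_size_def)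
qed

lemma cone_R:
  assumes "(t, y) \<in> nt_cone F r D d \<alpha> x" "0 < \<alpha>"
  shows "0 < t" "R x y \<le> \<alpha> powr (1 / (d + 1)) * t powr bet"
proof -
  have c: "0 < t" "R x y powr (d + 1) < \<alpha> * t\<^sup>2" using assms by (auto simp: nt_cone_def)
  have "R x y = (R x y powr (d + 1)) powr (1 / (d + 1))" using d_pos by (simp add: powr_powr)
  also have "\<dots> \<le> (\<alpha> * t\<^sup>2) powr (1 / (d + 1))" using c d_pos by (intro powr_mono2) auto
  also have "\<dots> = \<alpha> powr (1 / (d + 1)) * (t powr 2) powr (1 / (d + 1))"
    using assms(2) c by (simp add: powr_mult powr_numeral)
  also have "(t powr 2) powr (1 / (d + 1)) = t powr bet" by (simp add: powr_powr bet_def)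
  finally show "R x y \<le> \<alpha> powr (1 / (d + 1)) * t powr bet" .
  show "0 < t" by (rule c)
qed

text \<open>Valid also without integrability, because the Bochner integral of a non-integrable
  function is 0.\<close>

lemma abs_poisson_le: "ennreal \<bar>u f t y\<bar> \<le> (\<integral>\<^sup>+z. ennreal (\<bar>P t y z\<bar> * \<bar>f z\<bar>) \<partial>\<mu>)"
proof (cases "integrable \<mu> (\<lambda>z. P t y z * f z)")
  case True
  from integral_norm_bound_ennreal[OF this] show ?thesis by (simp add: poisson_integral_def abs_mult)
qed (simp add: poisson_integral_def not_integrable_integral_eq)

text \<open>At scale \<open>\<epsilon> = t powr bet\<close> the kernel is dominated by a rapidly decreasing combination of
  indicators of the balls of radius \<open>2 ^ k * K * \<epsilon>\<close> around the vertex of the cone.\<close>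

lemma cone_maximal_bound:
  assumes \<alpha>: "0 < \<alpha>"
  obtains A where "0 < A"
    "\<And>f t x y. f \<in> borel_measurable \<mu> \<Longrightarrow> (t, y) \<in> nt_cone F r D d \<alpha> x \<Longrightarrow>
       ennreal \<bar>u f t y\<bar> \<le> ennreal A * MF f x"
proof -
  obtain Cd where Cd: "0 < Cd" and Pd: "\<And>t x y. 0 < t \<Longrightarrow> \<bar>P t x y\<bar> \<le> Cd * diag_size t"
    by (rule kernel_diag) (rule that)
  obtain Co where Co: "0 < Co" and Po: "\<And>t x y. 0 < t \<Longrightarrow> x \<noteq> y \<Longrightarrow> \<bar>P t x y\<bar> \<le> Co * (t * R x y powr (- gam))"
    by (rule kernel_off_diag) (rule that)
  obtain Cu where Cu: "0 < Cu" "\<And>x \<rho>. 0 < \<rho> \<Longrightarrow> measure \<mu> (B x \<rho>) \<le> Cu * \<rho> powr d"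
    by (rule ball_upper) (rule that)
  define a where "a = \<alpha> powr (1 / (d + 1))"
  have a: "0 < a" using \<alpha> by (simp add: a_def)
  \<comment> \<open>A point outside the ball of radius \<open>2 ^ m * K * \<epsilon>\<close> around
    \<open>x\<close> has distance at least \<open>2 ^ m * \<epsilon>\<close> from every
    \<open>y\<close> within \<open>a * \<epsilon>\<close> of \<open>x\<close>.\<close>
  define K where "K = 2 * a + 1"
  have K: "1 \<le> K" "0 < K" using a by (auto simp: K_def)
  define A1 where "A1 = Cd + Co * 2 powr gam"
  have A1: "0 < A1" "Cd \<le> A1" "Co * 2 powr gam \<le> A1" using Cd Co by (auto simp: A1_def add_pos_pos)
  define q where "q = 2 powr (- gam)"
  define q' where "q' = 2 powr (d - gam)"
  \<comment> \<open>The kernel loses a factor \<open>2 powr (- gam)\<close> per dyadic shell while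
    the measure bound for the balls grows by \<open>2 powr d\<close>; the series converges because
    \<open>gam\<close> exceeds \<open>d\<close>.\<close>
  have "d - gam < 0" using d_pos by (simp add: gam_def field_simps)
  from powr_less_mono[OF this, of 2] have q': "0 < q'" "q' < 1" by (simp_all add: q'_def)
  define A2 where "A2 = A1 * Cu * K powr d"
  have A2: "0 < A2" using A1 Cu K by (simp add: A2_def)
  define A where "A = A2 / (1 - q') + Cd"
  have A: "0 < A" "A2 / (1 - q') \<le> A" "Cd \<le> A" using A2 q' Cd by (auto simp: A_def add_pos_pos less_imp_le)
  have "ennreal \<bar>u f t y\<bar> \<le> ennreal A * MF f x"
    if f: "f \<in> borel_measurable \<mu>" and cone: "(t, y) \<in> nt_cone F r D d \<alpha> x" for f t x y
  proof -
    note t = cone_R(1)[OF cone \<alpha>] and Rxy = cone_R(2)[OF cone \<alpha>, folded a_def]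
    show ?thesis
    proof (cases "t \<le> 1")
      case False
      \<comment> \<open>For \<open>t > 1\<close> the kernel is bounded by a constant, and the ball
        of radius \<open>D0 + 1\<close> is the whole space.\<close>
      then have dg: "diag_size t = 1" by (intro diag_size_large) simp
      have "ennreal \<bar>u f t y\<bar> \<le> (\<integral>\<^sup>+z. ennreal (\<bar>P t y z\<bar> * \<bar>f z\<bar>) \<partial>\<mu>)" by (rule abs_poisson_le)
      also have "\<dots> \<le> (\<integral>\<^sup>+z. ennreal Cd * (ennreal \<bar>f z\<bar> * indicator (B x (D0 + 1)) z) \<partial>\<mu>)"
      proof (rule nn_integral_mono)
        fix z
        have "z \<in> B x (D0 + 1)" using D0(2)[of x z] by (simp add: res_ball_def)
        moreover have "\<bar>P t y z\<bar> * \<bar>f z\<bar> \<le> Cd * \<bar>f z\<bar>" using Pd[OF t, of y z] dg by (intro mult_right_mono) auto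
        ultimately show "ennreal (\<bar>P t y z\<bar> * \<bar>f z\<bar>) \<le> ennreal Cd * (ennreal \<bar>f z\<bar> * indicator (B x (D0 + 1)) z)"
          using Cd by (simp add: ennreal_mult'[symmetric] ennreal_leI)
      qed
      also have "\<dots> = ennreal Cd * (\<integral>\<^sup>+z\<in>B x (D0 + 1). ennreal \<bar>f z\<bar> \<partial>\<mu>)"
        by (rule nn_integral_cmult[OF abs_indicator_measurable[OF f]])
      also have "\<dots> \<le> ennreal Cd * (emeasure \<mu> (B x (D0 + 1)) * MF f x)"
        using D0(1) by (intro mult_left_mono ball_integral_le) auto
      also have "\<dots> \<le> ennreal A * (1 * MF f x)"
        using A by (intro mult_mono ennreal_leI mult_right_mono emeasure_le_1) auto
      finally show ?thesis by simp
    next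
      case True
      define \<epsilon> where "\<epsilon> = t powr bet"
      have \<epsilon>: "0 < \<epsilon>" using t by (simp add: \<epsilon>_def)
      have Rxy': "R x y \<le> a * \<epsilon>" using Rxy by (simp add: \<epsilon>_def)
      define rr where "rr k = 2 ^ k * (K * \<epsilon>)" for k :: nat
      have rr: "0 < rr k" for k using K \<epsilon> by (simp add: rr_def)
      define c where "c k = A1 * \<epsilon> powr (- d) * q ^ k" for k :: nat
      have c0: "0 \<le> c k" for k using A1 by (simp add: c_def q_def)
      \<comment> \<open>At distance \<epsilon> the off-diagonal bound has the same size as the
        diagonal bound.\<close>
      have teps: "t * \<epsilon> powr (- gam) = \<epsilon> powr (- d)"
      proof -
        have "t = t powr 1" using t by simp
        also have "1 = bet * ((d + 1) / 2)" using d_pos by (simp add: bet_def)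
        also have "t powr (bet * ((d + 1) / 2)) = \<epsilon> powr ((d + 1) / 2)" by (simp add: \<epsilon>_def powr_powr)
        finally have "t * \<epsilon> powr (- gam) = \<epsilon> powr ((d + 1) / 2 + - gam)" by (simp only: powr_add)
        also have "(d + 1) / 2 + - gam = - d" by (simp add: gam_def field_simps)
        finally show ?thesis .
      qed
      have dom: "\<exists>k. z \<in> B x (rr k) \<and> \<bar>P t y z\<bar> \<le> c k" for z
      proof -
        obtain n :: nat where "D0 / (K * \<epsilon>) < 2 ^ n" using real_arch_pow[of 2 "D0 / (K * \<epsilon>)"] by auto
        then have "D0 < rr n" using K \<epsilon> by (simp add: rr_def field_simps)
        then have ex: "\<exists>n. R x z < rr n" using D0(2)[of x z] by (intro exI[of _ n]) simp
        define k where "k = (LEAST n. R x z < rr n)"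
        have kz: "R x z < rr k" unfolding k_def using ex by (rule LeastI_ex)
        have "\<bar>P t y z\<bar> \<le> c k"
        proof (cases k)
          case 0
          have "\<bar>P t y z\<bar> \<le> Cd * \<epsilon> powr (- d)" using Pd[OF t, of y z] diag_size_small[OF t True] by (simp add: \<epsilon>_def)
          also have "\<dots> \<le> A1 * \<epsilon> powr (- d)" using A1 by (intro mult_right_mono) auto
          finally show ?thesis by (simp add: 0 c_def)
        next
          case (Suc m)
          have "\<not> R x z < rr m" using not_less_Least[of m "\<lambda>n. R x z < rr n"] Suc by (simp add: k_def)
          then have "2 ^ m * (K * \<epsilon>) \<le> R x z" by (simp add: rr_def)
          moreover have "a * \<epsilon> \<le> 2 ^ m * (a * \<epsilon>)"
            using mult_right_mono[of 1 "2 ^ m" "a * \<epsilon>"] a \<epsilon> by simp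
          moreover have "0 \<le> 2 ^ m * (a * \<epsilon>)" using a \<epsilon> by simp
          moreover have "2 ^ m * (K * \<epsilon>) = 2 * (2 ^ m * (a * \<epsilon>)) + 2 ^ m * \<epsilon>" by (simp add: K_def algebra_simps)
          ultimately have far: "2 ^ m * \<epsilon> \<le> R y z" using R_tri[of x z y] Rxy' by linarith
          have pos: "0 < 2 ^ m * \<epsilon>" using \<epsilon> by simp
          have "y \<noteq> z" using far pos by auto
          then have "\<bar>P t y z\<bar> \<le> Co * (t * R y z powr (- gam))" by (rule Po[OF t])
          also have "\<dots> \<le> Co * (t * (2 ^ m * \<epsilon>) powr (- gam))"
            using far pos gam_pos Co t by (intro mult_left_mono powr_mono2') auto
          also have "(2 ^ m * \<epsilon>) powr (- gam) = q ^ m * \<epsilon> powr (- gam)"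
            using \<epsilon> by (simp add: powr_mult q_def powr_realpow[symmetric] powr_powr mult.commute)
          also have "Co * (t * (q ^ m * \<epsilon> powr (- gam))) = Co * q ^ m * \<epsilon> powr (- d)"
            unfolding teps[symmetric] by simp
          \<comment> \<open>Membership in shell \<open>Suc m\<close> only yields a distance of order
            \<open>2 ^ m\<close>; the missing factor \<open>2 powr gam\<close> is part of
            \<open>A1\<close>.\<close>
          also have "Co * q ^ m = Co * 2 powr gam * q ^ Suc m"
            by (simp add: q_def powr_minus)
          also have "Co * 2 powr gam * q ^ Suc m * \<epsilon> powr (- d) \<le> A1 * q ^ Suc m * \<epsilon> powr (- d)"
            using A1 by (intro mult_right_mono) (auto simp: q_def)
          finally show ?thesis by (simp add: Suc c_def mult_ac)
        qed
        then show ?thesis using kz by (auto simp: res_ball_def)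
      qed
      have ptw: "ennreal (\<bar>P t y z\<bar> * \<bar>f z\<bar>) \<le> (\<Sum>k. ennreal (c k) * (ennreal \<bar>f z\<bar> * indicator (B x (rr k)) z))" for z
      proof -
        obtain k where k: "z \<in> B x (rr k)" "\<bar>P t y z\<bar> \<le> c k" using dom by blast
        have "ennreal (\<bar>P t y z\<bar> * \<bar>f z\<bar>) \<le> ennreal (c k * \<bar>f z\<bar>)" using k(2) by (intro ennreal_leI mult_right_mono) auto
        also have "\<dots> = (\<Sum>k\<in>{k}. ennreal (c k) * (ennreal \<bar>f z\<bar> * indicator (B x (rr k)) z))"
          using k(1) c0 by (simp add: ennreal_mult')
        also have "\<dots> \<le> (\<Sum>k. ennreal (c k) * (ennreal \<bar>f z\<bar> * indicator (B x (rr k)) z))"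
          by (rule sum_le_suminf) auto
        finally show ?thesis .
      qed
      have "ennreal \<bar>u f t y\<bar> \<le> (\<integral>\<^sup>+z. ennreal (\<bar>P t y z\<bar> * \<bar>f z\<bar>) \<partial>\<mu>)" by (rule abs_poisson_le)
      also have "\<dots> \<le> (\<integral>\<^sup>+z. (\<Sum>k. ennreal (c k) * (ennreal \<bar>f z\<bar> * indicator (B x (rr k)) z)) \<partial>\<mu>)"
        by (intro nn_integral_mono ptw)
      also have "\<dots> = (\<Sum>k. \<integral>\<^sup>+z. ennreal (c k) * (ennreal \<bar>f z\<bar> * indicator (B x (rr k)) z) \<partial>\<mu>)"
        by (intro nn_integral_suminf borel_measurable_times_ennreal borel_measurable_const abs_indicator_measurable f)
      also have "\<dots> = (\<Sum>k. ennreal (c k) * (\<integral>\<^sup>+z\<in>B x (rr k). ennreal \<bar>f z\<bar> \<partial>\<mu>))"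
        by (intro suminf_cong nn_integral_cmult abs_indicator_measurable f)
      also have "\<dots> \<le> (\<Sum>k. ennreal (A2 * q' ^ k) * MF f x)"
      proof (intro suminf_le summableI)
        fix k
        have "ennreal (c k) * (\<integral>\<^sup>+z\<in>B x (rr k). ennreal \<bar>f z\<bar> \<partial>\<mu>) \<le> ennreal (c k) * (emeasure \<mu> (B x (rr k)) * MF f x)"
          by (intro mult_left_mono ball_integral_le rr) simp
        also have "\<dots> \<le> ennreal (c k) * (ennreal (Cu * rr k powr d) * MF f x)"
          using Cu(2)[OF rr] by (intro mult_left_mono mult_right_mono) (auto simp: emeasure_eq_measure intro!: ennreal_leI)
        also have "\<dots> = ennreal (c k * (Cu * rr k powr d)) * MF f x"
          using c0[of k] by (simp add: ennreal_mult' mult.assoc)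
        also have "c k * (Cu * rr k powr d) = A2 * q' ^ k"
        proof -
          have "rr k powr d = (2 powr d) ^ k * (K powr d * \<epsilon> powr d)"
            using K \<epsilon> by (simp add: rr_def powr_mult powr_realpow[symmetric] powr_powr mult.commute)
          moreover have "\<epsilon> powr (- d) * \<epsilon> powr d = 1" using \<epsilon> by (simp add: powr_minus)
          moreover have "q ^ k * (2 powr d) ^ k = q' ^ k"
            unfolding power_mult_distrib[symmetric] q_def q'_def by (simp add: powr_add[symmetric])
          moreover have "c k * (Cu * ((2 powr d) ^ k * (K powr d * \<epsilon> powr d)))
             = A2 * (q ^ k * (2 powr d) ^ k) * (\<epsilon> powr (- d) * \<epsilon> powr d)" by (simp add: c_def A2_def)
          ultimately show ?thesis by simp
        qed
        finally show "ennreal (c k) * (\<integral>\<^sup>+z\<in>B x (rr k). ennreal \<bar>f z\<bar> \<partial>\<mu>) \<le> ennreal (A2 * q' ^ k) * MF f x" .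
      qed
      also have "\<dots> = (\<Sum>k. ennreal (A2 * q' ^ k)) * MF f x" by (rule ennreal_suminf_multc)
      also have "(\<Sum>k. ennreal (A2 * q' ^ k)) = ennreal (A2 * (1 / (1 - q')))"
        using q' A2 by (intro suminf_ennreal_eq sums_mult geometric_sums) auto
      also have "ennreal (A2 * (1 / (1 - q'))) * MF f x \<le> ennreal A * MF f x"
        using A by (intro mult_right_mono ennreal_leI) auto
      finally show ?thesis .
    qed
  qed
  with A(1) show ?thesis by (rule that)
qed

section \<open>Convergence for sums of eigenfunctions\<close>

lemma P_meas: assumes "0 < t" shows "P t y \<in> borel_measurable \<mu>"
proof -
  have lim: "(\<lambda>N. PN N t y z) \<longlonglongrightarrow> P t y z" for z
    by (rule kernel_diag) (use assms in blast)
  have m: "PN N t y \<in> borel_measurable \<mu>" for N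
    unfolding PN_comb by (intro cont_meas Fb_cont comb_Fb)
  show ?thesis by (rule borel_measurable_LIMSEQ_real[where u = "\<lambda>N. PN N t y"]) (rule lim, rule m)
qed

lemma P_f_int: assumes t: "0 < t" and f: "integrable \<mu> f" shows "integrable \<mu> (\<lambda>z. P t y z * f z)"
proof -
  obtain C where C: "0 < C" "\<And>t x y. 0 < t \<Longrightarrow> \<bar>P t x y\<bar> \<le> C * diag_size t"
    by (rule kernel_diag) (rule that)
  show ?thesis
  proof (rule Bochner_Integration.integrable_bound)
    show "integrable \<mu> (\<lambda>z. C * diag_size t * \<bar>f z\<bar>)" using f by simp
    show "(\<lambda>z. P t y z * f z) \<in> borel_measurable \<mu>"
      using P_meas[OF t] f by (intro borel_measurable_times) auto
    show "AE z in \<mu>. norm (P t y z * f z) \<le> norm (C * diag_size t * \<bar>f z\<bar>)"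
      using C(1) C(2)[OF t] diag_size_pos[OF t] by (intro AE_I2) (auto simp: abs_mult intro!: mult_right_mono)
  qed
qed

lemma poisson_diff:
  assumes "0 < t" "integrable \<mu> f" "integrable \<mu> g"
  shows "u (\<lambda>x. f x - g x) t y = u f t y - u g t y"
  unfolding poisson_integral_def right_diff_distrib
  using assms by (intro Bochner_Integration.integral_diff P_f_int)

text \<open>The partial kernels are dominated uniformly in \<open>N\<close>, so integration and
  limit commute; by orthogonality the integrals are constant as soon as \<open>N\<close> exceeds all
  indices in \<open>A\<close>.\<close>

lemma poisson_comb:
  assumes t: "0 < t" and A: "finite A"
  shows "u (comb A c) t y = (\<Sum>n\<in>A. exp (- sqrt (lam n) * t) * c n * \<phi> n y)"
proof -
  obtain C where C: "0 < C" "\<And>t x y N. 0 < t \<Longrightarrow> \<bar>PN N t x y\<bar> \<le> C * diag_size t"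
    "\<And>t x y. 0 < t \<Longrightarrow> (\<lambda>N. PN N t x y) \<longlonglongrightarrow> P t x y"
    by (rule kernel_diag) (rule that)
  let ?g = "comb A c"
  let ?e = "\<lambda>n. exp (- sqrt (lam n) * t)"
  have cg: "continuous_on UNIV ?g" by (intro Fb_cont comb_Fb)
  have "(\<lambda>N. ip (PN N t y) ?g) \<longlonglongrightarrow> (LINT z|\<mu>. P t y z * ?g z)"
  proof (rule integral_dominated_convergence[where w = "\<lambda>z. C * diag_size t * \<bar>?g z\<bar>"])
    show "(\<lambda>z. P t y z * ?g z) \<in> borel_measurable \<mu>" "(\<lambda>z. PN N t y z * ?g z) \<in> borel_measurable \<mu>" for N
      unfolding PN_comb by (intro borel_measurable_times P_meas t cont_meas cg Fb_cont comb_Fb)+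
    show "integrable \<mu> (\<lambda>z. C * diag_size t * \<bar>?g z\<bar>)" using cg by (intro cont_int continuous_intros)
    show "AE z in \<mu>. (\<lambda>N. PN N t y z * ?g z) \<longlonglongrightarrow> P t y z * ?g z"
      by (intro AE_I2 tendsto_mult tendsto_const C(3) t)
    show "AE z in \<mu>. norm (PN N t y z * ?g z) \<le> C * diag_size t * \<bar>?g z\<bar>" for N
      using C(2)[OF t] by (intro AE_I2) (auto simp: abs_mult intro!: mult_right_mono)
  qed
  moreover have "\<forall>\<^sub>F N in sequentially. ip (PN N t y) ?g = (\<Sum>n\<in>A. ?e n * c n * \<phi> n y)"
  proof -
    obtain M where M: "\<forall>n\<in>A. n < M" using A unfolding finite_nat_set_iff_bounded by (rule exE)
    have ph: "ip (\<phi> n) ?g = (if n \<in> A then c n else 0)" for n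
    proof -
      have "ip (\<phi> n) ?g = ip ?g (\<phi> n)" by (simp add: mult.commute)
      also have "\<dots> = (\<Sum>k\<in>A. if k = n then c k else 0)"
        unfolding ip_comb[OF A phi_cont] by (intro sum.cong refl) (simp add: orth)
      finally show ?thesis using A by simp
    qed
    have "ip (PN N t y) ?g = (\<Sum>n\<in>A. ?e n * c n * \<phi> n y)" if "M \<le> N" for N
    proof -
      have "ip (PN N t y) ?g = (\<Sum>n<N. ?e n * \<phi> n y * (if n \<in> A then c n else 0))"
        unfolding PN_comb using cg by (simp add: ip_comb ph)
      also have "\<dots> = (\<Sum>n\<in>A. ?e n * \<phi> n y * (if n \<in> A then c n else 0))"
        using M that by (intro sum.mono_neutral_right) (auto intro: less_le_trans)
      finally show ?thesis by (simp add: mult_ac)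
    qed
    then show ?thesis by (auto simp: eventually_sequentially)
  qed
  then have "(\<lambda>N. ip (PN N t y) ?g) \<longlonglongrightarrow> (\<Sum>n\<in>A. ?e n * c n * \<phi> n y)" by (rule tendsto_eventually)
  ultimately show ?thesis unfolding poisson_integral_def by (rule LIMSEQ_unique)
qed

text \<open>Form functions that vanish on \<open>Z\<close> are dense in L1, and each of them is the
  uniform limit of its eigenfunction expansion.\<close>

lemma comb_dense:
  assumes f: "integrable \<mu> f" and e: "0 < e"
  obtains A c where "finite A" "(LINT x|\<mu>. \<bar>f x - comb A c x\<bar>) < e"
proof -
  obtain v where v: "v \<in> Dom" "\<forall>z\<in>Z. v z = 0" "(LINT x|\<mu>. \<bar>f x - v x\<bar>) < e / 2"
    using dense_vanishing[OF finite_Z f, of "e / 2"] e by auto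
  then have vF: "v \<in> Fb" by (simp add: Fb_def)
  have "\<forall>\<^sub>F N in sequentially. \<forall>x\<in>UNIV. dist (comb {..<N} (coef v) x) (v x) < e / 2"
    using uniform_limitD[OF expansion(1)[OF vF], of "e / 2"] e by simp
  then obtain N where N: "\<And>x. dist (comb {..<N} (coef v) x) (v x) < e / 2"
    by (auto simp: eventually_sequentially)
  let ?g = "comb {..<N} (coef v)"
  have gi: "integrable \<mu> ?g" by (intro cont_int Fb_cont comb_Fb)
  have vi: "integrable \<mu> v" by (intro Dom_int v)
  have "(LINT x|\<mu>. \<bar>f x - ?g x\<bar>) \<le> (LINT x|\<mu>. \<bar>f x - v x\<bar> + e / 2)"
  proof (intro integral_mono)
    show "integrable \<mu> (\<lambda>x. \<bar>f x - ?g x\<bar>)" "integrable \<mu> (\<lambda>x. \<bar>f x - v x\<bar> + e / 2)"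
      using f gi vi by auto
    show "\<bar>f x - ?g x\<bar> \<le> \<bar>f x - v x\<bar> + e / 2" for x
      using N[of x] unfolding dist_real_def by linarith
  qed
  also have "\<dots> = (LINT x|\<mu>. \<bar>f x - v x\<bar>) + e / 2"
    using f vi prob_space by (subst Bochner_Integration.integral_add) auto
  finally have "(LINT x|\<mu>. \<bar>f x - ?g x\<bar>) < e" using v(3) by simp
  then show ?thesis by (intro that[of "{..<N}" "coef v"]) auto
qed

lemma comb_limit:
  assumes A: "finite A"
  shows "((\<lambda>(t, y). u (comb A c) t y) \<longlongrightarrow> comb A c x) (at (0, x) within nt_cone F r D d \<alpha> x)"
proof -
  let ?F = "at (0, x) within nt_cone F r D d \<alpha> x"
  have f1: "((\<lambda>p. fst p) \<longlongrightarrow> 0) ?F" using tendsto_fst[OF tendsto_ident_at, of "(0, x)"] by simp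
  have f2: "((\<lambda>p. snd p) \<longlongrightarrow> x) ?F" using tendsto_snd[OF tendsto_ident_at, of "(0, x)"] by simp
  have ph: "((\<lambda>p. \<phi> n (snd p)) \<longlongrightarrow> \<phi> n x) ?F" for n
  proof -
    have "isCont (\<phi> n) x" using phi_cont[of n] by (simp add: continuous_on_eq_continuous_at)
    then show ?thesis using f2 by (rule isCont_tendsto_compose)
  qed
  have "((\<lambda>p. \<Sum>n\<in>A. exp (- sqrt (lam n) * fst p) * c n * \<phi> n (snd p)) \<longlongrightarrow> (\<Sum>n\<in>A. exp (- sqrt (lam n) * 0) * c n * \<phi> n x)) ?F"
    by (intro tendsto_sum tendsto_mult tendsto_exp tendsto_const f1 ph)
  moreover have "(\<Sum>n\<in>A. exp (- sqrt (lam n) * 0) * c n * \<phi> n x) = comb A c x" by (simp add: comb_def)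
  moreover have "\<forall>\<^sub>F p in ?F. (\<Sum>n\<in>A. exp (- sqrt (lam n) * fst p) * c n * \<phi> n (snd p)) = (\<lambda>(t, y). u (comb A c) t y) p"
    unfolding eventually_at_filter
    by (intro always_eventually allI impI) (auto simp: nt_cone_def poisson_comb[OF _ A])
  ultimately show ?thesis using Lim_transform_eventually by fastforce
qed

text \<open>The approximations have L1 error below \<open>(1 / 4) ^ k\<close> and are compared at
  the threshold \<open>(1 / 2) ^ k\<close>. The weak type and Markov inequalities then give
  exceptional sets of summable measure, so by Borel-Cantelli almost every \<open>x\<close> lies in
  only finitely many of them; off these sets the maximal inequality controls the error on the whole
  cone.\<close>

lemma nontangential_limit:
  assumes f: "integrable \<mu> f" and \<alpha>: "0 < \<alpha>"
  shows "AE x in \<mu>. ((\<lambda>(t, y). u f t y) \<longlongrightarrow> f x) (at (0, x) within nt_cone F r D d \<alpha> x)"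
proof -
  obtain A where A: "0 < A" "\<And>f t x y. f \<in> borel_measurable \<mu> \<Longrightarrow> (t, y) \<in> nt_cone F r D d \<alpha> x \<Longrightarrow>
       ennreal \<bar>u f t y\<bar> \<le> ennreal A * MF f x"
    by (rule cone_maximal_bound[OF \<alpha>]) (rule that)
  obtain C where C: "0 < C" "\<And>f l. integrable \<mu> f \<Longrightarrow> 0 < l \<Longrightarrow> \<exists>A. open A \<and> measure \<mu> A \<le> C / l * (LINT x|\<mu>. \<bar>f x\<bar>) \<and>
        (\<forall>x. x \<notin> A \<longrightarrow> maximal_function F r D \<mu> f x \<le> ennreal l)"
    by (rule weak_type) (rule that)
  let ?l = "\<lambda>k. (1 / 2) ^ k :: real"
  have lp: "0 < ?l k" for k by simp
  have "\<exists>S c. finite S \<and> (LINT x|\<mu>. \<bar>f x - comb S c x\<bar>) < (1 / 4) ^ k" for k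
    using comb_dense[OF f, of "(1 / 4) ^ k"] by (metis zero_less_power zero_less_divide_1_iff zero_less_numeral)
  then obtain S c where Sc: "\<And>k. finite (S k)" "\<And>k. (LINT x|\<mu>. \<bar>f x - comb (S k) (c k) x\<bar>) < (1 / 4) ^ k"
    by metis
  let ?g = "\<lambda>k. comb (S k) (c k)"
  let ?h = "\<lambda>k x. f x - ?g k x"
  have gi: "integrable \<mu> (?g k)" for k by (intro cont_int Fb_cont comb_Fb)
  have hi: "integrable \<mu> (?h k)" for k using f gi by simp
  have "\<forall>k. \<exists>X. open X \<and> measure \<mu> X \<le> C / ?l k * (LINT x|\<mu>. \<bar>?h k x\<bar>) \<and> (\<forall>x. x \<notin> X \<longrightarrow> MF (?h k) x \<le> ennreal (?l k))"
    by (intro allI C(2)[OF hi lp])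
  from choice[OF this] obtain X where X': "\<forall>k. open (X k) \<and> measure \<mu> (X k) \<le> C / ?l k * (LINT x|\<mu>. \<bar>?h k x\<bar>)
      \<and> (\<forall>x. x \<notin> X k \<longrightarrow> MF (?h k) x \<le> ennreal (?l k))" by (rule exE)
  have X: "\<And>k. open (X k)" "\<And>k. measure \<mu> (X k) \<le> C / ?l k * (LINT x|\<mu>. \<bar>?h k x\<bar>)"
    "\<And>k x. x \<notin> X k \<Longrightarrow> MF (?h k) x \<le> ennreal (?l k)"
    using X' by simp_all
  let ?Y = "\<lambda>k. {x \<in> space \<mu>. ?l k \<le> \<bar>?h k x\<bar>}"
  have hm: "(\<lambda>x. \<bar>?h k x\<bar>) \<in> borel_measurable \<mu>" for k
    using borel_measurable_abs[OF borel_measurable_integrable[OF hi[of k]]] .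
  have Ym: "?Y k \<in> sets \<mu>" for k by (intro borel_measurable_le borel_measurable_const hm)
  have q: "(1 / 4) ^ k / ?l k = ?l k" for k
    by (simp add: power_divide power_mult_distrib[symmetric] field_simps)
  have bad: "measure \<mu> (X k \<union> ?Y k) \<le> (C + 1) * ?l k" for k
  proof -
    have h4: "(LINT x|\<mu>. \<bar>?h k x\<bar>) \<le> (1 / 4) ^ k" using Sc(2)[of k] by simp
    have "measure \<mu> (X k) \<le> C / ?l k * (LINT x|\<mu>. \<bar>?h k x\<bar>)" by (rule X)
    also have "\<dots> \<le> C / ?l k * (1 / 4) ^ k" using C(1) by (intro mult_left_mono h4) auto
    also have "\<dots> = C * ?l k" using q[of k] by (metis times_divide_eq_left times_divide_eq_right)
    finally have 1: "measure \<mu> (X k) \<le> C * ?l k" .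
    have "measure \<mu> (?Y k) \<le> (LINT x|\<mu>. \<bar>?h k x\<bar>) / ?l k"
      by (rule integral_Markov_inequality_measure[OF integrable_abs[OF hi], where A = "space \<mu>"]) auto
    also have "\<dots> \<le> (1 / 4) ^ k / ?l k" by (intro divide_right_mono h4) simp
    finally have 2: "measure \<mu> (?Y k) \<le> ?l k" using q[of k] by simp
    have "measure \<mu> (X k \<union> ?Y k) \<le> measure \<mu> (X k) + measure \<mu> (?Y k)"
      using X(1) Ym by (intro measure_Un_le) auto
    then show ?thesis using 1 2 by (simp add: distrib_right)
  qed
  have "AE x in \<mu>. \<forall>\<^sub>F k in sequentially. x \<in> space \<mu> - (X k \<union> ?Y k)"
  proof (rule borel_cantelli_AE1)
    show "X k \<union> ?Y k \<in> sets \<mu>" for k using X(1)[of k] Ym[of k] by auto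
    show "emeasure \<mu> (X k \<union> ?Y k) < \<infinity>" for k by (simp add: emeasure_eq_measure)
    show "summable (\<lambda>k. measure \<mu> (X k \<union> ?Y k))"
    proof (rule summable_comparison_test)
      show "summable (\<lambda>k. (C + 1) * ?l k)" by (intro summable_mult summable_geometric) simp
      show "\<exists>N. \<forall>k\<ge>N. norm (measure \<mu> (X k \<union> ?Y k)) \<le> (C + 1) * ?l k" using bad by auto
    qed
  qed
  then show ?thesis
  proof eventually_elim
    case (elim x)
    let ?F = "at (0, x) within nt_cone F r D d \<alpha> x"
    show ?case
    proof (rule tendstoI)
      fix e :: real assume e: "0 < e"
      \<comment> \<open>\<open>A * ?l k\<close> bounds the Poisson integral of the error on the
        cone, and one further \<open>?l k\<close> the error at \<open>x\<close>.\<close>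
      have "(\<lambda>k. (A + 1) * ?l k) \<longlonglongrightarrow> (A + 1) * 0"
        by (intro tendsto_mult tendsto_const LIMSEQ_realpow_zero) auto
      then have "\<forall>\<^sub>F k in sequentially. (A + 1) * ?l k < e / 2" using e by (intro order_tendstoD) auto
      from eventually_conj[OF this elim] obtain k where k: "(A + 1) * ?l k < e / 2" "x \<notin> X k" "x \<notin> ?Y k"
        by (auto simp: eventually_sequentially)
      have hx: "\<bar>?h k x\<bar> < ?l k" using k(3) by simp
      have "\<forall>\<^sub>F p in ?F. dist ((\<lambda>(t, y). u (?g k) t y) p) (?g k x) < e / 2"
        using e by (intro tendstoD[OF comb_limit[OF Sc(1)]]) simp
      moreover have "\<forall>\<^sub>F p in ?F. p \<in> nt_cone F r D d \<alpha> x"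
        unfolding eventually_at_filter by (intro always_eventually) auto
      ultimately show "\<forall>\<^sub>F p in ?F. dist ((\<lambda>(t, y). u f t y) p) (f x) < e"
      proof eventually_elim
        case (elim p)
        obtain t y where p: "p = (t, y)" by (cases p)
        have cone: "(t, y) \<in> nt_cone F r D d \<alpha> x" using elim p by simp
        have t: "0 < t" using cone by (simp add: nt_cone_def)
        have "ennreal \<bar>u (?h k) t y\<bar> \<le> ennreal A * MF (?h k) x"
          using hi[of k] by (intro A(2) cone) auto
        also have "\<dots> \<le> ennreal A * ennreal (?l k)" by (intro mult_left_mono X(3) k) simp
        also have "\<dots> = ennreal (A * ?l k)" using A(1) by (simp add: ennreal_mult')
        finally have "\<bar>u (?h k) t y\<bar> \<le> A * ?l k" using A(1) by (simp add: ennreal_le_iff)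
        moreover have "u (?h k) t y = u f t y - u (?g k) t y" by (rule poisson_diff[OF t f gi])
        moreover have "\<bar>u (?g k) t y - ?g k x\<bar> < e / 2" using elim p by (simp add: dist_real_def)
        ultimately have "\<bar>u f t y - f x\<bar> < A * ?l k + ?l k + e / 2" using hx by linarith
        also have "\<dots> < e" using k(1) by (simp add: distrib_right)
        finally show ?case by (simp add: p dist_real_def)
      qed
    qed
  qed
qed

end

section \<open>Integrability, positivity of the dimension, and both boundary conditions\<close>

lemma in_Lp_integrable:
  assumes "prob_space \<mu>" "1 \<le> p" "in_Lp \<mu> p f" shows "integrable \<mu> f"
proof -
  interpret prob_space \<mu> by fact
  have m: "f \<in> borel_measurable \<mu>" using assms(3) by (simp add: in_Lp_def)
  show ?thesis
  proof (cases "p = top")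
    case True
    then obtain C where "AE x in \<mu>. \<bar>f x\<bar> \<le> C" using assms(3) by (auto simp: in_Lp_def)
    then show ?thesis using m by (intro integrable_const_bound[of _ C]) auto
  next
    case False
    let ?q = "enn2real p"
    have q: "1 \<le> ?q"
      using enn2real_mono[OF assms(2)] False by (simp add: less_top)
    have i: "integrable \<mu> (\<lambda>x. \<bar>f x\<bar> powr ?q)" using assms(3) False by (simp add: in_Lp_def)
    have le: "\<bar>f x\<bar> \<le> 1 + \<bar>f x\<bar> powr ?q" for x
    proof (cases "\<bar>f x\<bar> \<le> 1")
      case True
      have "0 \<le> \<bar>f x\<bar> powr ?q" by simp
      with True show ?thesis by linarith
    next
      case False
      then have "\<bar>f x\<bar> powr 1 \<le> \<bar>f x\<bar> powr ?q" using q by (intro powr_mono) auto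
      then show ?thesis using False by simp
    qed
    show ?thesis
    proof (rule Bochner_Integration.integrable_bound[OF _ m])
      show "integrable \<mu> (\<lambda>x. 1 + \<bar>f x\<bar> powr ?q)" using i by simp
      show "AE x in \<mu>. norm (f x) \<le> norm (1 + \<bar>f x\<bar> powr ?q)" using le by (intro AE_I2) auto
    qed
  qed
qed

text \<open>If \<open>d \<le> 0\<close>, every summand is at least 1, so there is one letter, hence
  one code and one point. Then all functions are constants, which leaves no room for two orthonormal
  ones.\<close>

lemma dimension_pos:
  fixes F :: "'i::finite \<Rightarrow> 'a::metric_space \<Rightarrow> 'a" and r :: "'i \<Rightarrow> real" and d :: real
  assumes sss: "self_similar_structure F \<pi>" and r: "\<And>i. 0 < r i \<and> r i < 1"
    and sum: "(\<Sum>i\<in>UNIV. r i powr d) = 1" and pr: "prob_space \<mu>"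
    and cos: "complete_orthonormal_system \<mu> (\<phi> :: nat \<Rightarrow> 'a \<Rightarrow> real)"
  shows "0 < d"
proof (rule ccontr)
  assume "\<not> 0 < d"
  then have d: "d \<le> 0" by simp
  have one: "1 \<le> r i powr d" for i
    using powr_mono2'[of d "r i" 1] d r[of i] by simp
  have single: "i = j" for i j :: 'i
  proof (rule ccontr)
    assume "i \<noteq> j"
    then have "(\<Sum>k\<in>{i, j}. r k powr d) = r i powr d + r j powr d" by simp
    moreover have "(\<Sum>k\<in>{i, j}. r k powr d) \<le> (\<Sum>k\<in>UNIV. r k powr d)" by (rule sum_mono2) auto
    ultimately show False using sum one[of i] one[of j] by simp
  qed
  have const: "x = y" for x y :: 'a
  proof -
    have "surj \<pi>" using sss by (simp add: self_similar_structure_def)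
    then obtain \<omega> \<omega>' where "x = \<pi> \<omega>" "y = \<pi> \<omega>'" by (metis surj_def)
    moreover have "\<omega> = \<omega>'" by (rule ext) (rule single)
    ultimately show ?thesis by simp
  qed
  interpret prob_space \<mu> by (rule pr)
  have "(LINT x|\<mu>. \<phi> m x * \<phi> n x) = \<phi> m undefined * \<phi> n undefined" for m n
  proof -
    have "(\<lambda>x. \<phi> m x * \<phi> n x) = (\<lambda>x. \<phi> m undefined * \<phi> n undefined)"
      by (rule ext) (metis const)
    then show ?thesis by (simp add: prob_space)
  qed
  then have "\<phi> m undefined * \<phi> n undefined = (if m = n then 1 else 0)" for m n
    using cos by (simp add: complete_orthonormal_system_def)
  from this[of 0 0] this[of 1 1] this[of 0 1] show False by auto
qed

theorem theorem3p10:
  fixes F :: "'i::finite \<Rightarrow> 'a::metric_space \<Rightarrow> 'a"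
    and \<pi> :: "(nat \<Rightarrow> 'i) \<Rightarrow> 'a"
    and r :: "'i \<Rightarrow> real"
    and D :: "'a \<Rightarrow> 'a \<Rightarrow> real"
    and d \<alpha> :: real
    and \<mu> :: "'a measure"
    and lam :: "boundary_condition \<Rightarrow> nat \<Rightarrow> real"
    and \<phi> :: "boundary_condition \<Rightarrow> nat \<Rightarrow> 'a \<Rightarrow> real"
  assumes "self_similar_structure F \<pi>"
    and "post_critically_finite F \<pi>" and "V0 F \<noteq> {}"
    and "regular_harmonic_structure F r D"
    and "resistance_metrizes F r D"
    and "(\<Sum>i\<in>UNIV. r i powr d) = 1"
    and "self_similar_measure F (\<lambda>i. r i powr d) \<mu>"
    and "\<And>b. eigensystem F r D \<mu> b (lam b) (\<phi> b)"
    and "0 < \<alpha>"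
  shows "(\<exists>A>0. \<forall>b (p::ennreal) f x. 1 \<le> p \<longrightarrow> in_Lp \<mu> p f \<longrightarrow>
           (SUP (t, y)\<in>nt_cone F r D d \<alpha> x. ennreal \<bar>poisson_integral \<mu> (lam b) (\<phi> b) f t y\<bar>)
             \<le> ennreal A * maximal_function F r D \<mu> f x) \<and>
         (\<forall>b (p::ennreal) f. 1 \<le> p \<longrightarrow> in_Lp \<mu> p f \<longrightarrow>
           (AE x in \<mu>.
              ((\<lambda>(t, y). poisson_integral \<mu> (lam b) (\<phi> b) f t y) \<longlongrightarrow> f x)
                (at (0, x) within nt_cone F r D d \<alpha> x)))"
proof -
  have pr: "prob_space \<mu>" using assms(7) by (simp add: self_similar_measure_def)
  have cos: "complete_orthonormal_system \<mu> (\<phi> b)" for b using assms(8)[of b] by (simp add: eigensystem_def)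
  have r01: "0 < r i \<and> r i < 1" for i using assms(4) by (simp add: regular_harmonic_structure_def)
  have d: "0 < d" by (rule dimension_pos[OF assms(1) r01 assms(6) pr cos])
  interpret pcf_measure F \<pi> r D d \<mu>
    by unfold_locales (rule assms d)+
  \<comment> \<open>The Neumann condition forces no zeros; it is expressed by testing with all of
    \<open>Dom\<close>.\<close>
  define Z where "Z b = (case b of Dirichlet \<Rightarrow> V0 F | Neumann \<Rightarrow> {})" for b
  have eig: "pcf_eigen F \<pi> r D d \<mu> (lam b) (\<phi> b) (Z b)" for b
  proof unfold_locales
    note es = assms(8)[of b, unfolded eigensystem_def]
    have dl: "\<phi> b n \<in> dom_laplacian F r D \<mu> b" and hl: "has_laplacian F r D \<mu> (\<phi> b n) (\<lambda>x. - lam b n * \<phi> b n x)" for n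
      using es by auto
    show "finite (Z b)" by (cases b) (simp_all add: Z_def)
    show "0 \<le> lam b n" for n using es by blast
    show phD: "\<phi> b n \<in> Dom" for n using hl[of n] by (simp add: has_laplacian_def)
    show "\<phi> b n z = 0" if "z \<in> Z b" for n z
      using dl[of n] that by (cases b) (auto simp: Z_def)
    show "complete_orthonormal_system \<mu> (\<phi> b)" by (rule cos)
    fix v n assume v: "v \<in> Dom" "\<forall>z\<in>Z b. v z = 0"
    have D0eq: "En (\<phi> b n) w = - (LINT x|\<mu>. - lam b n * \<phi> b n x * w x)" if "w \<in> Dom" "\<forall>z\<in>V0 F. w z = 0" for w
      using hl[of n] that unfolding has_laplacian_def dom_energy0_def by blast
    show "En (\<phi> b n) v = lam b n * (LINT x|\<mu>. \<phi> b n x * v x)"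
    proof (cases b)
      case Dirichlet
      then show ?thesis using D0eq[OF v(1)] v(2) by (simp add: Z_def mult.assoc)
    next
      case Neumann
      then obtain \<eta> where \<eta>: "has_neumann_derivative F r D \<mu> (\<phi> b n) \<eta>" "\<forall>p\<in>V0 F. \<eta> p = 0"
        using dl[of n] by auto
      then obtain g where g: "has_laplacian F r D \<mu> (\<phi> b n) g"
        "\<forall>v\<in>Dom. En (\<phi> b n) v = (\<Sum>p\<in>V0 F. v p * \<eta> p) - (LINT x|\<mu>. v x * g x)"
        unfolding has_neumann_derivative_def by blast
      have cg: "continuous_on UNIV g" using g(1) by (simp add: has_laplacian_def)
      have cp: "continuous_on UNIV (\<phi> b n)" by (rule Dom_cont[OF phD])
      \<comment> \<open>The Neumann clause comes with its own function \<open>g\<close>; testing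
        with functions that vanish on the boundary identifies it with minus the eigenvalue times the
        eigenfunction.\<close>
      have "g x + lam b n * \<phi> b n x = 0" for x
      proof (rule cont_orthogonal_zero[OF finite_V])
        show "continuous_on UNIV (\<lambda>x. g x + lam b n * \<phi> b n x)" using cg cp by (intro continuous_intros)
        fix w assume w: "w \<in> Dom" "\<forall>z\<in>V0 F. w z = 0"
        have cw: "continuous_on UNIV w" by (rule Dom_cont[OF w(1)])
        have "En (\<phi> b n) w = - (LINT x|\<mu>. g x * w x)"
          using g(1) w unfolding has_laplacian_def dom_energy0_def by blast
        then have "(LINT x|\<mu>. g x * w x) + lam b n * (LINT x|\<mu>. \<phi> b n x * w x) = 0"
          using D0eq[OF w] by (simp add: mult.assoc)
        moreover have "(LINT x|\<mu>. (g x + lam b n * \<phi> b n x) * w x)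
            = (LINT x|\<mu>. g x * w x) + lam b n * (LINT x|\<mu>. \<phi> b n x * w x)"
          unfolding distrib_right mult.assoc using cg cp cw
          by (subst Bochner_Integration.integral_add) (auto intro!: cont_int continuous_intros)
        ultimately show "(LINT x|\<mu>. (g x + lam b n * \<phi> b n x) * w x) = 0" by simp
      qed
      then have geq: "g = (\<lambda>x. - (lam b n * \<phi> b n x))" by (auto simp: fun_eq_iff add_eq_0_iff2)
      have "En (\<phi> b n) v = - (LINT x|\<mu>. v x * g x)" using g(2) v(1) \<eta>(2) by simp
      also have "(LINT x|\<mu>. v x * g x) = (LINT x|\<mu>. - lam b n * (\<phi> b n x * v x))"
        unfolding geq by (intro Bochner_Integration.integral_cong refl) (simp add: mult_ac)
      also have "\<dots> = - lam b n * (LINT x|\<mu>. \<phi> b n x * v x)" by (rule integral_mult_right_zero)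
      finally show ?thesis by simp
    qed
  qed
  have "\<exists>A>0. \<forall>f t x y. f \<in> borel_measurable \<mu> \<longrightarrow> (t, y) \<in> nt_cone F r D d \<alpha> x \<longrightarrow>
       ennreal \<bar>poisson_integral \<mu> (lam b) (\<phi> b) f t y\<bar> \<le> ennreal A * maximal_function F r D \<mu> f x" for b
    by (rule pcf_eigen.cone_maximal_bound[OF eig[of b] assms(9)]) blast
  then obtain A where A: "\<And>b. 0 < A b" "\<And>b f t x y. f \<in> borel_measurable \<mu> \<Longrightarrow> (t, y) \<in> nt_cone F r D d \<alpha> x \<Longrightarrow>
       ennreal \<bar>poisson_integral \<mu> (lam b) (\<phi> b) f t y\<bar> \<le> ennreal (A b) * maximal_function F r D \<mu> f x"
    by metis
  have Ab: "A b \<le> A Dirichlet + A Neumann" for b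
    using A(1)[of Dirichlet] A(1)[of Neumann] by (cases b) auto
  have 1: "(SUP (t, y)\<in>nt_cone F r D d \<alpha> x. ennreal \<bar>poisson_integral \<mu> (lam b) (\<phi> b) f t y\<bar>)
             \<le> ennreal (A Dirichlet + A Neumann) * maximal_function F r D \<mu> f x" if "in_Lp \<mu> p f" for b p f x
  proof (rule SUP_least)
    fix ty assume "ty \<in> nt_cone F r D d \<alpha> x"
    moreover obtain t y where ty: "ty = (t, y)" by (cases ty)
    moreover have "f \<in> borel_measurable \<mu>" using that by (simp add: in_Lp_def)
    ultimately have "ennreal \<bar>poisson_integral \<mu> (lam b) (\<phi> b) f t y\<bar> \<le> ennreal (A b) * maximal_function F r D \<mu> f x"
      by (intro A(2)) auto
    also have "\<dots> \<le> ennreal (A Dirichlet + A Neumann) * maximal_function F r D \<mu> f x"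
      by (intro mult_right_mono ennreal_leI Ab) simp
    finally show "(case ty of (t, y) \<Rightarrow> ennreal \<bar>poisson_integral \<mu> (lam b) (\<phi> b) f t y\<bar>)
       \<le> ennreal (A Dirichlet + A Neumann) * maximal_function F r D \<mu> f x" by (simp add: ty)
  qed
  have 2: "AE x in \<mu>. ((\<lambda>(t, y). poisson_integral \<mu> (lam b) (\<phi> b) f t y) \<longlongrightarrow> f x)
                (at (0, x) within nt_cone F r D d \<alpha> x)" if "1 \<le> p" "in_Lp \<mu> p f" for b p f
    by (rule pcf_eigen.nontangential_limit[OF eig in_Lp_integrable[OF pr that] assms(9)])
  have "0 < A Dirichlet + A Neumann" using A(1) by (simp add: add_pos_pos)
  with 1 2 show ?thesis by blast
qed

end
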